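(* Let $V\in\mathcal V^*$ and let $\bar y=(\bar q,\bar p)$, $|\bar q|\le\bar R$, be an initial condition leading to collision for the system $P(0)$ at time $T_0$. Then $$\lim_{\substack{y\to\bar y\\ \varepsilon\to0}}\Phi_T(y,\varepsilon)=\Phi_T(\bar y,0)$$ for every $T>T_0$ (in the interval $(T_0,2T_0)$ on which the extended solution $y_0=(x_0,\dot x_0)$ issuing from $\bar y$ is defined) such that $\dot x_0(T)\ne0$.
   Context: **The classes $\mathcal V$ and $\mathcal V^*$.** $\mathcal V$ is the set of functions $V\in C^\infty(\mathbb R^+,\mathbb R)$, $\mathbb R^+=(0,\infty)$, such that (i) $\lim_{x\to0^+}V(x)=+\infty$; there exists $S\in(0,+\infty]$ such that on $(0,S)$: (ii) $V'(x)<0$ and $V''(x)>0$; (iii) $V'(x)/V''(x)$ is decreasing in $x$; and (iv) $\frac{d}{dx}\frac{V'(x)}{V''(x)}\big|_{x=0}<-\frac12$ (right derivative at $0$ of the function $V'/V''$ extended by continuity to $x=0$). $\mathcal V^*$ is the set of $V\in\mathcal V$ such that (v) $\lim_{\lambda\to0^+}V(\lambda x)/V(\lambda)=1$ for every $x\ge1$, uniformly on every compact $[1,M]$. By (iii), (iv) there is $T_*\in(0,+\infty]$ with $V'(x)/V''(x)\le -x/2$ on $(0,T_* )$. With such $S,T_*$ fixed, $\bar R:=\min\{T_*,S\}$. For $\varepsilon>0$, $V_\varepsilon(x)=V(\sqrt{x^2+\varepsilon^2})$, and $V_0=V$. **Systems and flows.** The phase space is $\mathcal F=\{y=(x,\dot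 x)\in\mathbb R^2\times\mathbb R^2\}$. For $\varepsilon\geq0$, $P(\varepsilon)$ is the initial value problem $y'=f_\varepsilon(y)$, $y(0)=y$, with $f_\varepsilon(x,\dot x)=(\dot x,\nabla V_\varepsilon(|x|))$ (gradient with respect to $x\in\mathbb R^2$; initial position $\neq0$ if $\varepsilon=0$). An initial datum leads to collision for $P(0)$ at time $T_0$ if the solution of $P(0)$ exists on $[0,T_0)$ and its position tends to $0$ as $t\to T_0^-$. For the datum $\bar y$ it is assumed that the collision solution satisfies $|\bar x(t)|\le\bar R$ for $t\in[0,T_0)$. **Transmission extension.** If $(\bar x(t),\dot{\bar x}(t))$, $t\in[0,T_0)$, is a solution of $P(0)$ colliding at time $T_0$, it is extended past the collision by $y_0(t)=(x_0(t),\dot x_0(t))$, where $y_0(t)=(\bar x(t),\dot{\bar x}(t))$ for $t\in[0,T_0)$ and $x_0(t)=-\bar x(2T_0-t)$, $\dot x_0(t)=\dot{\bar x}(2T_0-t)$ for $t\in(T_0,2T_0)$. $\Phi_T(y,\varepsilon)$ is the solution at time $T$ of $P(\varepsilon)$ with initial datum $y$, where for $\varepsilon=0$ and $y$ leading to collision the extended solution above is used. The limit is the joint limit $y\to\bar y$ in $\mathcal F$, $\varepsilon\to0$, $\varepsilon\ge0$. *)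

theory Defs
  imports "HOL-Analysis.Analysis"
begin

definition ratio :: "(real \<Rightarrow> real) \<Rightarrow> real \<Rightarrow> real" where
  "ratio V x = deriv V x / deriv (deriv V) x"

definition smooth_pos :: "(real \<Rightarrow> real) \<Rightarrow> bool" where
  "smooth_pos V \<longleftrightarrow> (\<forall>n. \<forall>x>0. ((deriv ^^ n) V) differentiable (at x))"

text \<open>The last clause says that the continuous extension of \<open>ratio V\<close> to \<open>0\<close> (with value \<open>L\<close>)
  has a right derivative \<open>D < -1/2\<close> at \<open>0\<close>. Decreasing is meant in the weak sense.\<close>

definition admissible_S :: "(real \<Rightarrow> real) \<Rightarrow> ereal \<Rightarrow> bool" where
  "admissible_S V S \<longleftrightarrow> 0 < S \<and>
     (\<forall>x>0. ereal x < S \<longrightarrow> deriv V x < 0 \<and> deriv (deriv V) x > 0) \<and>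
     antimono_on {x. 0 < x \<and> ereal x < S} (ratio V) \<and>
     (\<exists>L D. (ratio V \<longlongrightarrow> L) (at_right 0) \<and>
        (((ratio V)(0 := L)) has_real_derivative D) (at_right 0) \<and> D < - 1 / 2)"

definition class_V :: "(real \<Rightarrow> real) set" where
  "class_V = {V. smooth_pos V \<and> filterlim V at_top (at_right 0) \<and> (\<exists>S. admissible_S V S)}"

definition class_V_star :: "(real \<Rightarrow> real) set" where
  "class_V_star = {V \<in> class_V. \<forall>M\<ge>1.
     uniform_limit {1..M} (\<lambda>l x. V (l * x) / V l) (\<lambda>x. 1) (at_right 0)}"

definition admissible_T :: "(real \<Rightarrow> real) \<Rightarrow> ereal \<Rightarrow> bool" where
  "admissible_T V Ts \<longleftrightarrow> 0 < Ts \<and> (\<forall>x>0. ereal x < Ts \<longrightarrow> ratio V x \<le> - x / 2)"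

definition V_eps :: "(real \<Rightarrow> real) \<Rightarrow> real \<Rightarrow> real \<Rightarrow> real" where
  "V_eps V \<epsilon> r = V (sqrt (r\<^sup>2 + \<epsilon>\<^sup>2))"

type_synonym phase = "(real ^ 2) \<times> (real ^ 2)"

definition gradient :: "(real ^ 2 \<Rightarrow> real) \<Rightarrow> real ^ 2 \<Rightarrow> real ^ 2" where
  "gradient f x = (THE D. gderiv f x D)"

definition force_field :: "(real \<Rightarrow> real) \<Rightarrow> real \<Rightarrow> phase \<Rightarrow> phase" where
  "force_field V \<epsilon> y = (snd y, gradient (\<lambda>q. V_eps V \<epsilon> (norm q)) (fst y))"

text \<open>For \<open>\<epsilon> = 0\<close> the origin of the configuration plane is excluded from the domain.\<close>

definition solves :: "(real \<Rightarrow> real) \<Rightarrow> real \<Rightarrow> phase \<Rightarrow> real set \<Rightarrow> (real \<Rightarrow> phase) \<Rightarrow> bool" where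
  "solves V \<epsilon> y I u \<longleftrightarrow> u 0 = y \<and>
     (\<forall>t\<in>I. (\<epsilon> = 0 \<longrightarrow> fst (u t) \<noteq> 0) \<and>
            (u has_vector_derivative force_field V \<epsilon> (u t)) (at t within I))"

definition collides :: "(real \<Rightarrow> real) \<Rightarrow> phase \<Rightarrow> real \<Rightarrow> (real \<Rightarrow> phase) \<Rightarrow> bool" where
  "collides V y T0 u \<longleftrightarrow> 0 < T0 \<and> solves V 0 y {0..<T0} u \<and>
     ((\<lambda>t. fst (u t)) \<longlongrightarrow> 0) (at_left T0)"

text \<open>Only meaningful for \<open>t\<close> in \<open>[0, T0)\<close> or in \<open>(T0, 2 T0)\<close>; at the collision time
  itself the velocity is undefined.\<close>

definition transmission :: "real \<Rightarrow> (real \<Rightarrow> phase) \<Rightarrow> real \<Rightarrow> phase" where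
  "transmission T0 u t =
     (if t < T0 then u t else (- fst (u (2 * T0 - t)), snd (u (2 * T0 - t))))"

text \<open>\<open>flow_at V T y \<epsilon> z\<close>: the solution issuing from \<open>y\<close>, extended past a collision if
  \<open>\<epsilon> = 0\<close>, is defined at time \<open>T\<close> and equals \<open>z\<close> there. It is a relation because for a given
  datum the solution need not be defined at time \<open>T\<close> (finite-time blow-up, \<open>T\<close> equal to the
  collision time or at least twice the collision time).\<close>

definition flow_at :: "(real \<Rightarrow> real) \<Rightarrow> real \<Rightarrow> phase \<Rightarrow> real \<Rightarrow> phase \<Rightarrow> bool" where
  "flow_at V T y \<epsilon> z \<longleftrightarrow>
     (\<exists>u. solves V \<epsilon> y {0..T} u \<and> u T = z) \<or>
     (\<epsilon> = 0 \<and> (\<exists>T0 u. collides V y T0 u \<and> T0 < T \<and> T < 2 * T0 \<and> z = transmission T0 u T))"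

definition Phi :: "(real \<Rightarrow> real) \<Rightarrow> real \<Rightarrow> phase \<Rightarrow> real \<Rightarrow> phase" where
  "Phi V T y \<epsilon> = (THE z. flow_at V T y \<epsilon> z)"

end

theory Submission
  imports Defs
begin

text \<open>Slow variation of \<open>V\<close> and convexity give \<open>s V'(s) / V(s) \<rightarrow> 0\<close> as \<open>s \<rightarrow> 0\<close>; this is all
  that the argument uses about the singularity. Along a solution passing close to the origin let
  \<open>c\<close> be the angular momentum. The direction of the velocity turns at rate
  \<open>|V' s| c / (s |v|\<^sup>2)\<close>, a small multiple of the rate \<open>c / |x|\<^sup>2\<close> at which the position turns, and
  this forces the total turning of the velocity to be small: the solution crosses almost along a
  straight line. Its motion along that line is compared with the radial collision orbit
  through the time function \<open>\<integral> d\<xi> / sqrt (2 (V |\<xi>| + E))\<close>, whose integrand extends continuously by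
  \<open>0\<close> to the collision, so the transit time converges as well. Before and after the passage the
  flow is regular, and solutions with \<open>c = 0\<close> and \<open>\<epsilon> = 0\<close> collide at a time close to \<open>T0\<close>.\<close>

section \<open>Lipschitz differential equations\<close>

text \<open>The obstacle is that the speed is infinite at the collision, so closeness of states
  cannot be carried through it. What can be carried are quantities that stay bounded there: energy,
  angular momentum and \<epsilon>, all conserved, the direction of the velocity, the distance from
  the axis of the collision orbit, and the value of \<open>travel\<close> at the axial position.
  Away from the origin these determine the state continuously, so closeness of states is recovered
  at the exit. Existence during the passage cannot be taken for granted either. An orbit that ceases
  to exist must leave every annulus \<open>{m..1/m}\<close> of radii. The upper bound on the radius
  comes from the passage estimates themselves. A lower bound is available if \<epsilon> is nonzero,
  or if the angular momentum is nonzero, by a centrifugal barrier. Data with both equal to zero are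
  continued by the transmission rule at their own collision time. Both kinds of data accumulate at
  the given one, and their limits agree because the transmitted branch is the time reflection of the
  incoming one.\<close>

lemma lipschitz_ode_dependence:
  fixes u v :: "real \<Rightarrow> 'a::euclidean_space"
  assumes lip: "\<And>x y. norm (f x - f y) \<le> L * norm (x - y)"
    and u: "\<And>t. t \<in> {a..b} \<Longrightarrow> (u has_vector_derivative f (u t)) (at t within {a..b})"
    and v: "\<And>t. t \<in> {a..b} \<Longrightarrow> (v has_vector_derivative f (v t)) (at t within {a..b})"
    and t: "t \<in> {a..b}"
  shows "norm (u t - v t) \<le> exp (L * (t - a)) * norm (u a - v a)"
proof -
  \<comment> \<open>Gronwall in differential form: the weight absorbs the growth rate 2L of the
    squared distance, so \<open>h\<close> does not increase. The squared norm is differentiable also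
    where \<open>u\<close> and \<open>v\<close> meet.\<close>
  define h where "h = (\<lambda>s. exp (- 2 * L * (s - a)) * ((u s - v s) \<bullet> (u s - v s)))"
  have der: "(h has_derivative (\<lambda>r. r * (exp (- 2 * L * (s - a)) *
      (2 * ((u s - v s) \<bullet> (f (u s) - f (v s))) - 2 * L * ((u s - v s) \<bullet> (u s - v s))))))
      (at s within {a..t})" if "a \<le> s" "s \<le> t" for s
  proof -
    have "(u has_vector_derivative f (u s)) (at s within {a..t})"
      "(v has_vector_derivative f (v s)) (at s within {a..t})"
      by (rule has_vector_derivative_within_subset[OF u] has_vector_derivative_within_subset[OF v];
          use that t in auto)+
    then show ?thesis
      unfolding h_def has_vector_derivative_def
      by (auto intro!: derivative_eq_intros simp: inner_commute algebra_simps)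
  qed
  obtain s where s: "h t - h a = (t - a) * (exp (- 2 * L * (s - a)) *
      (2 * ((u s - v s) \<bullet> (f (u s) - f (v s))) - 2 * L * ((u s - v s) \<bullet> (u s - v s))))"
    using mvt_very_simple[of a t h, OF _ der] t by auto
  have "(u s - v s) \<bullet> (f (u s) - f (v s)) \<le> norm (u s - v s) * norm (f (u s) - f (v s))"
    by (rule norm_cauchy_schwarz)
  also have "\<dots> \<le> norm (u s - v s) * (L * norm (u s - v s))"
    by (rule mult_left_mono[OF lip]) simp
  also have "\<dots> = L * ((u s - v s) \<bullet> (u s - v s))"
    by (simp add: dot_square_norm power2_eq_square)
  finally have "2 * ((u s - v s) \<bullet> (f (u s) - f (v s))) - 2 * L * ((u s - v s) \<bullet> (u s - v s)) \<le> 0"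
    by simp
  then have "h t \<le> h a"
    using s t by (smt (verit) atLeastAtMost_iff exp_gt_zero mult_nonneg_nonpos)
  then have "exp (- 2 * L * (t - a)) * (norm (u t - v t))\<^sup>2 \<le> (norm (u a - v a))\<^sup>2"
    by (simp add: h_def dot_square_norm)
  moreover have "exp (- 2 * L * (t - a)) = (exp (- (L * (t - a))))\<^sup>2"
    using exp_double[of "- (L * (t - a))"] by (simp add: mult.assoc)
  ultimately have "(exp (- (L * (t - a))) * norm (u t - v t))\<^sup>2 \<le> (norm (u a - v a))\<^sup>2"
    by (simp only: power_mult_distrib)
  then have "exp (- (L * (t - a))) * norm (u t - v t) \<le> norm (u a - v a)"
    by (rule power2_le_imp_le) simp
  then show ?thesis
    by (simp add: exp_minus divide_simps mult.commute)
qed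

text \<open>Against the weight \<open>exp (K * (s - a))\<close> integration gains a factor 1/K,
  however long the interval. This gain makes the Picard operator a contraction on a
  half-line.\<close>

lemma norm_integral_le_exp:
  fixes h :: "real \<Rightarrow> 'a::banach"
  assumes "a \<le> t" "0 < K" and cont: "continuous_on {a..t} h"
    and bound: "\<And>s. a \<le> s \<Longrightarrow> norm (h s) \<le> C * exp (K * (s - a))"
  shows "norm (integral {a..t} h) \<le> C / K * exp (K * (t - a))"
proof -
  have "C \<ge> 0" using bound[of a] by (simp add: order_trans[OF norm_ge_zero])
  have hi: "((\<lambda>s. C * exp (K * (s - a))) has_integral C / K * exp (K * (t - a)) - C / K * exp (K * (a - a))) {a..t}"
    using \<open>0 < K\<close>
    by (intro fundamental_theorem_of_calculus \<open>a \<le> t\<close>)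
       (auto intro!: derivative_eq_intros simp flip: has_real_derivative_iff_has_vector_derivative)
  have "norm (integral {a..t} h) \<le> C / K * exp (K * (t - a)) - C / K"
    using integral_norm_bound_integral[OF integrable_continuous_real[OF cont] has_integral_integrable[OF hi]]
      bound integral_unique[OF hi] by auto
  then show ?thesis using \<open>C \<ge> 0\<close> \<open>0 < K\<close>
    by (smt (verit) divide_nonneg_pos)
qed

text \<open>Picard iteration in Bielecki's weighted norm: the unknown is
  \<open>exp (- K * (t - a)) *\<^sub>R u t\<close>, a bounded continuous function, so a single use
  of Banach's theorem gives the solution on all of \<open>{a..}\<close> without gluing.\<close>

lemma lipschitz_ode_exists:
  fixes f :: "'a::euclidean_space \<Rightarrow> 'a" and a :: real
  assumes lip: "\<And>x y. norm (f x - f y) \<le> L * norm (x - y)"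
  obtains u where "u a = z" "\<And>t. a \<le> t \<Longrightarrow> (u has_vector_derivative f (u t)) (at t within {a..})"
proof -
  define M where "M = \<bar>L\<bar> + 1"
  have M: "0 < M" by (simp add: M_def)
  have lipM: "norm (f x - f y) \<le> M * norm (x - y)" for x y
    by (rule order_trans[OF lip]) (intro mult_right_mono, auto simp: M_def)
  then have contf: "continuous_on UNIV f"
    by (intro lipschitz_on_continuous_on[of M] lipschitz_onI) (use M in \<open>auto simp: dist_norm\<close>)
  \<comment> \<open>Integration gains 1/K against the Lipschitz constant \<open>M\<close>, so this
    choice contracts by 1/2.\<close>
  define K where "K = 2 * M"
  have K: "0 < K" using M by (simp add: K_def)
  define g where "g = (\<lambda>(b :: real \<Rightarrow>\<^sub>C 'a) s. f (exp (K * (s - a)) *\<^sub>R b s))"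
  have contg: "continuous_on I (g b)" for I b
    unfolding g_def by (intro continuous_on_compose2[OF contf] continuous_intros) auto
  \<comment> \<open>Elements of the function space live on the whole real line;
    \<open>max a t\<close> freezes them to the left of \<open>a\<close>, where nothing is
    claimed.\<close>
  define G where "G = (\<lambda>b t. integral {a..max a t} (g b))"
  have contG: "continuous_on UNIV (G b)" for b
  proof -
    have "continuous_on {..<T} (G b)" for T
    proof -
      have "continuous_on {a..max a T} (\<lambda>t. integral {a..t} (g b))"
        by (intro indefinite_integral_continuous_1 integrable_continuous_real contg)
      then show ?thesis
        unfolding G_def
        by (rule continuous_on_compose2) (auto intro!: continuous_intros)
    qed
    then have "isCont (G b) t" for t
      by (meson continuous_on_eq_continuous_at gt_ex lessThan_iff open_lessThan)
    then show ?thesis by (simp add: continuous_at_imp_continuous_on)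
  qed
  define P where "P = (\<lambda>b t. exp (- K * (max a t - a)) *\<^sub>R (z + G b t))"
  have exp1: "exp (- K * (max a t - a)) \<le> 1" for t
    using K by simp
  have cancel: "exp (- K * x) * (q * exp (K * x)) = q" for x q
    using mult_exp_exp[of "- K * x" "K * x"] by (simp add: mult.left_commute)
  have Gb: "norm (G b t) \<le> (norm (f 0) + M * norm b) / K * exp (K * (max a t - a))" for b t
    unfolding G_def
  proof (rule norm_integral_le_exp)
    fix s assume "a \<le> s"
    have e: "1 \<le> exp (K * (s - a))" using K \<open>a \<le> s\<close> by simp
    have "norm (g b s) \<le> norm (f 0) + norm (g b s - f 0)"
      by (metis add.commute diff_add_cancel norm_triangle_ineq)
    also have "\<dots> \<le> norm (f 0) + M * (exp (K * (s - a)) * norm b)"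
      using lipM[of "exp (K * (s - a)) *\<^sub>R b s" 0] M norm_bounded[of b s]
      by (smt (verit) diff_zero exp_ge_zero g_def mult_left_mono norm_scaleR norm_exp real_norm_def)
    also have "\<dots> \<le> (norm (f 0) + M * norm b) * exp (K * (s - a))"
      using e mult_left_mono[OF e, of "norm (f 0)"] by (simp add: algebra_simps)
    finally show "norm (g b s) \<le> (norm (f 0) + M * norm b) * exp (K * (s - a))" .
  qed (use K contg in auto)
  have "P b \<in> bcontfun" for b
  proof (rule bcontfun_normI)
    show "continuous_on UNIV (P b)"
      unfolding P_def by (intro continuous_intros contG)
    show "norm (P b t) \<le> norm z + (norm (f 0) + M * norm b) / K" for t
    proof -
      have "norm (P b t) \<le> exp (- K * (max a t - a)) * (norm z + norm (G b t))"
        unfolding P_def by (simp add: norm_triangle_ineq)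
      also have "\<dots> \<le> exp (- K * (max a t - a)) * norm z + exp (- K * (max a t - a)) * ((norm (f 0) + M * norm b) / K * exp (K * (max a t - a)))"
        unfolding distrib_left by (intro add_left_mono mult_left_mono Gb) simp
      also have "\<dots> = exp (- K * (max a t - a)) * norm z + (norm (f 0) + M * norm b) / K"
        unfolding cancel ..
      also have "\<dots> \<le> norm z + (norm (f 0) + M * norm b) / K"
        using mult_right_mono[OF exp1[of t] norm_ge_zero[of z]] by simp
      finally show ?thesis .
    qed
  qed
  moreover define Q where "Q = (\<lambda>b. Bcontfun (P b))"
  ultimately have Q: "apply_bcontfun (Q b) = P b" for b
    by (simp add: Bcontfun_inverse)
  have contr: "dist (Q b) (Q c) \<le> 1 / 2 * dist b c" for b c
  proof (rule dist_bound)
    fix t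
    have "norm (integral {a..max a t} (\<lambda>s. g b s - g c s)) \<le> (M * dist b c) / K * exp (K * (max a t - a))"
    proof (rule norm_integral_le_exp)
      fix s
      have "norm (g b s - g c s) \<le> M * (exp (K * (s - a)) * norm (b s - c s))"
        unfolding g_def using lipM[of "exp (K * (s - a)) *\<^sub>R b s" "exp (K * (s - a)) *\<^sub>R c s"]
        by (simp flip: scaleR_diff_right)
      also have "\<dots> \<le> M * (exp (K * (s - a)) * dist b c)"
        using dist_bounded[of b s c] M by (simp add: dist_norm)
      finally show "norm (g b s - g c s) \<le> M * dist b c * exp (K * (s - a))"
        by (simp add: algebra_simps)
    qed (use K in \<open>auto intro!: continuous_intros contg\<close>)
    also have "integral {a..max a t} (\<lambda>s. g b s - g c s) = G b t - G c t"
      unfolding G_def by (intro integral_diff integrable_continuous_real contg)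
    finally have "exp (- K * (max a t - a)) * norm (G b t - G c t)
       \<le> exp (- K * (max a t - a)) * ((M * dist b c) / K * exp (K * (max a t - a)))"
      by (intro mult_left_mono) auto
    also have "\<dots> = 1 / 2 * dist b c"
      unfolding cancel using M by (simp add: K_def)
    finally show "dist (Q b t) (Q c t) \<le> 1 / 2 * dist b c"
      by (simp add: Q P_def dist_norm flip: scaleR_diff_right)
  qed
  then obtain b where b: "Q b = b"
    using banach_fix_type[of "1/2" Q] by auto
  define u where "u = (\<lambda>t. exp (K * (t - a)) *\<^sub>R b t)"
  have ug: "g b = (\<lambda>s. f (u s))" by (simp add: g_def u_def)
  have u: "u t = z + integral {a..t} (\<lambda>s. f (u s))" if "a \<le> t" for t
  proof -
    have "b t = exp (- K * (t - a)) *\<^sub>R (z + integral {a..t} (\<lambda>s. f (u s)))"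
      using fun_cong[OF Q[of b], of t] that unfolding b by (simp add: P_def G_def ug max_def)
    then show ?thesis by (simp add: u_def exp_minus)
  qed
  show ?thesis
  proof (rule that[of u])
    show "u a = z" using u[of a] by simp
    fix t assume t: "a \<le> t"
    have "((\<lambda>t. z + integral {a..t} (\<lambda>s. f (u s))) has_vector_derivative f (u t)) (at t within {a..t+1})"
      using integral_has_vector_derivative[OF contg[of "{a..t+1}" b], of t] t unfolding ug
      by (auto intro!: derivative_eq_intros)
    then have "(u has_vector_derivative f (u t)) (at t within {a..t+1})"
      by (rule has_vector_derivative_transform[rotated 2]) (use t u in auto)
    moreover have "at t within {a..t+1} = at t within {a..}"
      by (rule at_within_nhd[of t "{..<t+1}"]) auto
    ultimately show "(u has_vector_derivative f (u t)) (at t within {a..})" by simp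
  qed
qed

section \<open>Newton's equation with the regularization as a coordinate\<close>

text \<open>The regularization parameter is carried along as a third position coordinate with zero
  velocity: a state is \<open>((x, \<epsilon>), v)\<close>, and \<open>sqrt (|x|\<^sup>2 + \<epsilon>\<^sup>2)\<close> is the norm of \<open>(x, \<epsilon>)\<close>.\<close>

type_synonym 'a state = "('a \<times> real) \<times> 'a"

abbreviation pos :: "'a state \<Rightarrow> 'a" where "pos z \<equiv> fst (fst z)"
abbreviation vel :: "'a state \<Rightarrow> 'a" where "vel z \<equiv> snd z"
abbreviation radius :: "'a::euclidean_space state \<Rightarrow> real" where "radius z \<equiv> norm (fst z)"

definition newton :: "(real \<Rightarrow> real) \<Rightarrow> 'a::euclidean_space state \<Rightarrow> 'a state" where
  "newton V z = ((vel z, 0), (deriv V (radius z) / radius z) *\<^sub>R pos z)"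

text \<open>Positivity of the radius expresses the domain for all \<epsilon> at once: it excludes
  the origin when \<epsilon> = 0 and is automatic otherwise.\<close>

definition orbit :: "(real \<Rightarrow> real) \<Rightarrow> real set \<Rightarrow> (real \<Rightarrow> 'a::euclidean_space state) \<Rightarrow> bool" where
  "orbit V I U \<longleftrightarrow> (\<forall>t\<in>I. 0 < radius (U t) \<and> (U has_vector_derivative newton V (U t)) (at t within I))"

definition energy :: "(real \<Rightarrow> real) \<Rightarrow> 'a::euclidean_space state \<Rightarrow> real" where
  "energy V z = (vel z \<bullet> vel z) / 2 - V (radius z)"

text \<open>By Lagrange's identity this is the squared norm of the wedge product of position and
  velocity, in the plane the square of the angular momentum. The formula makes sense in every
  dimension.\<close>

definition sq_momentum :: "'a::euclidean_space state \<Rightarrow> real" where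
  "sq_momentum z = (pos z \<bullet> pos z) * (vel z \<bullet> vel z) - (pos z \<bullet> vel z)\<^sup>2"

lemma has_real_derivative_inner:
  assumes "(f has_vector_derivative f') (at t within I)" "(g has_vector_derivative g') (at t within I)"
  shows "((\<lambda>t. f t \<bullet> g t) has_real_derivative f t \<bullet> g' + f' \<bullet> g t) (at t within I)"
  using has_derivative_inner[OF assms[unfolded has_vector_derivative_def]]
  unfolding has_field_derivative_def
  by (rule has_derivative_eq_rhs) (auto simp: algebra_simps)

lemma orbit_subset: "orbit V I U \<Longrightarrow> J \<subseteq> I \<Longrightarrow> orbit V J U"
  unfolding orbit_def by (meson has_vector_derivative_within_subset subsetD)

lemma orbit_radius_pos: "orbit V I U \<Longrightarrow> t \<in> I \<Longrightarrow> 0 < radius (U t)"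
  unfolding orbit_def by blast

lemma orbit_continuous: "orbit V I U \<Longrightarrow> continuous_on I U"
  unfolding orbit_def continuous_on_eq_continuous_within
  by (meson has_vector_derivative_continuous)

lemma orbit_singleton: "0 < radius z \<Longrightarrow> orbit V {a} (\<lambda>_. z)"
  by (simp add: orbit_def has_vector_derivative_def has_derivative_within_singleton_iff
      bounded_linear_scaleR_left)

lemma orbit_derivs:
  assumes "orbit V I U" "t \<in> I"
  shows orbit_fst_deriv: "((\<lambda>t. fst (U t)) has_vector_derivative (vel (U t), 0)) (at t within I)"
    and orbit_pos_deriv: "((\<lambda>t. pos (U t)) has_vector_derivative vel (U t)) (at t within I)"
    and orbit_eps_deriv: "((\<lambda>t. snd (fst (U t))) has_vector_derivative 0) (at t within I)"
    and orbit_vel_deriv: "((\<lambda>t. vel (U t)) has_vector_derivative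
      (deriv V (radius (U t)) / radius (U t)) *\<^sub>R pos (U t)) (at t within I)"
    and orbit_radius_deriv: "((\<lambda>t. radius (U t)) has_real_derivative
      (pos (U t) \<bullet> vel (U t)) / radius (U t)) (at t within I)"
proof -
  have U: "(U has_vector_derivative newton V (U t)) (at t within I)" and s: "fst (U t) \<noteq> 0"
    using assms unfolding orbit_def by auto
  show 1: "((\<lambda>t. fst (U t)) has_vector_derivative (vel (U t), 0)) (at t within I)"
    using bounded_linear.has_vector_derivative[OF bounded_linear_fst U]
    by (simp add: newton_def)
  show "((\<lambda>t. pos (U t)) has_vector_derivative vel (U t)) (at t within I)"
    using bounded_linear.has_vector_derivative[OF bounded_linear_fst 1] by simp
  show "((\<lambda>t. snd (fst (U t))) has_vector_derivative 0) (at t within I)"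
    using bounded_linear.has_vector_derivative[OF bounded_linear_snd 1] by simp
  show "((\<lambda>t. vel (U t)) has_vector_derivative
      (deriv V (radius (U t)) / radius (U t)) *\<^sub>R pos (U t)) (at t within I)"
    using bounded_linear.has_vector_derivative[OF bounded_linear_snd U]
    by (simp add: newton_def)
  have "((\<lambda>t. radius (U t)) has_derivative (\<lambda>r. (r *\<^sub>R (vel (U t), 0)) \<bullet> sgn (fst (U t)))) (at t within I)"
    using has_derivative_compose[OF 1[unfolded has_vector_derivative_def] has_derivative_norm[OF s]] .
  moreover have "(\<lambda>r. (r *\<^sub>R (vel (U t), 0)) \<bullet> sgn (fst (U t)))
      = (*) ((pos (U t) \<bullet> vel (U t)) / radius (U t))"
    by (auto simp: sgn_div_norm inner_prod_def fun_eq_iff inner_commute field_simps)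
  ultimately show "((\<lambda>t. radius (U t)) has_real_derivative
      (pos (U t) \<bullet> vel (U t)) / radius (U t)) (at t within I)"
    by (simp add: has_field_derivative_def)
qed

lemma orbit_radial_deriv:
  assumes "orbit V I U" "t \<in> I"
  shows "((\<lambda>t. pos (U t) \<bullet> vel (U t)) has_real_derivative
      vel (U t) \<bullet> vel (U t) + deriv V (radius (U t)) / radius (U t) * (pos (U t) \<bullet> pos (U t)))
      (at t within I)"
  using has_real_derivative_inner[OF orbit_pos_deriv[OF assms] orbit_vel_deriv[OF assms]]
  by (simp add: add.commute)

lemma radius_sq: "(radius z)\<^sup>2 = pos z \<bullet> pos z + (snd (fst z))\<^sup>2"
  unfolding power2_norm_eq_inner by (simp add: inner_prod_def power2_eq_square)

lemma norm_pos_le: "norm (pos z) \<le> radius z"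
  by (metis norm_fst_le prod.collapse)

lemma orbit_eps_const:
  assumes "orbit V I U" "convex I" "s \<in> I" "t \<in> I"
  shows "snd (fst (U s)) = snd (fst (U t))"
  using has_vector_derivative_zero_constant[OF \<open>convex I\<close> orbit_eps_deriv[OF assms(1)]] assms
  by metis

lemma orbit_sq_momentum_const:
  assumes U: "orbit V I U" and "convex I" "s \<in> I" "t \<in> I"
  shows "sq_momentum (U s) = sq_momentum (U t)"
proof -
  have "((\<lambda>t. sq_momentum (U t)) has_vector_derivative 0) (at r within I)" if "r \<in> I" for r
    using has_real_derivative_inner[OF orbit_pos_deriv[OF U that] orbit_pos_deriv[OF U that]]
      has_real_derivative_inner[OF orbit_vel_deriv[OF U that] orbit_vel_deriv[OF U that]]
      orbit_radial_deriv[OF U that]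
    unfolding sq_momentum_def has_real_derivative_iff_has_vector_derivative[symmetric]
    by (auto intro!: derivative_eq_intros simp: inner_commute algebra_simps power2_eq_square)
  from has_vector_derivative_zero_constant[OF \<open>convex I\<close> this] assms show ?thesis
    by metis
qed

section \<open>Regular theory away from the origin\<close>

locale smooth_potential =
  fixes V :: "real \<Rightarrow> real"
  assumes smooth: "smooth_pos V"
begin

lemma V_deriv: "0 < s \<Longrightarrow> (V has_real_derivative deriv V s) (at s)"
  and V_deriv2: "0 < s \<Longrightarrow> (deriv V has_real_derivative deriv (deriv V) s) (at s)"
  and V_deriv2_cont: "0 < s \<Longrightarrow> isCont (deriv (deriv V)) s"
  using smooth[unfolded smooth_pos_def, rule_format, of s 0]
    smooth[unfolded smooth_pos_def, rule_format, of s 1]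
    smooth[unfolded smooth_pos_def, rule_format, of s 2]
  by (auto simp: DERIV_deriv_iff_real_differentiable numeral_2_eq_2 differentiable_imp_continuous_within)

lemma orbit_energy_const:
  assumes U: "orbit V I U" and "convex I" "s \<in> I" "t \<in> I"
  shows "energy V (U s) = energy V (U t)"
proof -
  have "((\<lambda>t. energy V (U t)) has_vector_derivative 0) (at r within I)" if "r \<in> I" for r
    using has_real_derivative_inner[OF orbit_vel_deriv[OF U that] orbit_vel_deriv[OF U that]]
      DERIV_chain2[OF V_deriv[OF orbit_radius_pos[OF U that]] orbit_radius_deriv[OF U that]]
    unfolding energy_def has_real_derivative_iff_has_vector_derivative[symmetric]
    by (auto intro!: derivative_eq_intros simp: inner_commute algebra_simps)
  from has_vector_derivative_zero_constant[OF \<open>convex I\<close> this] assms show ?thesis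
    by metis
qed

text \<open>The field is singular at the origin and need not be Lipschitz at infinity. Freezing the
  coefficient V'(s)/s outside \<open>{m..1/m}\<close> makes it globally Lipschitz, so the theorems
  on Lipschitz equations apply while nothing changes on the annulus.\<close>

lemma newton_cutoff:
  assumes "0 < m" "m \<le> 1"
  obtains f :: "'a::euclidean_space state \<Rightarrow> 'a state" and L
  where "0 \<le> L" "\<And>x y. norm (f x - f y) \<le> L * norm (x - y)"
    "\<And>z. radius z \<in> {m..1/m} \<Longrightarrow> f z = newton V z"
proof -
  define M where "M = 1 / m"
  have mM: "m \<le> M" "0 < M" using assms unfolding M_def by (auto simp: field_simps mult_le_one)
  define k where "k = (\<lambda>s. deriv V s / s)"
  define k' where "k' = (\<lambda>s. (deriv (deriv V) s * s - deriv V s) / (s * s))"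
  have k': "(k has_real_derivative k' s) (at s within {m..M})" if "s \<in> {m..M}" for s
    unfolding k_def k'_def using that assms
    by (auto intro!: derivative_eq_intros has_field_derivative_at_within[OF V_deriv2])
  have "continuous_on {m..M} k'"
    unfolding k'_def using assms
    by (intro continuous_intros) (auto intro!: continuous_at_imp_continuous_on V_deriv2_cont
        DERIV_isCont[OF V_deriv2])
  then obtain B where B: "\<And>s. s \<in> {m..M} \<Longrightarrow> norm (k' s) \<le> B"
    using compact_imp_bounded[OF compact_continuous_image[OF _ compact_Icc]]
    by (metis (no_types, lifting) bounded_iff imageI)
  have "continuous_on {m..M} k"
    using k' by (meson DERIV_continuous continuous_on_eq_continuous_within)
  then obtain C where C: "\<And>s. s \<in> {m..M} \<Longrightarrow> norm (k s) \<le> C"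
    using compact_imp_bounded[OF compact_continuous_image[OF _ compact_Icc]]
    by (metis (no_types, lifting) bounded_iff imageI)
  have "0 \<le> B" "0 \<le> C" using B[of m] C[of m] mM by (auto intro: order_trans[OF norm_ge_zero])
  define G where "G = (\<lambda>s. k (max m (min s M)))"
  have clamp: "max m (min s M) \<in> {m..M}" for s using mM by auto
  have GC: "\<bar>G s\<bar> \<le> C" for s
    using C[OF clamp[of s]] by (simp add: G_def)
  have GB: "\<bar>G s - G t\<bar> \<le> B * \<bar>s - t\<bar>" for s t
  proof -
    have "\<bar>G s - G t\<bar> \<le> B * \<bar>max m (min s M) - max m (min t M)\<bar>"
      using field_differentiable_bound[OF _ k' B clamp clamp, of s t] by (simp add: G_def)
    also have "\<dots> \<le> B * \<bar>s - t\<bar>"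
      by (rule mult_left_mono) (use \<open>0 \<le> B\<close> in auto)
    finally show ?thesis .
  qed
  define f where "f = (\<lambda>z :: 'a state. ((vel z, 0 :: real), G (radius z) *\<^sub>R pos z))"
  \<comment> \<open>The product is split so that the difference of coefficients multiplies the
    position of smaller radius: either that radius is at most \<open>M\<close>, or both radii are
    clamped to \<open>M\<close> and the difference vanishes.\<close>
  have GL: "norm (G (radius y) *\<^sub>R pos y - G (radius z) *\<^sub>R pos z) \<le> (B * M + C) * norm (y - z)"
    if "radius y \<le> radius z" for y z :: "'a state"
  proof -
    have n: "norm (pos y - pos z) \<le> norm (y - z)" "norm (fst y - fst z) \<le> norm (y - z)"
      by (metis fst_diff norm_fst_le order_trans prod.collapse)+
    have 1: "\<bar>G (radius y) - G (radius z)\<bar> * norm (pos y) \<le> B * M * norm (y - z)"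
    proof (cases "radius y \<le> M")
      case True
      have "\<bar>G (radius y) - G (radius z)\<bar> * norm (pos y) \<le> (B * norm (y - z)) * M"
      proof (rule mult_mono)
        have "\<bar>radius y - radius z\<bar> \<le> norm (y - z)"
          using norm_triangle_ineq3 n(2) order_trans by blast
        then show "\<bar>G (radius y) - G (radius z)\<bar> \<le> B * norm (y - z)"
          using GB[of "radius y" "radius z"] \<open>0 \<le> B\<close> by (meson mult_left_mono order_trans)
      qed (use True norm_pos_le[of y] \<open>0 \<le> B\<close> in auto)
      then show ?thesis by (simp add: algebra_simps)
    next
      case False
      then have "G (radius y) = G (radius z)" using that by (simp add: G_def)
      then show ?thesis using \<open>0 \<le> B\<close> mM by simp
    qed
    have 2: "\<bar>G (radius z)\<bar> * norm (pos y - pos z) \<le> C * norm (y - z)"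
      using GC n(1) \<open>0 \<le> C\<close> by (intro mult_mono) auto
    have "G (radius y) *\<^sub>R pos y - G (radius z) *\<^sub>R pos z
        = (G (radius y) - G (radius z)) *\<^sub>R pos y + G (radius z) *\<^sub>R (pos y - pos z)"
      by (simp add: algebra_simps)
    then have "norm (G (radius y) *\<^sub>R pos y - G (radius z) *\<^sub>R pos z)
        \<le> \<bar>G (radius y) - G (radius z)\<bar> * norm (pos y) + \<bar>G (radius z)\<bar> * norm (pos y - pos z)"
      by (metis norm_scaleR norm_triangle_ineq real_norm_def)
    with 1 2 show ?thesis by (simp add: algebra_simps)
  qed
  have GL': "norm (G (radius y) *\<^sub>R pos y - G (radius z) *\<^sub>R pos z) \<le> (B * M + C) * norm (y - z)"
    for y z :: "'a state"
    using GL[of y z] GL[of z y] by (cases "radius y \<le> radius z") (auto simp: norm_minus_commute)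
  show ?thesis
  proof (rule that[of "1 + (B * M + C)" f])
    show "0 \<le> 1 + (B * M + C)" using \<open>0 \<le> B\<close> \<open>0 \<le> C\<close> mM by simp
    show "norm (f y - f z) \<le> (1 + (B * M + C)) * norm (y - z)" for y z
    proof -
      have "norm (f y - f z) \<le> norm (vel y - vel z) + norm (G (radius y) *\<^sub>R pos y - G (radius z) *\<^sub>R pos z)"
        unfolding f_def
        using norm_Pair_le[of "(vel y - vel z, 0::real)" "G (radius y) *\<^sub>R pos y - G (radius z) *\<^sub>R pos z"]
        by simp
      moreover have "norm (vel y - vel z) \<le> norm (y - z)"
        by (metis norm_snd_le prod.collapse snd_diff)
      ultimately show ?thesis using GL'[of y z] by (simp add: distrib_right)
    qed
    show "f z = newton V z" if "radius z \<in> {m..1/m}" for z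
      using that by (auto simp: f_def newton_def G_def k_def M_def)
  qed
qed

lemma orbit_radius_bounds:
  assumes U: "orbit V {a..b} U" and "a \<le> b"
  obtains m where "0 < m" "m \<le> 1" "\<And>t. t \<in> {a..b} \<Longrightarrow> radius (U t) \<in> {m..1/m}"
proof -
  have cont: "continuous_on {a..b} (\<lambda>t. radius (U t))"
    by (intro continuous_intros orbit_continuous[OF U])
  obtain p where p: "p \<in> {a..b}" "\<And>t. t \<in> {a..b} \<Longrightarrow> radius (U p) \<le> radius (U t)"
    using continuous_attains_inf[OF compact_Icc _ cont] \<open>a \<le> b\<close> by auto
  obtain q where q: "q \<in> {a..b}" "\<And>t. t \<in> {a..b} \<Longrightarrow> radius (U t) \<le> radius (U q)"
    using continuous_attains_sup[OF compact_Icc _ cont] \<open>a \<le> b\<close> by auto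
  have pos: "0 < radius (U p)" "0 < radius (U q)"
    using orbit_radius_pos[OF U] p q by auto
  define m where "m = min 1 (min (radius (U p)) (1 / radius (U q)))"
  have m: "0 < m" "m \<le> 1" "m \<le> radius (U p)" "m \<le> 1 / radius (U q)"
    using pos by (auto simp: m_def)
  then have "radius (U q) \<le> 1 / m" using pos by (simp add: field_simps)
  then show ?thesis using that[of m] m p q by force
qed

text \<open>Inside the annulus an orbit solves the cut-off equation too, so the exponential estimate
  applies; equal initial values force equality.\<close>

lemma cutoff_agrees:
  assumes f: "\<And>x y. norm (f x - f y) \<le> L * norm (x - y)"
    "\<And>z. radius z \<in> {m..1/m} \<Longrightarrow> f z = newton V z"
    and U: "orbit V {a..b} U" "\<And>t. t \<in> {a..b} \<Longrightarrow> radius (U t) \<in> {m..1/m}"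
    and W: "\<And>t. t \<in> {a..b} \<Longrightarrow> (W has_vector_derivative f (W t)) (at t within {a..b})"
    and t: "t \<in> {a..b}"
  shows "norm (W t - U t) \<le> exp (L * (t - a)) * norm (W a - U a)"
proof (rule lipschitz_ode_dependence[OF f(1) W _ t])
  fix r assume "r \<in> {a..b}"
  then show "(U has_vector_derivative f (U r)) (at r within {a..b})"
    using U f(2) unfolding orbit_def by auto
qed

lemma orbit_unique:
  assumes U: "orbit V {a..b} U" and W: "orbit V {a..b} W" and "U a = W a" and t: "t \<in> {a..b}"
  shows "U t = W t"
proof -
  have "a \<le> b" using t by simp
  obtain m where m: "0 < m" "m \<le> 1" "\<And>t. t \<in> {a..b} \<Longrightarrow> radius (U t) \<in> {m..1/m}"
    using orbit_radius_bounds[OF U \<open>a \<le> b\<close>] by metis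
  obtain n where n: "0 < n" "n \<le> 1" "\<And>t. t \<in> {a..b} \<Longrightarrow> radius (W t) \<in> {n..1/n}"
    using orbit_radius_bounds[OF W \<open>a \<le> b\<close>] by metis
  have "1 / m \<le> 1 / min m n" "1 / n \<le> 1 / min m n"
    using m(1) n(1) by (auto intro!: divide_left_mono)
  then have b: "radius (U t) \<in> {min m n..1/min m n}" "radius (W t) \<in> {min m n..1/min m n}"
    if "t \<in> {a..b}" for t
    using m(3)[OF that] n(3)[OF that] by auto
  have "0 < min m n" "min m n \<le> 1" using m n by auto
  then obtain f :: "'a state \<Rightarrow> 'a state" and L
    where f: "\<And>x y. norm (f x - f y) \<le> L * norm (x - y)"
    "\<And>z. radius z \<in> {min m n..1/min m n} \<Longrightarrow> f z = newton V z"
    using newton_cutoff by metis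
  have "norm (W t - U t) \<le> exp (L * (t - a)) * norm (W a - U a)"
    by (rule cutoff_agrees[OF f U b(1) _ t]) (use W b(2) f(2) in \<open>auto simp: orbit_def\<close>)
  then show ?thesis using \<open>U a = W a\<close> by simp
qed

text \<open>The neighbouring orbit lasts for the whole interval because the cut-off equation is
  solvable globally; closeness to \<open>U\<close> then keeps it in the annulus where the cut-off is
  invisible.\<close>

lemma orbit_dependence:
  fixes U :: "real \<Rightarrow> 'a::euclidean_space state"
  assumes U: "orbit V {a..b} U" and "a \<le> b" "0 < \<delta>"
  obtains \<alpha> where "0 < \<alpha>" "\<And>z. dist z (U a) < \<alpha> \<Longrightarrow>
    \<exists>W. W a = z \<and> orbit V {a..b} W \<and> (\<forall>t\<in>{a..b}. dist (W t) (U t) < \<delta>)"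
proof -
  obtain m where m: "0 < m" "m \<le> 1" "\<And>t. t \<in> {a..b} \<Longrightarrow> radius (U t) \<in> {m..1/m}"
    using orbit_radius_bounds[OF U \<open>a \<le> b\<close>] by metis
  \<comment> \<open>The radii of \<open>U\<close> lie in \<open>{m..1/m}\<close>. A deviation below
    m/2 leaves radii of at least m/2 and at most 1/m + 1/m = 1/n.\<close>
  define n where "n = m / 2"
  have n: "0 < n" "n \<le> 1" using m by (auto simp: n_def)
  have nm: "1 / n = 1 / m + 1 / m" "n \<le> 1 / m" using m mult_le_one[of m m] by (auto simp: n_def field_simps)
  then obtain f :: "'a state \<Rightarrow> 'a state" and L
    where f: "0 \<le> L" "\<And>x y. norm (f x - f y) \<le> L * norm (x - y)"
    "\<And>z. radius z \<in> {n..1/n} \<Longrightarrow> f z = newton V z"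
    using newton_cutoff[OF n] by metis
  have Un: "radius (U t) \<in> {n..1/n}" if "t \<in> {a..b}" for t
    using m(3)[OF that] m(1) nm by (auto simp: n_def)
  define \<delta>' where "\<delta>' = min \<delta> n"
  have \<delta>': "0 < \<delta>'" "\<delta>' \<le> \<delta>" "\<delta>' \<le> n" using \<open>0 < \<delta>\<close> n by (auto simp: \<delta>'_def)
  show ?thesis
  proof (rule that[of "\<delta>' / exp (L * (b - a))"])
    show "0 < \<delta>' / exp (L * (b - a))" using \<delta>' by simp
    fix z assume z: "dist z (U a) < \<delta>' / exp (L * (b - a))"
    obtain W where W: "W a = z" "\<And>t. a \<le> t \<Longrightarrow> (W has_vector_derivative f (W t)) (at t within {a..})"
      using lipschitz_ode_exists[OF f(2)] by metis
    have W': "(W has_vector_derivative f (W t)) (at t within {a..b})" if "t \<in> {a..b}" for t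
      using W(2)[of t] that by (auto intro: has_vector_derivative_within_subset)
    have d: "dist (W t) (U t) < \<delta>'" if t: "t \<in> {a..b}" for t
    proof -
      have "dist (W t) (U t) \<le> exp (L * (t - a)) * dist z (U a)"
        using cutoff_agrees[OF f(2,3) U Un W' t] W(1) by (simp add: dist_norm)
      also have "\<dots> \<le> exp (L * (b - a)) * dist z (U a)"
        using t f(1) by (intro mult_right_mono) (auto intro: mult_left_mono)
      also have "\<dots> < \<delta>'"
        using z by (simp add: pos_less_divide_eq mult.commute)
      finally show ?thesis .
    qed
    have "radius (W t) \<in> {n..1/n}" if t: "t \<in> {a..b}" for t
    proof -
      have "\<bar>radius (W t) - radius (U t)\<bar> \<le> dist (W t) (U t)"
        by (metis dist_fst_le dist_norm norm_triangle_ineq3 order_trans)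
      then show ?thesis using d[OF t] m(3)[OF t] \<delta>' nm by (auto simp: n_def)
    qed
    then have "orbit V {a..b} W"
      unfolding orbit_def using W' f(3) n(1) by (metis atLeastAtMost_iff order_less_le_trans)
    then show "\<exists>W. W a = z \<and> orbit V {a..b} W \<and> (\<forall>t\<in>{a..b}. dist (W t) (U t) < \<delta>)"
      using W(1) order_less_le_trans[OF d \<delta>'(2)] by blast
  qed
qed

text \<open>The usual alternative for maximal solutions. The radius alone decides, because on an
  annulus the field agrees with a globally Lipschitz one, so the velocity cannot blow up
  there.\<close>

lemma orbit_continuation:
  fixes z :: "'a::euclidean_space state"
  assumes "0 < radius z" "a < b" and none: "\<nexists>U. orbit V {a..b} U \<and> U a = z"
  obtains \<tau> U where "a < \<tau>" "\<tau> \<le> b" "orbit V {a..<\<tau>} U" "U a = z"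
    "\<And>m. 0 < m \<Longrightarrow> m \<le> 1 \<Longrightarrow> \<exists>t\<in>{a..<\<tau>}. radius (U t) \<notin> {m..1/m}"
proof -
  \<comment> \<open>The set of reachable times has no greatest element, since every solution can be
    prolonged a little; its supremum is therefore the first time missed.\<close>
  define A where "A = {t \<in> {a..b}. \<exists>U. orbit V {a..t} U \<and> U a = z}"
  have "b \<notin> A" using none \<open>a < b\<close> by (auto simp: A_def)
  have "a \<in> A" using orbit_singleton[OF \<open>0 < radius z\<close>, of V a] \<open>a < b\<close>
    by (auto simp: A_def)
  have extend: "\<exists>t'>t. t' \<in> A" if tA: "t \<in> A" for t
  proof -
    obtain U where U: "orbit V {a..t} U" "U a = z" and t: "a \<le> t" "t \<le> b"
      using tA by (auto simp: A_def)
    have "t < b" using t \<open>b \<notin> A\<close> tA by (cases "t = b") auto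
    obtain m where m: "0 < m" "m \<le> 1" "\<And>r. r \<in> {a..t} \<Longrightarrow> radius (U r) \<in> {m..1/m}"
      using orbit_radius_bounds[OF U(1) \<open>a \<le> t\<close>] by metis
    define n where "n = m / 2"
    have n: "0 < n" "n \<le> 1" "n < m" "1 / m < 1 / n" using m by (auto simp: n_def field_simps)
    obtain f :: "'a state \<Rightarrow> 'a state" and L
      where f: "\<And>x y. norm (f x - f y) \<le> L * norm (x - y)"
        "\<And>z. radius z \<in> {n..1/n} \<Longrightarrow> f z = newton V z"
      using newton_cutoff[OF n(1,2)] by metis
    obtain W where W: "W a = z" "\<And>r. a \<le> r \<Longrightarrow> (W has_vector_derivative f (W r)) (at r within {a..})"
      using lipschitz_ode_exists[OF f(1)] by metis
    have W': "(W has_vector_derivative f (W r)) (at r within {a..c})" if "r \<in> {a..c}" for r c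
      using W(2)[of r] that by (auto intro: has_vector_derivative_within_subset)
    have Un: "radius (U r) \<in> {n..1/n}" if "r \<in> {a..t}" for r
      using m(3)[OF that] n by auto
    have WU: "W r = U r" if "r \<in> {a..t}" for r
      using cutoff_agrees[OF f U(1) Un W' that] W(1) U(2) by simp
    have "continuous_on {a..} (\<lambda>r. radius (W r))"
      using W(2) by (intro continuous_intros)
        (meson atLeast_iff continuous_on_eq_continuous_within has_vector_derivative_continuous)
    then have "((\<lambda>r. radius (W r)) \<longlongrightarrow> radius (W t)) (at t within {a..})"
      using t(1) by (simp add: continuous_on_def)
    moreover have "radius (W t) \<in> {n<..<1/n}"
      using WU[of t] m(3)[of t] n t(1) by auto
    ultimately have "eventually (\<lambda>r. radius (W r) \<in> {n<..<1/n}) (at t within {a..})"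
      using topological_tendstoD open_greaterThanLessThan by blast
    then obtain d where d: "0 < d" "\<And>r. a \<le> r \<Longrightarrow> r \<noteq> t \<Longrightarrow> dist r t < d \<Longrightarrow> radius (W r) \<in> {n<..<1/n}"
      unfolding eventually_at by auto
    define t' where "t' = min b (t + d / 2)"
    have t': "t < t'" "t' \<le> b" "t' < t + d" using d(1) \<open>t < b\<close> by (auto simp: t'_def)
    have "radius (W r) \<in> {n..1/n}" if "r \<in> {a..t'}" for r
    proof (cases "r \<le> t")
      case True
      then show ?thesis using WU Un that by auto
    next
      case False
      then show ?thesis using d(2)[of r] that t' by (auto simp: dist_real_def)
    qed
    then have "orbit V {a..t'} W"
      unfolding orbit_def using W' f(2) n(1) by (metis atLeastAtMost_iff order_less_le_trans)
    then show ?thesis using W(1) t' t by (auto simp: A_def)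
  qed
  define \<tau> where "\<tau> = Sup A"
  have bdd: "bdd_above A" by (auto simp: A_def intro!: bdd_aboveI[of _ b])
  have A_le: "t \<le> \<tau>" if "t \<in> A" for t
    unfolding \<tau>_def using bdd that by (rule cSup_upper[rotated])
  have "\<tau> \<notin> A" using extend A_le by (meson not_le)
  have "a < \<tau>" using extend[OF \<open>a \<in> A\<close>] A_le by force
  have "\<tau> \<le> b" unfolding \<tau>_def using \<open>a \<in> A\<close>
    by (intro cSup_least) (blast, simp add: A_def)
  have A_mem: "\<exists>t'\<in>A. t < t'" if "t < \<tau>" for t
    using less_cSupD[of A t] that \<open>a \<in> A\<close> unfolding \<tau>_def by auto
  \<comment> \<open>The value at \<open>t\<close> is read off from any solution that reaches
    \<open>t\<close>; uniqueness makes the choice immaterial.\<close>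
  define U where "U = (\<lambda>t. (SOME W. orbit V {a..t} W \<and> W a = z) t)"
  have U_eq: "U t = W t" if W: "orbit V {a..t'} W" "W a = z" and t: "t \<in> {a..t'}" for t t' W
  proof -
    have W': "orbit V {a..t} W" by (rule orbit_subset[OF W(1)]) (use t in auto)
    have "orbit V {a..t} (SOME W. orbit V {a..t} W \<and> W a = z) \<and> (SOME W. orbit V {a..t} W \<and> W a = z) a = z"
      by (rule someI[of _ W]) (use W' W(2) in simp)
    then show ?thesis
      unfolding U_def using orbit_unique[OF _ W'] W(2) t by auto
  qed
  have "orbit V {a..<\<tau>} U"
    unfolding orbit_def
  proof (intro ballI conjI)
    fix t assume t: "t \<in> {a..<\<tau>}"
    obtain t' where t': "t' \<in> A" "t < t'" using A_mem t by auto
    obtain W where W: "orbit V {a..t'} W" "W a = z" using t' by (auto simp: A_def)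
    show "0 < radius (U t)"
      using U_eq[OF W] orbit_radius_pos[OF W(1)] t t' by auto
    have "(W has_vector_derivative newton V (W t)) (at t within {a..t'})"
      using W t t' by (auto simp: orbit_def)
    then have "(U has_vector_derivative newton V (U t)) (at t within {a..t'})"
      using U_eq[OF W] t t' by (intro has_vector_derivative_transform[of t _ U W]) auto
    moreover have "at t within {a..<\<tau>} = at t within {a..t'}"
      by (rule at_within_nhd[of t "{..<t'}"]) (use t' A_le[OF t'(1)] in auto)
    ultimately show "(U has_vector_derivative newton V (U t)) (at t within {a..<\<tau>})"
      by simp
  qed
  moreover have "U a = z"
    using U_eq[of a "\<lambda>_. z" a] orbit_singleton[OF \<open>0 < radius z\<close>, of V a] by simp
  \<comment> \<open>If all radii stayed in one annulus, the cut-off solution would run through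
    \<open>\<tau>\<close>, with radii in the same closed annulus, and \<open>\<tau>\<close> would be
    reachable.\<close>
  moreover have "\<exists>t\<in>{a..<\<tau>}. radius (U t) \<notin> {n..1/n}" if n: "0 < n" "n \<le> 1" for n
  proof (rule ccontr)
    assume "\<not> ?thesis"
    then have Un: "radius (U t) \<in> {n..1/n}" if "t \<in> {a..<\<tau>}" for t using that by auto
    obtain f :: "'a state \<Rightarrow> 'a state" and L
      where f: "\<And>x y. norm (f x - f y) \<le> L * norm (x - y)"
        "\<And>z. radius z \<in> {n..1/n} \<Longrightarrow> f z = newton V z"
      using newton_cutoff[OF n] by metis
    obtain W where W: "W a = z" "\<And>r. a \<le> r \<Longrightarrow> (W has_vector_derivative f (W r)) (at r within {a..})"
      using lipschitz_ode_exists[OF f(1)] by metis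
    have W': "(W has_vector_derivative f (W r)) (at r within {a..c})" if "r \<in> {a..c}" for r c
      using W(2)[of r] that by (auto intro: has_vector_derivative_within_subset)
    have WU: "W t = U t" if t: "t \<in> {a..<\<tau>}" for t
    proof -
      have Ut: "orbit V {a..t} U"
        by (rule orbit_subset[OF \<open>orbit V {a..<\<tau>} U\<close>]) (use t in auto)
      have "norm (W t - U t) \<le> exp (L * (t - a)) * norm (W a - U a)"
        by (rule cutoff_agrees[OF f Ut]) (use Un W' t in auto)
      then show ?thesis using W(1) \<open>U a = z\<close> by simp
    qed
    have contW: "continuous_on {a..\<tau>} (\<lambda>r. radius (W r))"
      using W' by (intro continuous_intros)
        (meson continuous_on_eq_continuous_within has_vector_derivative_continuous)
    have "closed ({a..\<tau>} \<inter> (\<lambda>r. radius (W r)) -` {n..1/n})"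
      by (rule continuous_closed_preimage[OF contW]) auto
    moreover have "{a..<\<tau>} \<subseteq> {a..\<tau>} \<inter> (\<lambda>r. radius (W r)) -` {n..1/n}"
      using Un WU by fastforce
    ultimately have "closure {a..<\<tau>} \<subseteq> {a..\<tau>} \<inter> (\<lambda>r. radius (W r)) -` {n..1/n}"
      by (meson closure_minimal)
    then have "radius (W t) \<in> {n..1/n}" if "t \<in> {a..\<tau>}" for t
      using that closure_atLeastLessThan[OF \<open>a < \<tau>\<close>] by auto
    then have "orbit V {a..\<tau>} W"
      unfolding orbit_def using W' f(2) n(1) by (metis atLeastAtMost_iff order_less_le_trans)
    then show False using \<open>\<tau> \<notin> A\<close> \<open>a < \<tau>\<close> \<open>\<tau> \<le> b\<close> W(1) by (auto simp: A_def)
  qed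
  ultimately show ?thesis using that[OF \<open>a < \<tau>\<close> \<open>\<tau> \<le> b\<close>] by blast
qed

end

section \<open>Turning of the velocity near the singularity\<close>

lemma sq_momentum_nonneg: "0 \<le> sq_momentum z"
  unfolding sq_momentum_def using Cauchy_Schwarz_ineq[of "pos z" "vel z"] by simp

lemma sgn_has_vector_derivative:
  fixes v :: "real \<Rightarrow> 'a::euclidean_space"
  assumes v: "(v has_vector_derivative a) (at t within I)" and "v t \<noteq> 0"
  shows "((\<lambda>t. sgn (v t)) has_vector_derivative
    (1 / norm (v t)) *\<^sub>R (a - ((a \<bullet> v t) / (v t \<bullet> v t)) *\<^sub>R v t)) (at t within I)"
proof -
  define n where "n = norm (v t)"
  have n: "0 < n" "v t \<bullet> v t = n * n" using \<open>v t \<noteq> 0\<close>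
    by (auto simp: n_def dot_square_norm power2_eq_square)
  have "((\<lambda>t. norm (v t)) has_derivative (\<lambda>r. (r *\<^sub>R a) \<bullet> sgn (v t))) (at t within I)"
    using has_derivative_compose[OF v[unfolded has_vector_derivative_def] has_derivative_norm[OF \<open>v t \<noteq> 0\<close>]] .
  moreover have "(\<lambda>r. (r *\<^sub>R a) \<bullet> sgn (v t)) = (*) ((a \<bullet> v t) / n)"
    by (auto simp: sgn_div_norm fun_eq_iff n_def field_simps)
  ultimately have "((\<lambda>t. norm (v t)) has_real_derivative (a \<bullet> v t) / n) (at t within I)"
    by (simp add: has_field_derivative_def)
  then have "((\<lambda>t. inverse (norm (v t))) has_real_derivative - (inverse n * ((a \<bullet> v t) / n) * inverse n)) (at t within I)"
    using DERIV_inverse' n(1) n_def by fastforce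
  from has_vector_derivative_scaleR[OF this v]
  have "((\<lambda>t. sgn (v t)) has_vector_derivative
    inverse n *\<^sub>R a + - (inverse n * ((a \<bullet> v t) / n) * inverse n) *\<^sub>R v t) (at t within I)"
    by (simp add: sgn_div_norm n_def)
  moreover have "inverse n *\<^sub>R a + - (inverse n * ((a \<bullet> v t) / n) * inverse n) *\<^sub>R v t
     = (1 / norm (v t)) *\<^sub>R (a - ((a \<bullet> v t) / (v t \<bullet> v t)) *\<^sub>R v t)"
    using n(1) by (simp add: n(2) n_def[symmetric] algebra_simps divide_simps)
  ultimately show ?thesis by simp
qed

text \<open>Pythagoras for the distance of \<open>x\<close> from the line through \<open>v\<close>.
  For position and velocity this distance is the angular momentum divided by the speed, which is how
  the momentum enters the turning rate.\<close>

lemma norm_rejection: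
  fixes x v :: "'a::euclidean_space"
  assumes "v \<noteq> 0"
  shows "norm (x - ((x \<bullet> v) / (v \<bullet> v)) *\<^sub>R v) = sqrt ((x \<bullet> x) * (v \<bullet> v) - (x \<bullet> v)\<^sup>2) / norm v"
proof -
  have "(norm (x - ((x \<bullet> v) / (v \<bullet> v)) *\<^sub>R v))\<^sup>2 = (x \<bullet> x) - (x \<bullet> v)\<^sup>2 / (v \<bullet> v)"
    using assms unfolding power2_norm_eq_inner
    by (simp add: algebra_simps inner_commute power2_eq_square)
  also have "\<dots> = ((x \<bullet> x) * (v \<bullet> v) - (x \<bullet> v)\<^sup>2) / (norm v)\<^sup>2"
    using assms by (simp add: diff_divide_distrib power2_norm_eq_inner)
  finally have "sqrt ((norm (x - ((x \<bullet> v) / (v \<bullet> v)) *\<^sub>R v))\<^sup>2)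
      = sqrt (((x \<bullet> x) * (v \<bullet> v) - (x \<bullet> v)\<^sup>2) / (norm v)\<^sup>2)" by simp
  then show ?thesis by (simp add: real_sqrt_divide)
qed

lemma sq_momentum_zero_parallel:
  assumes "sq_momentum z = 0" "vel z \<noteq> 0"
  shows "pos z = (pos z \<bullet> sgn (vel z)) *\<^sub>R sgn (vel z)"
proof -
  have "pos z = ((pos z \<bullet> vel z) / (vel z \<bullet> vel z)) *\<^sub>R vel z"
    using norm_rejection[OF assms(2), of "pos z"] assms(1) by (simp add: sq_momentum_def)
  also have "\<dots> = (pos z \<bullet> sgn (vel z)) *\<^sub>R sgn (vel z)"
    by (simp add: sgn_div_norm dot_square_norm power2_eq_square divide_inverse mult.commute mult.left_commute)
  finally show ?thesis .
qed

section \<open>Scales on which the singularity is weak\<close>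

locale weak_singularity = smooth_potential +
  assumes blowup: "filterlim V at_top (at_right 0)"
    and decreasing: "\<forall>\<^sub>F s in at_right 0. deriv V s < 0"
    and slow: "((\<lambda>s. s * deriv V s / V s) \<longlongrightarrow> 0) (at_right 0)"
begin

definition small_scale :: "real \<Rightarrow> real \<Rightarrow> real \<Rightarrow> bool" where
  "small_scale E0 \<eta> \<rho> \<longleftrightarrow> 0 < \<rho> \<and> (\<forall>s E. 0 < s \<longrightarrow> s \<le> \<rho> \<longrightarrow> \<bar>E - E0\<bar> \<le> 1 \<longrightarrow>
     deriv V s < 0 \<and> 1 \<le> V s + E \<and> s * \<bar>deriv V s\<bar> \<le> \<eta> * (V s + E))"

lemma small_scaleD:
  assumes "small_scale E0 \<eta> \<rho>" "0 < s" "s \<le> \<rho>" "\<bar>E - E0\<bar> \<le> 1"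
  shows "deriv V s < 0" "1 \<le> V s + E" "s * \<bar>deriv V s\<bar> \<le> \<eta> * (V s + E)"
  using assms unfolding small_scale_def by blast+

lemma small_scale_exists:
  assumes "0 < \<eta>"
  obtains \<rho> where "small_scale E0 \<eta> \<rho>"
proof -
  have "\<forall>\<^sub>F s in at_right 0. 2 * (\<bar>E0\<bar> + 2) \<le> V s"
    using blowup by (simp add: filterlim_at_top)
  moreover have "\<forall>\<^sub>F s in at_right 0. dist (s * deriv V s / V s) 0 < \<eta> / 2"
    using slow assms by (intro tendstoD) auto
  ultimately have "\<forall>\<^sub>F s in at_right 0. deriv V s < 0 \<and> 2 * (\<bar>E0\<bar> + 2) \<le> V s \<and> \<bar>s * deriv V s / V s\<bar> < \<eta> / 2"
    using decreasing by eventually_elim auto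
  then obtain b where b: "0 < b" "\<And>s. 0 < s \<Longrightarrow> s < b \<Longrightarrow>
      deriv V s < 0 \<and> 2 * (\<bar>E0\<bar> + 2) \<le> V s \<and> \<bar>s * deriv V s / V s\<bar> < \<eta> / 2"
    by (auto simp: eventually_at_right_field)
  have "small_scale E0 \<eta> (b / 2)"
    unfolding small_scale_def
  proof (intro conjI allI impI)
    fix s E :: real assume s: "0 < s" "s \<le> b / 2" and E: "\<bar>E - E0\<bar> \<le> 1"
    have V: "deriv V s < 0" "2 * (\<bar>E0\<bar> + 2) \<le> V s" "\<bar>s * deriv V s / V s\<bar> < \<eta> / 2"
      using b s by force+
    show "deriv V s < 0" by fact
    have "- (\<bar>E0\<bar> + 1) \<le> E" using E by linarith
    then have half: "1 \<le> V s + E" "V s \<le> 2 * (V s + E)" using V(2) by auto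
    show "1 \<le> V s + E" by fact
    have "s * \<bar>deriv V s\<bar> \<le> \<eta> / 2 * V s"
      using V s by (simp add: abs_mult field_simps)
    also have "\<dots> \<le> \<eta> / 2 * (2 * (V s + E))"
      using half(2) assms by (intro mult_left_mono) auto
    also have "\<dots> = \<eta> * (V s + E)" by (simp only: divide_inverse) simp
    finally show "s * \<bar>deriv V s\<bar> \<le> \<eta> * (V s + E)" .
  qed (use b in simp)
  then show ?thesis using that by blast
qed

text \<open>A centrifugal barrier. With c^2 the squared momentum, c^2 \<le> s^2 |v|^2 = 2 s^2 (V(s)
  + E), and s (V(s) + E) is nondecreasing for small s, hence bounded. So c^2 is at most a constant
  times s.\<close>

lemma radius_lower_bound:
  assumes "0 < e"
  obtains m where "0 < m" "\<And>z :: 'a::euclidean_space state.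
    0 < radius z \<Longrightarrow> energy V z = E \<Longrightarrow> e \<le> sq_momentum z \<Longrightarrow> m < radius z"
proof -
  \<comment> \<open>The factor 1 is what monotonicity of s (V(s) + E) asks for: the derivative is V
    + E + s V'.\<close>
  obtain \<rho> where \<rho>: "small_scale E 1 \<rho>" using small_scale_exists[of 1 E] by auto
  have "0 < \<rho>" using \<rho> by (simp add: small_scale_def)
  have mono: "s * (V s + E) \<le> \<rho> * (V \<rho> + E)" if s: "0 < s" "s \<le> \<rho>" for s
  proof (rule DERIV_nonneg_imp_nondecreasing[OF s(2)])
    fix r assume r: "s \<le> r" "r \<le> \<rho>"
    have "((\<lambda>s. s * (V s + E)) has_real_derivative (V r + E) + r * deriv V r) (at r)"
      using V_deriv[of r] r s by (auto intro!: derivative_eq_intros)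
    moreover have "0 \<le> (V r + E) + r * deriv V r"
      using small_scaleD[OF \<rho>, of r E] r s by simp
    ultimately show "\<exists>y. ((\<lambda>s. s * (V s + E)) has_real_derivative y) (at r) \<and> 0 \<le> y" by blast
  qed
  define C where "C = 2 * (\<rho> * (V \<rho> + E))"
  have "1 \<le> V \<rho> + E" using small_scaleD(2)[OF \<rho>, of \<rho> E] \<open>0 < \<rho>\<close> by simp
  then have "0 < C" using \<open>0 < \<rho>\<close> by (simp add: C_def)
  define m where "m = min \<rho> (e / (2 * C))"
  have "m < radius z"
    if z: "0 < radius z" "energy V z = E" "e \<le> sq_momentum z" for z :: "'a state"
  proof (rule ccontr)
    assume "\<not> m < radius z"
    then have s: "radius z \<le> \<rho>" "radius z \<le> e / (2 * C)" by (auto simp: m_def)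
    have "pos z \<bullet> pos z \<le> (radius z)\<^sup>2" by (simp add: radius_sq)
    then have "(pos z \<bullet> pos z) * (vel z \<bullet> vel z) \<le> (radius z)\<^sup>2 * (vel z \<bullet> vel z)"
      by (rule mult_right_mono) simp
    then have "sq_momentum z \<le> (radius z)\<^sup>2 * (vel z \<bullet> vel z)"
      unfolding sq_momentum_def by (smt (verit) zero_le_power2)
    also have "vel z \<bullet> vel z = 2 * (V (radius z) + E)"
      using z(2) by (simp add: energy_def)
    also have "(radius z)\<^sup>2 * (2 * (V (radius z) + E)) = radius z * (2 * (radius z * (V (radius z) + E)))"
      by (simp add: power2_eq_square algebra_simps)
    also have "\<dots> \<le> radius z * C"
      unfolding C_def using mono[OF z(1) s(1)] by (intro mult_left_mono) auto
    also have "\<dots> \<le> e / (2 * C) * C"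
      using s(2) \<open>0 < C\<close> by (intro mult_right_mono) auto
    also have "\<dots> < e" using \<open>0 < C\<close> assms by simp
    finally show False using z(3) by simp
  qed
  moreover have "0 < m" using \<open>0 < \<rho>\<close> \<open>0 < C\<close> assms by (simp add: m_def)
  ultimately show ?thesis using that by blast
qed

text \<open>Only the component of the force across the velocity turns it: |V'|/s times the distance
  c/|v| of the position from the line of the velocity. The rate is this component divided by the
  speed.\<close>

lemma direction_deriv:
  assumes U: "orbit V I U" "t \<in> I" and "vel (U t) \<noteq> 0"
  obtains w' where "((\<lambda>t. sgn (vel (U t))) has_vector_derivative w') (at t within I)"
    "norm w' = \<bar>deriv V (radius (U t))\<bar> * sqrt (sq_momentum (U t)) / (radius (U t) * (vel (U t) \<bullet> vel (U t)))"
proof -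
  define k where "k = deriv V (radius (U t)) / radius (U t)"
  define x v where "x = pos (U t)" and "v = vel (U t)"
  have s: "0 < radius (U t)" using orbit_radius_pos[OF U] .
  have v: "0 < norm v" using assms by (simp add: v_def)
  let ?w = "(1 / norm v) *\<^sub>R (k *\<^sub>R x - ((k *\<^sub>R x \<bullet> v) / (v \<bullet> v)) *\<^sub>R v)"
  have "norm ?w = norm ((k / norm v) *\<^sub>R (x - ((x \<bullet> v) / (v \<bullet> v)) *\<^sub>R v))"
    by (simp add: algebra_simps)
  also have "\<dots> = \<bar>k\<bar> / norm v * (sqrt (sq_momentum (U t)) / norm v)"
    using norm_rejection[of v x] v by (simp add: sq_momentum_def x_def v_def)
  also have "\<dots> = \<bar>deriv V (radius (U t))\<bar> * sqrt (sq_momentum (U t)) / (radius (U t) * (v \<bullet> v))"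
    using s v by (simp add: k_def dot_square_norm power2_eq_square)
  finally show ?thesis
    using that sgn_has_vector_derivative[OF orbit_vel_deriv[OF U] assms(3)]
    unfolding k_def x_def v_def by blast
qed

end

text \<open>Since |v|^2 = 2 (V + E), the factor 1/2 means s |V'| \<le> |v|^2 / 4: the force takes
  away at most a quarter of the rate at which the arctan of \<open>direction_estimate\<close> would
  grow in free motion.\<close>

locale collision_scale = weak_singularity +
  fixes E0 s0 :: real
  assumes scale: "small_scale E0 (1/2) s0"
begin

lemma s0_pos: "0 < s0"
  using scale by (simp add: small_scale_def)

lemma V_antimono:
  assumes "0 < s" "s \<le> t" "t \<le> s0"
  shows "V t \<le> V s"
proof (rule DERIV_nonpos_imp_nonincreasing[OF assms(2)])
  fix r assume "s \<le> r" "r \<le> t"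
  then show "\<exists>y. (V has_real_derivative y) (at r) \<and> y \<le> 0"
    using V_deriv[of r] small_scaleD(1)[OF scale, of r E0] assms by (intro exI[of _ "deriv V r"]) auto
qed

lemma vel_sq:
  assumes "\<bar>energy V z - E0\<bar> \<le> 1" "0 < radius z" "radius z \<le> s0"
  shows "vel z \<bullet> vel z = 2 * (V (radius z) + energy V z)" "2 \<le> vel z \<bullet> vel z" "vel z \<noteq> 0"
proof -
  show 1: "vel z \<bullet> vel z = 2 * (V (radius z) + energy V z)" by (simp add: energy_def)
  then show "2 \<le> vel z \<bullet> vel z" using small_scaleD(2)[OF scale assms(2,3,1)] by simp
  then show "vel z \<noteq> 0" by auto
qed

text \<open>If \<open>c\<^sup>2\<close> is the conserved squared angular momentum, the velocity direction \<open>w\<close> turns at rate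
  \<open>|V' s| c / (s |v|\<^sup>2)\<close>, while \<open>arctan ((x \<bullet> v) / c)\<close>, the complement of the angle between position
  and velocity, grows at rate at least \<open>3 c / (4 s\<^sup>2)\<close> and stays in an interval of length \<open>\<pi>\<close>.
  So where \<open>s |V' s|\<close> is small against \<open>|v|\<^sup>2\<close> the total turning is small.\<close>

lemma direction_estimate:
  assumes U: "orbit V {a..b} U" and "a \<le> b"
    and En: "\<bar>energy V (U a) - E0\<bar> \<le> 1"
    and s: "\<And>t. t \<in> {a..b} \<Longrightarrow> radius (U t) \<le> s0"
    and \<eta>: "small_scale E0 \<eta> \<rho>" "0 < \<eta>"
  shows "norm (sgn (vel (U b)) - sgn (vel (U a)))
    \<le> (if sq_momentum (U a) = 0 then 0 else 4 * \<eta> + sqrt (sq_momentum (U a)) / \<rho>\<^sup>2 * (b - a))"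
proof (cases "a = b")
  case True
  then show ?thesis using \<eta> by simp
next
  case False
  then have "a < b" using \<open>a \<le> b\<close> by simp
  define c where "c = sqrt (sq_momentum (U a))"
  have c: "0 \<le> c" "sq_momentum (U a) = c\<^sup>2"
    using sq_momentum_nonneg[of "U a"] by (auto simp: c_def)
  have mom: "sq_momentum (U t) = c\<^sup>2" if "t \<in> {a..b}" for t
    using orbit_sq_momentum_const[OF U _ that, of a] c \<open>a \<le> b\<close> by simp
  have En': "energy V (U t) = energy V (U a)" if "t \<in> {a..b}" for t
    using orbit_energy_const[OF U _ that, of a] \<open>a \<le> b\<close> by simp
  have pos: "0 < radius (U t)" if "t \<in> {a..b}" for t
    using orbit_radius_pos[OF U that] .
  have v: "vel (U t) \<bullet> vel (U t) = 2 * (V (radius (U t)) + energy V (U a))"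
    "2 \<le> vel (U t) \<bullet> vel (U t)" "vel (U t) \<noteq> 0" if "t \<in> {a..b}" for t
    using vel_sq[of "U t"] En En'[OF that] pos[OF that] s[OF that] by auto
  have "\<exists>w'. \<forall>t\<in>{a..b}. ((\<lambda>t. sgn (vel (U t))) has_vector_derivative w' t) (at t within {a..b}) \<and>
    norm (w' t) = \<bar>deriv V (radius (U t))\<bar> * c / (radius (U t) * (vel (U t) \<bullet> vel (U t)))"
    by (intro bchoice ballI) (metis direction_deriv[OF U] v(3) mom real_sqrt_unique c(1))
  then obtain w' where w': "\<And>t. t \<in> {a..b} \<Longrightarrow> ((\<lambda>t. sgn (vel (U t))) has_vector_derivative w' t) (at t within {a..b})"
    and nw': "\<And>t. t \<in> {a..b} \<Longrightarrow> norm (w' t) = \<bar>deriv V (radius (U t))\<bar> * c / (radius (U t) * (vel (U t) \<bullet> vel (U t)))"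
    by metis
  have inner_at: "(f has_vector_derivative f') (at t)"
    if "(f has_vector_derivative f') (at t within {a..b})" "a < t" "t < b"
    for f :: "real \<Rightarrow> 'c::real_normed_vector" and f' t
    using that by (simp add: at_within_Icc_at)
  have contw: "continuous_on {a..b} (\<lambda>t. sgn (vel (U t)))"
    using w' by (meson continuous_on_eq_continuous_within has_vector_derivative_continuous)
  show ?thesis
  \<comment> \<open>The angle function of the second case divides by \<open>c\<close>. Without
    angular momentum the turning rate is zero and the direction constant.\<close>
  proof (cases "c = 0")
    case True
    have "norm (sgn (vel (U b)) - sgn (vel (U a))) \<le> (\<lambda>_. 0) b - (\<lambda>_. 0) a"
      by (rule differentiable_bound_general[OF \<open>a < b\<close> contw])
        (use w' nw' True in \<open>auto intro!: inner_at derivative_eq_intros\<close>)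
    then show ?thesis using c True by simp
  next
    case False
    then have "0 < c" using c by simp
    define A where "A = (\<lambda>t. arctan ((pos (U t) \<bullet> vel (U t)) / c))"
    define A' where "A' = (\<lambda>t. c * (vel (U t) \<bullet> vel (U t) + deriv V (radius (U t)) / radius (U t) * (pos (U t) \<bullet> pos (U t)))
        / ((pos (U t) \<bullet> pos (U t)) * (vel (U t) \<bullet> vel (U t))))"
    have A: "(A has_real_derivative A' t) (at t within {a..b})" if t: "t \<in> {a..b}" for t
    proof -
      have m: "(pos (U t) \<bullet> pos (U t)) * (vel (U t) \<bullet> vel (U t)) = c\<^sup>2 + (pos (U t) \<bullet> vel (U t))\<^sup>2"
        using mom[OF t] by (simp add: sq_momentum_def)
      have p: "0 < c\<^sup>2 + (pos (U t) \<bullet> vel (U t))\<^sup>2"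
        using \<open>0 < c\<close> by (simp add: add_pos_nonneg)
      have q: "1 + ((pos (U t) \<bullet> vel (U t)) / c)\<^sup>2 = (c\<^sup>2 + (pos (U t) \<bullet> vel (U t))\<^sup>2) / c\<^sup>2"
        using \<open>0 < c\<close> by (simp add: field_simps)
      show ?thesis
        unfolding A_def A'_def m
        by (rule DERIV_cong[OF DERIV_chain2[OF DERIV_arctan DERIV_cdivide[OF orbit_radial_deriv[OF U t]]]])
          (use \<open>0 < c\<close> p in \<open>simp add: q power2_eq_square divide_simps\<close>)
    qed
    have bound: "norm (w' t) \<le> \<eta> * A' t + c / \<rho>\<^sup>2" "0 \<le> A' t" if t: "t \<in> {a..b}" for t
    proof -
      define s where "s = radius (U t)"
      define x2 where "x2 = pos (U t) \<bullet> pos (U t)"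
      define v2 where "v2 = vel (U t) \<bullet> vel (U t)"
      define d where "d = \<bar>deriv V s\<bar>"
      have sp: "0 < s" "s \<le> s0" using pos[OF t] assms(4)[OF t] by (auto simp: s_def)
      have v2: "v2 = 2 * (V s + energy V (U a))" "0 < v2" using v[OF t] by (auto simp: s_def v2_def)
      have d: "deriv V s = - d" "s * d \<le> v2 / 4" "0 \<le> d"
        using small_scaleD[OF scale sp En] v2 by (auto simp: d_def)
      have x2: "0 < x2" "x2 \<le> s * s"
      proof -
        have "0 < c\<^sup>2 + (pos (U t) \<bullet> vel (U t))\<^sup>2"
          using \<open>0 < c\<close> by (simp add: add_pos_nonneg)
        then have "0 < x2 * v2"
          using mom[OF t] by (simp add: sq_momentum_def x2_def v2_def)
        then show "0 < x2" using v2(2) by (simp add: zero_less_mult_iff)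
        show "x2 \<le> s * s"
          using radius_sq[of "U t"] by (simp add: x2_def s_def power2_eq_square)
      qed
      have A't: "A' t = c * (v2 - d / s * x2) / (x2 * v2)"
        unfolding A'_def x2_def v2_def s_def[symmetric] d(1) by simp
      have "d / s * x2 \<le> d / s * (s * s)"
        using x2 sp d by (intro mult_left_mono) auto
      also have "d / s * (s * s) = s * d" using sp by simp
      finally have "v2 - d / s * x2 \<ge> 3 / 4 * v2" using d(2) by linarith
      then have "A' t \<ge> c * (3 / 4 * v2) / (x2 * v2)"
        unfolding A't using \<open>0 < c\<close> x2 v2 by (intro divide_right_mono mult_left_mono) auto
      also have "c * (3 / 4 * v2) / (x2 * v2) = 3 / 4 * c / x2" using v2(2) by simp
      finally have "A' t \<ge> 3 / 4 * c / x2" .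
      moreover have "3 / 4 * c / x2 \<ge> 3 / 4 * c / (s * s)"
        using x2 \<open>0 < c\<close> sp by (intro divide_left_mono) auto
      ultimately have Ages: "A' t \<ge> 3 / 4 * (c / (s * s))" by simp
      have cs: "0 \<le> c / (s * s)" and cr: "0 \<le> c / \<rho>\<^sup>2" using \<open>0 < c\<close> by simp_all
      show "0 \<le> A' t" using Ages cs by linarith
      have w: "norm (w' t) = d * c / (s * v2)"
        using nw'[OF t] by (simp add: d_def s_def v2_def)
      also have "\<dots> = (s * d) / v2 * (c / (s * s))" using sp by simp
      finally have w: "norm (w' t) = (s * d) / v2 * (c / (s * s))" .
      \<comment> \<open>Inside radius \<open>\<rho>\<close> the turning is charged to
        \<open>\<eta>\<close> times the growth of the angle, whose total is bounded however small
        \<open>c\<close> is. Outside, the rate is at most c/\<rho>^2, which is small for small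
        \<open>c\<close> once \<open>\<rho>\<close> is fixed.\<close>
      show "norm (w' t) \<le> \<eta> * A' t + c / \<rho>\<^sup>2"
      proof (cases "s \<le> \<rho>")
        case True
        have "V s + energy V (U a) = v2 / 2" using v2 by simp
        then have "s * d \<le> \<eta> * (v2 / 2)"
          using small_scaleD(3)[OF \<eta>(1) sp(1) True En] by (simp only: d_def)
        then have "(s * d) / v2 \<le> \<eta> / 2" using v2(2) by (simp add: field_simps)
        then have "norm (w' t) \<le> \<eta> / 2 * (c / (s * s))"
          unfolding w using cs by (intro mult_right_mono) auto
        also have "\<dots> \<le> \<eta> * (3 / 4 * (c / (s * s)))"
          using mult_nonneg_nonneg[OF less_imp_le[OF \<eta>(2)] cs] by simp
        also have "\<dots> \<le> \<eta> * A' t" using Ages \<eta>(2) by (intro mult_left_mono) auto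
        finally show ?thesis using cr by linarith
      next
        case False
        have "(s * d) / v2 \<le> 1" using d(2) v2(2) by (simp add: field_simps)
        then have "norm (w' t) \<le> 1 * (c / (s * s))"
          unfolding w using cs by (intro mult_right_mono) auto
        also have "\<dots> \<le> c / \<rho>\<^sup>2"
          using False \<open>0 < c\<close> \<eta> unfolding power2_eq_square small_scale_def
          by (simp add: frac_le mult_mono)
        finally have "norm (w' t) \<le> c / \<rho>\<^sup>2" .
        moreover have "0 \<le> \<eta> * A' t" using \<open>0 \<le> A' t\<close> \<eta>(2) by simp
        ultimately show ?thesis by linarith
      qed
    qed
    define \<phi> where "\<phi> = (\<lambda>t. \<eta> * A t + c / \<rho>\<^sup>2 * t)"
    have \<phi>: "(\<phi> has_real_derivative \<eta> * A' t + c / \<rho>\<^sup>2) (at t within {a..b})" if t: "t \<in> {a..b}" for t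
      unfolding \<phi>_def by (intro DERIV_add DERIV_cmult DERIV_cmult_Id A[OF t])
    have "norm (sgn (vel (U b)) - sgn (vel (U a))) \<le> \<phi> b - \<phi> a"
    proof (rule differentiable_bound_general[OF \<open>a < b\<close> contw])
      show "continuous_on {a..b} \<phi>"
        using \<phi> by (meson DERIV_continuous continuous_on_eq_continuous_within)
      fix t assume t: "a < t" "t < b"
      show "((\<lambda>t. sgn (vel (U t))) has_vector_derivative w' t) (at t)"
        using w' t by (intro inner_at) auto
      show "(\<phi> has_vector_derivative \<eta> * A' t + c / \<rho>\<^sup>2) (at t)"
        using \<phi> t by (intro inner_at) (auto simp flip: has_real_derivative_iff_has_vector_derivative)
      show "norm (w' t) \<le> \<eta> * A' t + c / \<rho>\<^sup>2" using bound(1) t by simp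
    qed
    also have "\<dots> = \<eta> * (A b - A a) + c / \<rho>\<^sup>2 * (b - a)" by (simp only: \<phi>_def right_diff_distrib)
    also have "\<dots> \<le> \<eta> * 4 + c / \<rho>\<^sup>2 * (b - a)"
    proof -
      have "A b < pi / 2" "- (pi / 2) < A a"
        using arctan_bounded unfolding A_def by blast+
      then have "A b - A a \<le> 4" using pi_less_4 by simp
      then show ?thesis using \<eta>(2) by (intro add_right_mono mult_left_mono) auto
    qed
    also have "\<eta> * 4 = 4 * \<eta>" by simp
    finally show ?thesis using c False by (simp only: c_def[symmetric]) simp
  qed
qed

end

section \<open>Passage through a neighbourhood of the collision\<close>

lemma mvt_bounds:
  fixes f :: "real \<Rightarrow> real"
  assumes "a \<le> b" and f: "\<And>t. t \<in> {a..b} \<Longrightarrow> (f has_real_derivative f' t) (at t within {a..b})"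
  shows mvt_upper: "(\<And>t. t \<in> {a..b} \<Longrightarrow> f' t \<le> C) \<Longrightarrow> f b - f a \<le> C * (b - a)"
    and mvt_lower: "(\<And>t. t \<in> {a..b} \<Longrightarrow> C \<le> f' t) \<Longrightarrow> C * (b - a) \<le> f b - f a"
proof -
  obtain t where "t \<in> {a..b}" "f b - f a = f' t * (b - a)"
    using mvt_very_simple[OF \<open>a \<le> b\<close>, of f "\<lambda>t. (*) (f' t)"] f
    by (auto simp: has_field_derivative_def)
  with \<open>a \<le> b\<close> show "(\<And>t. t \<in> {a..b} \<Longrightarrow> f' t \<le> C) \<Longrightarrow> f b - f a \<le> C * (b - a)"
    "(\<And>t. t \<in> {a..b} \<Longrightarrow> C \<le> f' t) \<Longrightarrow> C * (b - a) \<le> f b - f a"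
    by (auto intro: mult_right_mono)
qed

text \<open>Continuous induction: at the first time at which \<open>h\<close> reached
  \<open>c\<close>, the hypothesis \<open>step\<close> would put \<open>h\<close> below
  \<open>c\<close>. It confines an orbit by estimates that themselves presuppose confinement up to
  the time in question.\<close>

lemma first_exit_induct:
  fixes h :: "real \<Rightarrow> real"
  assumes "a \<le> b" and h: "continuous_on {a..b} h" "h a < c"
    and step: "\<And>r. r \<in> {a..b} \<Longrightarrow> (\<And>q. q \<in> {a..r} \<Longrightarrow> h q \<le> c) \<Longrightarrow> h r < c"
    and t: "t \<in> {a..b}"
  shows "h t < c"
proof (rule ccontr)
  assume "\<not> h t < c"
  define K where "K = {a..b} \<inter> h -` {c}"
  have hits: "\<exists>q\<in>{a..r}. q \<in> K" if r: "r \<in> {a..b}" "c \<le> h r" for r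
  proof -
    have "continuous_on {a..r} h" using continuous_on_subset[OF h(1)] r by auto
    then obtain q where "a \<le> q" "q \<le> r" "h q = c"
      using IVT'[of h a c r] r h(2) by auto
    then show ?thesis using r by (auto simp: K_def)
  qed
  have "closed K" unfolding K_def by (rule continuous_closed_preimage[OF h(1)]) auto
  then have "compact K" unfolding K_def
    by (metis Int_lower1 bounded_closed_interval bounded_subset compact_eq_bounded_closed)
  moreover have "K \<noteq> {}" using hits[OF t] \<open>\<not> h t < c\<close> by auto
  ultimately obtain r where r: "r \<in> K" "\<And>q. q \<in> K \<Longrightarrow> r \<le> q"
    using compact_attains_inf by metis
  have "h q \<le> c" if q: "q \<in> {a..r}" for q
  proof (rule ccontr)
    assume "\<not> h q \<le> c"
    then obtain p where "p \<in> {a..q}" "p \<in> K" using hits[of q] q r(1) by (auto simp: K_def)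
    then have "p = q" using r(2)[of p] q by auto
    then show False using \<open>p \<in> K\<close> \<open>\<not> h q \<le> c\<close> by (simp add: K_def)
  qed
  then have "h r < c" using step[of r] r(1) by (auto simp: K_def)
  then show False using r(1) by (simp add: K_def)
qed

section \<open>Splitting along a fixed direction\<close>

definition transverse :: "'a::euclidean_space \<Rightarrow> 'a \<Rightarrow> 'a" where
  "transverse w x = x - (x \<bullet> w) *\<^sub>R w"

lemma transverse_add: "transverse w (x + y) = transverse w x + transverse w y"
  and transverse_scaleR: "transverse w (c *\<^sub>R x) = c *\<^sub>R transverse w x"
  by (simp_all add: transverse_def algebra_simps)

lemma transverse_self: "norm w = 1 \<Longrightarrow> transverse w w = 0"
  by (simp add: transverse_def norm_eq_1)

lemma norm_transverse_le: "norm w = 1 \<Longrightarrow> norm (transverse w x) \<le> 2 * norm x"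
proof -
  assume w: "norm w = 1"
  have "norm (transverse w x) \<le> norm x + \<bar>x \<bullet> w\<bar> * norm w"
    unfolding transverse_def by (metis norm_triangle_ineq4 norm_scaleR real_norm_def)
  then show ?thesis using Cauchy_Schwarz_ineq2[of x w] w by simp
qed

lemma norm_le_axial_transverse:
  assumes "norm w = 1"
  shows "norm x \<le> \<bar>x \<bullet> w\<bar> + norm (transverse w x)"
proof -
  have "x = (x \<bullet> w) *\<^sub>R w + transverse w x" by (simp add: transverse_def)
  then have "norm x \<le> norm ((x \<bullet> w) *\<^sub>R w) + norm (transverse w x)"
    by (metis norm_triangle_ineq)
  then show ?thesis using assms by simp
qed

lemma radius_le: "radius z \<le> norm (pos z) + \<bar>snd (fst z)\<bar>"
  by (metis norm_Pair_le prod.collapse real_norm_def)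

lemma abs_axial_le_radius:
  assumes "norm w = 1"
  shows "\<bar>pos z \<bullet> w\<bar> \<le> radius z"
  using Cauchy_Schwarz_ineq2[of "pos z" w] norm_pos_le[of z] assms by simp

section \<open>Travel time along the collision orbit\<close>

context collision_scale
begin

text \<open>The reciprocal speed of the unperturbed collision orbit, continuous at the collision because
  \<open>V\<close> blows up there; its primitive \<open>travel\<close> is the time along that orbit, as a function of the
  signed position.\<close>

definition speed_inv :: "real \<Rightarrow> real" where
  "speed_inv s = (if s \<le> 0 then 0 else 1 / sqrt (2 * (V s + E0)))"

definition travel :: "real \<Rightarrow> real" where
  "travel x = integral {- s0..x} (\<lambda>r. speed_inv \<bar>r\<bar>)"

lemma V_E0_ge: "0 < s \<Longrightarrow> s \<le> s0 \<Longrightarrow> 1 \<le> V s + E0"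
  using small_scaleD(2)[OF scale, of s E0] by simp

lemma speed_inv_pos: "0 < s \<Longrightarrow> s \<le> s0 \<Longrightarrow> 0 < speed_inv s"
  using V_E0_ge[of s] by (simp add: speed_inv_def)

lemma speed_inv_nonneg: "s \<le> s0 \<Longrightarrow> 0 \<le> speed_inv s"
  using speed_inv_pos[of s] by (cases "s \<le> 0") (auto simp: speed_inv_def)

lemma speed_inv_mono: "s \<le> t \<Longrightarrow> t \<le> s0 \<Longrightarrow> speed_inv s \<le> speed_inv t"
  using V_antimono[of s t] V_E0_ge[of s] V_E0_ge[of t] speed_inv_nonneg[of t]
  by (cases "s \<le> 0") (auto simp: speed_inv_def intro!: divide_left_mono)

lemma speed_inv_cont: "continuous_on {0..s0} speed_inv"
  unfolding continuous_on_eq_continuous_within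
proof
  fix s assume s: "s \<in> {0..s0}"
  show "continuous (at s within {0..s0}) speed_inv"
  proof (cases "s = 0")
    case True
    have "filterlim (\<lambda>s. 2 * (E0 + V s)) at_top (at_right 0)"
      by (intro filterlim_tendsto_pos_mult_at_top[OF tendsto_const] filterlim_tendsto_add_at_top[OF tendsto_const] blowup) simp
    then have "((\<lambda>s. inverse (sqrt (2 * (E0 + V s)))) \<longlongrightarrow> 0) (at_right 0)"
      by (intro tendsto_inverse_0_at_top filterlim_compose[OF sqrt_at_top])
    moreover have "\<forall>\<^sub>F s in at_right 0. inverse (sqrt (2 * (E0 + V s))) = speed_inv s"
      using eventually_at_right_less[of "0::real"]
      by eventually_elim (auto simp: speed_inv_def add.commute divide_inverse)
    ultimately have "(speed_inv \<longlongrightarrow> 0) (at_right 0)"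
      by (rule Lim_transform_eventually)
    then show ?thesis
      using True s0_pos by (simp add: continuous_within at_within_Icc_at_right speed_inv_def)
  next
    case False
    then have "0 < s" using s by simp
    have "isCont (\<lambda>s. 1 / sqrt (2 * (V s + E0))) s"
      using V_E0_ge[of s] s \<open>0 < s\<close> DERIV_isCont[OF V_deriv[OF \<open>0 < s\<close>]]
      by (intro continuous_intros) auto
    moreover have "\<forall>\<^sub>F r in nhds s. 1 / sqrt (2 * (V r + E0)) = speed_inv r"
      using eventually_nhds_in_open[of "{0<..}" s] \<open>0 < s\<close>
      by (auto elim!: eventually_mono simp: speed_inv_def)
    ultimately have "isCont speed_inv s"
      using isCont_cong[of "\<lambda>r. 1 / sqrt (2 * (V r + E0))" speed_inv s] by simp
    then show ?thesis by (rule continuous_at_imp_continuous_at_within)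
  qed
qed

lemma travel_deriv:
  assumes "x \<in> {- s0..s0}"
  shows "(travel has_real_derivative speed_inv \<bar>x\<bar>) (at x within {- s0..s0})"
  unfolding travel_def
  by (rule integral_has_real_derivative[OF _ assms])
    (intro continuous_on_compose2[OF speed_inv_cont] continuous_intros, auto)

lemma travel_mono:
  assumes "- s0 \<le> x" "x \<le> y" "y \<le> s0"
  shows "travel x \<le> travel y"
proof -
  have "0 * (y - x) \<le> travel y - travel x"
    by (rule mvt_lower[OF assms(2), of travel "\<lambda>x. speed_inv \<bar>x\<bar>"])
      (use assms in \<open>auto intro!: speed_inv_nonneg intro: DERIV_subset[OF travel_deriv]\<close>)
  then show ?thesis by simp
qed

lemma travel_strict_mono:
  assumes "- s0 \<le> x" "x < y" "y \<le> s0"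
  shows "travel x < travel y"
proof -
  \<comment> \<open>The integrand of \<open>travel\<close> vanishes at 0 only; strictness is gained
    on a subinterval that avoids 0.\<close>
  obtain p q where pq: "x \<le> p" "p < q" "q \<le> y" "0 < p \<or> q < 0"
  proof (cases "0 < y")
    case True
    then show ?thesis using that[of "max x (y / 2)" y] assms by auto
  next
    case False
    then show ?thesis using that[of x "(x + y) / 2"] assms by auto
  qed
  have "(travel has_derivative (*) (speed_inv \<bar>r\<bar>)) (at r within {p..q})" if "p \<le> r" "r \<le> q" for r
    using DERIV_subset[OF travel_deriv[of r], of "{p..q}"] that pq assms
    unfolding has_field_derivative_def by auto
  then obtain r where r: "r \<in> {p..q}" "travel q - travel p = speed_inv \<bar>r\<bar> * (q - p)"
    using mvt_very_simple[of p q travel "\<lambda>x. (*) (speed_inv \<bar>x\<bar>)"] pq by force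
  have "0 < speed_inv \<bar>r\<bar>"
    using r pq assms by (intro speed_inv_pos) auto
  then have "travel p < travel q" using r pq by (smt (verit) mult_pos_pos)
  moreover have "travel x \<le> travel p" "travel q \<le> travel y"
    using pq assms by (auto intro!: travel_mono)
  ultimately show ?thesis by simp
qed

lemma travel_less_imp: "- s0 \<le> y \<Longrightarrow> x \<le> s0 \<Longrightarrow> travel x < travel y \<Longrightarrow> x < y"
  using travel_mono[of y x] by force

text \<open>The integrand is even, so approach and departure take equally long and the collision
  falls at half the transit time.\<close>

lemma travel_even:
  assumes "0 \<le> x" "x \<le> s0"
  shows "travel x - travel 0 = travel 0 - travel (- x)"
proof -
  have "((\<lambda>y. travel y + travel (- y)) has_vector_derivative 0) (at y within {0..s0})"
    if y: "y \<in> {0..s0}" for y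
  proof -
    have "(uminus has_real_derivative - 1) (at y within {0..s0})"
      using DERIV_minus[OF DERIV_ident] .
    then have "((\<lambda>y. travel (- y)) has_real_derivative speed_inv \<bar>y\<bar> * (- 1)) (at y within {0..s0})"
      using DERIV_image_chain[of travel "speed_inv \<bar>y\<bar>" uminus y "{0..s0}" "-1"]
        DERIV_subset[OF travel_deriv[of "- y"], of "uminus ` {0..s0}"] y
      by (auto simp: o_def)
    moreover have "(travel has_real_derivative speed_inv \<bar>y\<bar>) (at y within {0..s0})"
      using y by (intro DERIV_subset[OF travel_deriv]) auto
    ultimately show ?thesis
      unfolding has_real_derivative_iff_has_vector_derivative[symmetric]
      by (auto intro!: derivative_eq_intros)
  qed
  from has_vector_derivative_zero_constant[OF _ this]
  obtain c where "\<And>y. y \<in> {0..s0} \<Longrightarrow> travel y + travel (- y) = c" by auto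
  from this[of 0] this[of x] show ?thesis using assms by simp
qed

lemma travel_isCont: "\<bar>x\<bar> < s0 \<Longrightarrow> isCont travel x"
  using travel_deriv[of x] DERIV_isCont[of travel _ x] by (simp add: at_within_Icc_at abs_less_iff)

text \<open>The second rule holds also where the axial position crosses 0, because the integrand of
  \<open>travel\<close> is continuous there. This lets times be compared across the passage.\<close>

lemma travel_orbit_deriv:
  assumes U: "orbit V {a..b} U" and s: "\<And>t. t \<in> {a..b} \<Longrightarrow> radius (U t) \<le> s0"
    and w: "norm w = 1" and t: "t \<in> {a..b}"
  shows "((\<lambda>t. pos (U t) \<bullet> w) has_real_derivative vel (U t) \<bullet> w) (at t within {a..b})"
    and "((\<lambda>t. travel (pos (U t) \<bullet> w)) has_real_derivative
      speed_inv \<bar>pos (U t) \<bullet> w\<bar> * (vel (U t) \<bullet> w)) (at t within {a..b})"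
proof -
  show 1: "((\<lambda>t. pos (U t) \<bullet> w) has_real_derivative vel (U t) \<bullet> w) (at t within {a..b})"
    using has_real_derivative_inner[OF orbit_pos_deriv[OF U t] has_vector_derivative_const[of w]]
    by simp
  have "\<bar>pos (U r) \<bullet> w\<bar> \<le> s0" if "r \<in> {a..b}" for r
    using abs_axial_le_radius[OF w, of "U r"] s[OF that] by linarith
  then have "(\<lambda>t. pos (U t) \<bullet> w) ` {a..b} \<subseteq> {- s0..s0}"
    by (force simp: abs_le_iff)
  then show "((\<lambda>t. travel (pos (U t) \<bullet> w)) has_real_derivative
      speed_inv \<bar>pos (U t) \<bullet> w\<bar> * (vel (U t) \<bullet> w)) (at t within {a..b})"
    using DERIV_image_chain[OF DERIV_subset[OF travel_deriv, of "pos (U t) \<bullet> w"] 1] t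
    unfolding o_def by blast
qed

text \<open>The ratio of the actual speed to that of the unperturbed orbit at the same radius is
  sqrt ((V + E) / (V + E0)). As V + E0 \<ge> 1, an energy error \<beta> moves the quotient from 1 by
  at most \<beta>, uniformly down to radius 0, although both speeds are unbounded.\<close>

lemma speed_ratio:
  assumes "0 < radius z" "radius z \<le> s0" "\<bar>energy V z - E0\<bar> \<le> \<beta>" "\<beta> \<le> 1"
  shows "norm (vel z) * speed_inv (radius z) \<in> {1 - \<beta>..1 + \<beta>}"
proof -
  define p where "p = V (radius z) + E0"
  define q where "q = V (radius z) + energy V z"
  have p: "1 \<le> p" using V_E0_ge assms by (simp add: p_def)
  have "0 \<le> \<beta>" using assms by linarith
  have "norm (vel z) = sqrt (2 * q)"
    by (simp add: norm_eq_sqrt_inner q_def energy_def)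
  then have 1: "norm (vel z) * speed_inv (radius z) = sqrt (q / p)"
    using assms(1) by (simp add: speed_inv_def p_def[symmetric] real_sqrt_mult real_sqrt_divide)
  have "\<bar>q - p\<bar> \<le> \<beta>" using assms by (simp add: p_def q_def)
  moreover have "\<beta> * 1 \<le> \<beta> * p" using p \<open>0 \<le> \<beta>\<close> by (intro mult_left_mono)
  ultimately have qp: "1 - \<beta> \<le> q / p" "q / p \<le> 1 + \<beta>"
    using p by (simp_all add: field_simps abs_le_iff)
  have "(1 - \<beta>)\<^sup>2 \<le> 1 - \<beta>" "1 + \<beta> \<le> (1 + \<beta>)\<^sup>2"
    using \<open>0 \<le> \<beta>\<close> assms(4) by (auto simp: power2_eq_square mult_le_cancel_right1 algebra_simps mult_left_le)
  then show ?thesis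
    unfolding 1 using qp \<open>0 \<le> \<beta>\<close> assms(4) by (auto intro!: real_le_rsqrt real_le_lsqrt)
qed

text \<open>Speeds are unbounded near the origin, so errors proportional to the speed are integrated
  against the axial displacement, at most 2 s0, and not against time. This works because the axial
  velocity is at least half the speed. \<open>\<omega>\<close> is the error of evaluating
  \<open>speed_inv\<close> at the axial distance instead of the radius.\<close>

lemma passage_bounds:
  fixes U :: "real \<Rightarrow> 'a::euclidean_space state"
  assumes U: "orbit V {a..b} U" and "a \<le> b" and \<beta>: "0 < \<beta>" "\<beta> \<le> 1 / 2" and w: "norm w = 1"
    and En: "\<bar>energy V (U a) - E0\<bar> \<le> \<beta>" and s: "\<And>t. t \<in> {a..b} \<Longrightarrow> radius (U t) \<le> s0"
    and dir: "\<And>t. t \<in> {a..b} \<Longrightarrow> norm (sgn (vel (U t)) - w) \<le> \<beta>"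
    and tr: "norm (transverse w (pos (U a))) \<le> 2 * \<beta>" and eps: "\<bar>snd (fst (U a))\<bar> \<le> \<beta>"
    and uc: "\<And>s t. s \<in> {0..s0} \<Longrightarrow> t \<in> {0..s0} \<Longrightarrow> \<bar>s - t\<bar> \<le> (3 + 8 * s0) * \<beta> \<Longrightarrow>
      \<bar>speed_inv s - speed_inv t\<bar> \<le> \<omega>"
  shows "0 < vel (U b) \<bullet> w"
    and "norm (transverse w (pos (U b))) \<le> (2 + 8 * s0) * \<beta>"
    and "pos (U a) \<bullet> w \<le> pos (U b) \<bullet> w"
    and "\<bar>travel (pos (U b) \<bullet> w) - travel (pos (U a) \<bullet> w) - (b - a)\<bar> \<le> 2 * \<beta> * (b - a) + 2 * s0 * \<omega>"
proof -
  define \<xi> where "\<xi> = (\<lambda>t. pos (U t) \<bullet> w)"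
  define n where "n = (\<lambda>t. norm (vel (U t)))"
  define e where "e = (\<lambda>t. sgn (vel (U t)) \<bullet> w)"
  have \<xi>_abs: "\<bar>\<xi> t\<bar> \<le> radius (U t)" for t
    unfolding \<xi>_def by (rule abs_axial_le_radius[OF w])
  have speed: "0 < n t" "n t * speed_inv (radius (U t)) \<in> {1 - \<beta>..1 + \<beta>}" if t: "t \<in> {a..b}" for t
  proof -
    have En': "\<bar>energy V (U t) - E0\<bar> \<le> \<beta>"
      using orbit_energy_const[OF U _ t, of a] En \<open>a \<le> b\<close> by simp
    show "0 < n t"
      using vel_sq(3)[of "U t"] En' \<beta> orbit_radius_pos[OF U t] s[OF t] by (simp add: n_def)
    show "n t * speed_inv (radius (U t)) \<in> {1 - \<beta>..1 + \<beta>}"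
      unfolding n_def using speed_ratio[OF orbit_radius_pos[OF U t] s[OF t] En'] \<beta> by simp
  qed
  have v: "vel (U t) = n t *\<^sub>R sgn (vel (U t))" for t
    by (cases "vel (U t) = 0") (simp_all add: n_def sgn_div_norm)
  then have vw: "vel (U t) \<bullet> w = n t * e t" for t
    unfolding e_def by (metis inner_scaleR_left)
  have e: "1 - \<beta> \<le> e t" "e t \<le> 1" if t: "t \<in> {a..b}" for t
  proof -
    have "e t = 1 + (sgn (vel (U t)) - w) \<bullet> w"
      using w by (simp add: e_def inner_diff_left norm_eq_1)
    moreover have "\<bar>(sgn (vel (U t)) - w) \<bullet> w\<bar> \<le> \<beta>"
      using Cauchy_Schwarz_ineq2[of "sgn (vel (U t)) - w" w] dir[OF t] w by simp
    ultimately show "1 - \<beta> \<le> e t" by linarith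
    show "e t \<le> 1"
      using norm_cauchy_schwarz[of "sgn (vel (U t))" w] w by (simp add: e_def norm_sgn split: if_splits)
  qed
  have half: "n t / 2 \<le> n t * e t" if t: "t \<in> {a..b}" for t
    using mult_left_mono[of "1/2" "e t" "n t"] e[OF t] speed(1)[OF t] \<beta> by simp
  show "0 < vel (U b) \<bullet> w"
    unfolding vw using half[of b] speed(1)[of b] \<open>a \<le> b\<close> by simp
  have \<xi>': "(\<xi> has_real_derivative n t * e t) (at t within {a..b})" if "t \<in> {a..b}" for t
    using travel_orbit_deriv(1)[OF U s w that] unfolding \<xi>_def vw by simp
  have T': "((\<lambda>t. travel (\<xi> t)) has_real_derivative speed_inv \<bar>\<xi> t\<bar> * (n t * e t)) (at t within {a..b})"
    if "t \<in> {a..b}" for t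
    using travel_orbit_deriv(2)[OF U s w that] unfolding \<xi>_def vw by simp
  have "0 * (b - a) \<le> \<xi> b - \<xi> a"
  proof (rule mvt_lower[OF \<open>a \<le> b\<close> \<xi>'])
    show "0 \<le> n t * e t" if "t \<in> {a..b}" for t
      using half[OF that] speed(1)[OF that] by simp
  qed
  then show "pos (U a) \<bullet> w \<le> pos (U b) \<bullet> w" by (simp add: \<xi>_def)
  have s0_abs: "\<bar>\<xi> t\<bar> \<le> s0" if "t \<in> {a..b}" for t
    using \<xi>_abs[of t] s[OF that] by linarith
  have perp: "norm (transverse w (pos (U t))) \<le> (2 + 8 * s0) * \<beta>" if t: "t \<in> {a..b}" for t
  proof (cases "a = t")
    case True
    then show ?thesis using tr s0_pos \<beta> by (simp add: algebra_simps add_increasing2)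
  next
    case False
    then have "a < t" using t by simp
    have sub: "{a..t} \<subseteq> {a..b}" using t by auto
    have P: "((\<lambda>t. transverse w (pos (U t))) has_vector_derivative transverse w (vel (U r))) (at r within {a..t})"
      if "r \<in> {a..t}" for r
    proof -
      have "r \<in> {a..b}" using that t by auto
      then have "((\<lambda>t. pos (U t)) has_vector_derivative vel (U r)) (at r within {a..t})"
        "((\<lambda>t. pos (U t) \<bullet> w) has_real_derivative vel (U r) \<bullet> w) (at r within {a..t})"
        using has_vector_derivative_within_subset[OF orbit_pos_deriv[OF U] sub]
          DERIV_subset[OF travel_orbit_deriv(1)[OF U s w] sub] by auto
      then show ?thesis
        unfolding transverse_def by (auto intro!: derivative_eq_intros)
    qed
    \<comment> \<open>The transverse speed is at most 2\<beta> times the speed, hence at most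
      4\<beta> times the axial velocity; this multiple of the axial position therefore majorizes the
      transverse drift.\<close>
    have X: "((\<lambda>t. 4 * \<beta> * \<xi> t) has_real_derivative 4 * \<beta> * (n r * e r)) (at r within {a..t})"
      if "r \<in> {a..t}" for r
      using DERIV_cmult[OF DERIV_subset[OF \<xi>' sub], of r "4 * \<beta>"] that t by auto
    have "norm (transverse w (pos (U t)) - transverse w (pos (U a))) \<le> 4 * \<beta> * \<xi> t - 4 * \<beta> * \<xi> a"
    proof (rule differentiable_bound_general[OF \<open>a < t\<close>])
      show "continuous_on {a..t} (\<lambda>t. transverse w (pos (U t)))"
        using P by (meson continuous_on_eq_continuous_within has_vector_derivative_continuous)
      show "continuous_on {a..t} (\<lambda>t. 4 * \<beta> * \<xi> t)"
        using X by (meson DERIV_continuous continuous_on_eq_continuous_within)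
      fix r assume r: "a < r" "r < t"
      then have r': "r \<in> {a..b}" using t by auto
      show "((\<lambda>t. transverse w (pos (U t))) has_vector_derivative transverse w (vel (U r))) (at r)"
        using P[of r] r by (simp add: at_within_Icc_at)
      show "((\<lambda>t. 4 * \<beta> * \<xi> t) has_vector_derivative 4 * \<beta> * (n r * e r)) (at r)"
        using X[of r] r by (simp add: at_within_Icc_at has_real_derivative_iff_has_vector_derivative)
      have "transverse w (vel (U r)) = n r *\<^sub>R transverse w (sgn (vel (U r)) - w)"
        using transverse_add[of w "sgn (vel (U r)) - w" w] transverse_self[OF w]
          transverse_scaleR[of w "n r" "sgn (vel (U r))"] v[of r] by simp
      then have "norm (transverse w (vel (U r))) \<le> n r * (2 * \<beta>)"
        using norm_transverse_le[OF w, of "sgn (vel (U r)) - w"] dir[OF r'] speed(1)[OF r'] by simp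
      also have "\<dots> = 4 * \<beta> * (n r / 2)" by simp
      also have "\<dots> \<le> 4 * \<beta> * (n r * e r)"
        using half[OF r'] \<beta> by (intro mult_left_mono) auto
      finally show "norm (transverse w (vel (U r))) \<le> 4 * \<beta> * (n r * e r)" .
    qed
    also have "\<dots> = 4 * \<beta> * (\<xi> t - \<xi> a)" by (simp add: right_diff_distrib)
    also have "\<dots> \<le> 4 * \<beta> * (2 * s0)"
      using s0_abs[OF t] s0_abs[of a] \<open>a \<le> b\<close> \<beta> by (intro mult_left_mono) auto
    finally have "norm (transverse w (pos (U t))) \<le> 2 * \<beta> + 4 * \<beta> * (2 * s0)"
      using tr norm_triangle_sub[of "transverse w (pos (U t))" "transverse w (pos (U a))"] by linarith
    then show ?thesis by (simp add: algebra_simps)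
  qed
  show "norm (transverse w (pos (U b))) \<le> (2 + 8 * s0) * \<beta>" using perp \<open>a \<le> b\<close> by simp
  have close: "speed_inv (radius (U t)) - \<omega> \<le> speed_inv \<bar>\<xi> t\<bar>" "speed_inv \<bar>\<xi> t\<bar> \<le> speed_inv (radius (U t))"
    if t: "t \<in> {a..b}" for t
  proof -
    have "snd (fst (U t)) = snd (fst (U a))"
      using orbit_eps_const[OF U _ t, of a] \<open>a \<le> b\<close> by simp
    then have "radius (U t) \<le> \<bar>\<xi> t\<bar> + (3 + 8 * s0) * \<beta>"
      using radius_le[of "U t"] norm_le_axial_transverse[OF w, of "pos (U t)"] perp[OF t] eps
      by (simp add: \<xi>_def algebra_simps)
    then have "\<bar>speed_inv (radius (U t)) - speed_inv \<bar>\<xi> t\<bar>\<bar> \<le> \<omega>"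
      using \<xi>_abs[of t] s[OF t] by (intro uc) auto
    then show "speed_inv (radius (U t)) - \<omega> \<le> speed_inv \<bar>\<xi> t\<bar>" by linarith
    show "speed_inv \<bar>\<xi> t\<bar> \<le> speed_inv (radius (U t))"
      using \<xi>_abs[of t] s[OF t] by (intro speed_inv_mono)
  qed
  have "0 \<le> \<omega>" using uc[of 0 0] s0_pos \<beta> by simp
  have upper: "travel (\<xi> b) - travel (\<xi> a) \<le> (1 + \<beta>) * (b - a)"
  proof (rule mvt_upper[OF \<open>a \<le> b\<close> T'])
    fix t assume t: "t \<in> {a..b}"
    have "n t * e t \<le> n t * 1" using e[OF t] speed(1)[OF t] by (intro mult_left_mono) auto
    then have "speed_inv \<bar>\<xi> t\<bar> * (n t * e t) \<le> speed_inv (radius (U t)) * n t"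
      using close(2)[OF t] half[OF t] speed(1)[OF t] s[OF t]
      by (intro mult_mono speed_inv_nonneg) auto
    then show "speed_inv \<bar>\<xi> t\<bar> * (n t * e t) \<le> 1 + \<beta>"
      using speed(2)[OF t] by (simp add: mult.commute)
  qed
  \<comment> \<open>The term \<open>\<omega> * \<xi>\<close> compensates for replacing the radius by
    |\<xi>|: the error, \<open>\<omega>\<close> times the axial velocity, has no uniform pointwise
    bound but integrates to at most 2 s0 \<omega>.\<close>
  have lower: "(1 - 2 * \<beta>) * (b - a) \<le> (travel (\<xi> b) + \<omega> * \<xi> b) - (travel (\<xi> a) + \<omega> * \<xi> a)"
  proof (rule mvt_lower[OF \<open>a \<le> b\<close>, of "\<lambda>t. travel (\<xi> t) + \<omega> * \<xi> t"])
    fix t assume t: "t \<in> {a..b}"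
    show "((\<lambda>t. travel (\<xi> t) + \<omega> * \<xi> t) has_real_derivative
      speed_inv \<bar>\<xi> t\<bar> * (n t * e t) + \<omega> * (n t * e t)) (at t within {a..b})"
      by (intro DERIV_add DERIV_cmult T'[OF t] \<xi>'[OF t])
    have "1 - 2 * \<beta> \<le> (1 - \<beta>) * (1 - \<beta>)" by (simp add: algebra_simps)
    also have "\<dots> \<le> (n t * speed_inv (radius (U t))) * e t"
      using speed(2)[OF t] e[OF t] \<beta> by (intro mult_mono) auto
    also have "\<dots> = speed_inv (radius (U t)) * (n t * e t)" by simp
    also have "\<dots> \<le> (speed_inv \<bar>\<xi> t\<bar> + \<omega>) * (n t * e t)"
      using close(1)[OF t] half[OF t] speed(1)[OF t] by (intro mult_right_mono) auto
    finally show "1 - 2 * \<beta> \<le> speed_inv \<bar>\<xi> t\<bar> * (n t * e t) + \<omega> * (n t * e t)"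
      by (simp add: distrib_right)
  qed
  have "\<omega> * \<xi> b - \<omega> * \<xi> a \<le> 2 * s0 * \<omega>"
    using mult_left_mono[of "\<xi> b - \<xi> a" "2 * s0" \<omega>] s0_abs[of a] s0_abs[of b] \<open>a \<le> b\<close> \<open>0 \<le> \<omega>\<close>
    by (simp add: right_diff_distrib mult.commute)
  moreover define p where "p = \<beta> * (b - a)"
  have "0 \<le> p" "0 \<le> 2 * s0 * \<omega>" using \<beta> \<open>a \<le> b\<close> s0_pos \<open>0 \<le> \<omega>\<close> by (auto simp: p_def)
  moreover have "travel (\<xi> b) - travel (\<xi> a) \<le> (b - a) + p"
    using upper by (simp only: p_def distrib_right mult_1)
  moreover have "(b - a) - 2 * p \<le> (travel (\<xi> b) + \<omega> * \<xi> b) - (travel (\<xi> a) + \<omega> * \<xi> a)"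
    using lower by (simp only: p_def left_diff_distrib mult_1 mult.assoc)
  ultimately have "\<bar>travel (\<xi> b) - travel (\<xi> a) - (b - a)\<bar> \<le> 2 * p + 2 * s0 * \<omega>"
    unfolding abs_le_iff by linarith
  then show "\<bar>travel (pos (U b) \<bullet> w) - travel (pos (U a) \<bullet> w) - (b - a)\<bar> \<le> 2 * \<beta> * (b - a) + 2 * s0 * \<omega>"
    by (simp only: \<xi>_def p_def mult.assoc)
qed

text \<open>The state at which the unperturbed collision orbit with direction \<open>w\<close> has signed position \<open>\<xi>\<close>.\<close>

definition radial_state :: "'a::euclidean_space \<Rightarrow> real \<Rightarrow> 'a state" where
  "radial_state w \<xi> = ((\<xi> *\<^sub>R w, 0), sqrt (2 * (V \<bar>\<xi>\<bar> + E0)) *\<^sub>R w)"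

definition transit_time :: "real \<Rightarrow> real" where
  "transit_time \<rho> = travel \<rho> - travel (- \<rho>)"

lemma radial_state_simps:
  assumes "norm w = 1" "0 < \<bar>\<xi>\<bar>" "\<bar>\<xi>\<bar> \<le> s0"
  shows "radius (radial_state w \<xi>) = \<bar>\<xi>\<bar>" "energy V (radial_state w \<xi>) = E0"
    "sq_momentum (radial_state w \<xi>) = 0" "vel (radial_state w \<xi>) \<noteq> 0"
    "sgn (vel (radial_state w \<xi>)) = w" "pos (radial_state w \<xi>) \<bullet> w = \<xi>"
    "pos (radial_state w \<xi>) = \<xi> *\<^sub>R w" "snd (fst (radial_state w \<xi>)) = 0"
proof -
  have q: "0 < V \<bar>\<xi>\<bar> + E0" using V_E0_ge[OF assms(2,3)] by simp
  have ww: "w \<bullet> w = 1" using assms(1) by (simp add: norm_eq_1)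
  show r: "radius (radial_state w \<xi>) = \<bar>\<xi>\<bar>"
    using assms(1) by (simp add: radial_state_def norm_Pair)
  show "energy V (radial_state w \<xi>) = E0"
    unfolding energy_def r using q by (simp add: radial_state_def ww field_simps)
  show "sq_momentum (radial_state w \<xi>) = 0"
    by (simp add: sq_momentum_def radial_state_def ww power2_eq_square)
  show "vel (radial_state w \<xi>) \<noteq> 0"
    using q ww by (auto simp: radial_state_def)
  show "sgn (vel (radial_state w \<xi>)) = w"
    using q assms(1) by (simp add: radial_state_def sgn_scaleR sgn_div_norm)
  show "pos (radial_state w \<xi>) \<bullet> w = \<xi>" "pos (radial_state w \<xi>) = \<xi> *\<^sub>R w"
    "snd (fst (radial_state w \<xi>)) = 0"
    by (simp_all add: radial_state_def ww)
qed

lemma transit_time_half: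
  assumes "0 \<le> \<rho>" "\<rho> \<le> s0"
  shows "travel 0 - travel (- \<rho>) = transit_time \<rho> / 2"
  using travel_even[OF assms] by (simp add: transit_time_def)

lemma tendsto_axial: "((\<lambda>z. pos z \<bullet> w) \<longlongrightarrow> pos z1 \<bullet> w) (nhds z1)"
  by (intro tendsto_intros) (simp_all add: filterlim_ident)

text \<open>The end time \<open>b\<close> is arbitrary up to the transit time, and the orbit is not
  assumed to exist beyond it. So the estimate serves orbits that cross as well as orbits that
  collide on the way, and it supplies the confinement needed for continuation.\<close>

lemma passage:
  fixes w :: "'a::euclidean_space"
  assumes w: "norm w = 1" and \<rho>: "0 < \<rho>" "4 * \<rho> \<le> s0" and "0 < \<delta>"
  obtains \<alpha> where "0 < \<alpha>" "\<And>U a b. a \<le> b \<Longrightarrow> b \<le> a + transit_time \<rho> \<Longrightarrow> orbit V {a..b} U \<Longrightarrow>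
    dist (U a) (radial_state w (- \<rho>)) < \<alpha> \<Longrightarrow>
    radius (U b) < s0 \<and> \<bar>energy V (U b) - E0\<bar> < \<delta> \<and> norm (sgn (vel (U b)) - w) < \<delta> \<and>
    norm (transverse w (pos (U b))) < \<delta> \<and> \<bar>snd (fst (U b))\<bar> < \<delta> \<and> 0 < vel (U b) \<bullet> w \<and>
    \<bar>travel (pos (U b) \<bullet> w) - travel (- \<rho>) - (b - a)\<bar> < \<delta>"
proof -
  define L where "L = transit_time \<rho>"
  have "0 < L"
    unfolding L_def transit_time_def using travel_strict_mono[of "- \<rho>" \<rho>] \<rho> by simp
  have min4: "min (min a b) (min c d) \<le> a" "min (min a b) (min c d) \<le> b"
    "min (min a b) (min c d) \<le> c" "min (min a b) (min c d) \<le> d" for a b c d :: real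
    by auto
  \<comment> \<open>The bound \<rho>/2 keeps the radius below 3\<rho> < s0: axial distance below
    2\<rho>, transverse part and \<epsilon> below \<rho>/2 each. The gap of \<open>travel\<close>
    between \<rho> and 2\<rho> prevents the axial position from passing 2\<rho> within the transit
    time.\<close>
  define \<delta>' where "\<delta>' = min (min \<delta> 1) (min (\<rho> / 2) (travel (2 * \<rho>) - travel \<rho>))"
  have "0 < \<delta>'"
    using \<open>0 < \<delta>\<close> \<rho> travel_strict_mono[of \<rho> "2 * \<rho>"] by (auto simp: \<delta>'_def)
  note \<delta>' = \<open>0 < \<delta>'\<close> min4[of \<delta> 1 "\<rho> / 2" "travel (2 * \<rho>) - travel \<rho>", folded \<delta>'_def]
  \<comment> \<open>The error of \<open>travel\<close> consists of three quarters of
    \<open>\<delta>'\<close>: the initial deviation, the term 2 \<beta> L from energy and direction,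
    and 2 s0 \<omega> from this choice.\<close>
  define \<omega> where "\<omega> = \<delta>' / (8 * s0)"
  have \<omega>: "0 < \<omega>" "2 * s0 * \<omega> = \<delta>' / 4" using \<delta>' s0_pos by (auto simp: \<omega>_def)
  have "uniformly_continuous_on {0..s0} speed_inv"
    by (rule compact_uniformly_continuous[OF speed_inv_cont]) simp
  then obtain \<kappa> where \<kappa>: "0 < \<kappa>" "\<And>s t. s \<in> {0..s0} \<Longrightarrow> t \<in> {0..s0} \<Longrightarrow> dist t s < \<kappa> \<Longrightarrow>
      dist (speed_inv t) (speed_inv s) < \<omega>"
    unfolding uniformly_continuous_on_def using \<omega>(1) by metis
  \<comment> \<open>In units of \<beta>, this bounds radius minus axial distance: 2 + 8 s0 from the
    transverse part and 1 from \<epsilon>.\<close>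
  define K where "K = 3 + 8 * s0"
  have K: "3 \<le> K" using s0_pos by (simp add: K_def)
  define \<beta> where "\<beta> = min (min (1 / 2) (\<delta>' / (2 * K))) (min (\<kappa> / (2 * K)) (\<delta>' / (8 * (L + 1))))"
  have "0 < \<beta>" using \<delta>' \<kappa>(1) K \<open>0 < L\<close> by (auto simp: \<beta>_def)
  note \<beta> = \<open>0 < \<beta>\<close> min4[of "1 / 2" "\<delta>' / (2 * K)" "\<kappa> / (2 * K)" "\<delta>' / (8 * (L + 1))", folded \<beta>_def]
  have K\<beta>: "K * \<beta> \<le> \<delta>' / 2" "K * \<beta> < \<kappa>" using \<beta> K \<kappa>(1) by (auto simp: field_simps)
  have "\<beta> * (8 * (L + 1)) \<le> \<delta>'" using \<beta>(5) \<open>0 < L\<close> by (simp add: pos_le_divide_eq)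
  then have L\<beta>: "2 * \<beta> * L \<le> \<delta>' / 4" using \<beta>(1) by (simp add: algebra_simps)
  have "3 * \<beta> \<le> K * \<beta>" using K \<beta>(1) by simp
  then have \<beta>\<delta>: "\<beta> < \<delta>'" using K\<beta>(1) \<beta>(1) \<delta>'(1) by linarith
  have uc: "\<bar>speed_inv s - speed_inv t\<bar> \<le> \<omega>"
    if "s \<in> {0..s0}" "t \<in> {0..s0}" "\<bar>s - t\<bar> \<le> (3 + 8 * s0) * \<beta>" for s t
    using \<kappa>(2)[OF that(2,1)] that(3) K\<beta>(2) by (simp add: dist_real_def K_def)
  \<comment> \<open>The initial direction error uses \<beta>/2. Of the turning, the arctan part
    takes 4 \<beta>/16 = \<beta>/4; once \<open>r\<close> is fixed, the bound \<open>\<mu>\<close>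
    on the momentum is chosen so that the rest is at most \<beta>/4.\<close>
  obtain r where r: "small_scale E0 (\<beta> / 16) r" using small_scale_exists[of "\<beta> / 16"] \<beta>(1) by auto
  have "0 < r" using r by (simp add: small_scale_def)
  define \<mu> where "\<mu> = \<beta> * r\<^sup>2 / (4 * (L + 1))"
  have "0 < \<mu>" using \<beta>(1) \<open>0 < r\<close> \<open>0 < L\<close> by (simp add: \<mu>_def)
  have "\<mu> / r\<^sup>2 * L = \<beta> / 4 * (L / (L + 1))" using \<open>0 < r\<close> by (simp add: \<mu>_def)
  also have "\<dots> \<le> \<beta> / 4 * 1" using \<open>0 < L\<close> \<beta>(1) by (intro mult_left_mono) auto
  finally have \<mu>L: "\<mu> / r\<^sup>2 * L \<le> \<beta> / 4" by simp
  define z1 where "z1 = radial_state w (- \<rho>)"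
  have \<rho>': "0 < \<bar>- \<rho>\<bar>" "\<bar>- \<rho>\<bar> \<le> s0" using \<rho> by auto
  note z1 = radial_state_simps[OF w \<rho>', folded z1_def]
  have fst': "(fst \<longlongrightarrow> fst z1) (nhds z1)" and snd': "(snd \<longlongrightarrow> snd z1) (nhds z1)"
    and pos': "((\<lambda>z. pos z) \<longlongrightarrow> pos z1) (nhds z1)" and eps': "((\<lambda>z. snd (fst z)) \<longlongrightarrow> snd (fst z1)) (nhds z1)"
    by (intro tendsto_fst tendsto_snd filterlim_ident)+
  have "((\<lambda>z. V (radius z)) \<longlongrightarrow> V (radius z1)) (nhds z1)"
    by (rule isCont_tendsto_compose[OF DERIV_isCont[OF V_deriv] tendsto_norm[OF fst']])
      (use z1(1) \<rho> in simp)
  then have "((\<lambda>z. energy V z) \<longlongrightarrow> E0) (nhds z1)"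
    using snd' unfolding z1(2)[symmetric] energy_def
    by (intro tendsto_intros) (simp_all add: filterlim_ident)
  then have ev1: "\<forall>\<^sub>F z in nhds z1. dist (energy V z) E0 < \<beta>"
    by (rule tendstoD[OF _ \<beta>(1)])
  have "((\<lambda>z. sqrt (sq_momentum z)) \<longlongrightarrow> sqrt (sq_momentum z1)) (nhds z1)"
    unfolding sq_momentum_def by (intro tendsto_intros pos' snd')
  then have ev2: "\<forall>\<^sub>F z in nhds z1. dist (sqrt (sq_momentum z)) 0 < \<mu>"
    using tendstoD[OF _ \<open>0 < \<mu>\<close>] z1(3) by force
  have ev3: "\<forall>\<^sub>F z in nhds z1. dist (sgn (vel z)) w < \<beta> / 2"
    using tendstoD[OF tendsto_sgn[OF snd' z1(4)], of "\<beta> / 2"] \<beta>(1) z1(5) by simp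
  have ev4: "\<forall>\<^sub>F z in nhds z1. dist (pos z) ((- \<rho>) *\<^sub>R w) < \<beta>"
    using tendstoD[OF pos' \<beta>(1)] z1(7) by simp
  have ev5: "\<forall>\<^sub>F z in nhds z1. dist (snd (fst z)) 0 < \<beta>"
    using tendstoD[OF eps' \<beta>(1)] z1(8) by simp
  have "((\<lambda>z. travel (pos z \<bullet> w)) \<longlongrightarrow> travel (pos z1 \<bullet> w)) (nhds z1)"
    by (rule isCont_tendsto_compose[OF travel_isCont tendsto_axial]) (use z1(6) \<rho> in simp)
  then have ev6: "\<forall>\<^sub>F z in nhds z1. dist (travel (pos z \<bullet> w)) (travel (- \<rho>)) < \<delta>' / 4"
    using tendstoD[of _ _ _ "\<delta>' / 4"] \<delta>'(1) z1(6) by force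
  have ev7: "\<forall>\<^sub>F z in nhds z1. dist (radius z) \<rho> < \<rho>"
    using tendstoD[OF tendsto_norm[OF fst'] \<rho>(1)] z1(1) \<rho> by simp
  obtain \<alpha> where \<alpha>: "0 < \<alpha>" "\<And>z. dist z z1 < \<alpha> \<Longrightarrow> dist (energy V z) E0 < \<beta> \<and>
      dist (sqrt (sq_momentum z)) 0 < \<mu> \<and> dist (sgn (vel z)) w < \<beta> / 2 \<and>
      dist (pos z) ((- \<rho>) *\<^sub>R w) < \<beta> \<and> dist (snd (fst z)) 0 < \<beta> \<and>
      dist (travel (pos z \<bullet> w)) (travel (- \<rho>)) < \<delta>' / 4 \<and> dist (radius z) \<rho> < \<rho>"
    using eventually_conj[OF ev1 eventually_conj[OF ev2 eventually_conj[OF ev3 eventually_conj[OF ev4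
      eventually_conj[OF ev5 eventually_conj[OF ev6 ev7]]]]]]
    unfolding eventually_nhds_metric by auto
  show ?thesis
  proof (rule that[OF \<alpha>(1)])
    fix U a b
    assume "a \<le> b" and b: "b \<le> a + transit_time \<rho>" and U: "orbit V {a..b} U"
      and near: "dist (U a) (radial_state w (- \<rho>)) < \<alpha>"
    note nr = \<alpha>(2)[OF near[folded z1_def]]
    have En: "\<bar>energy V (U a) - E0\<bar> \<le> \<beta>" and mom: "sqrt (sq_momentum (U a)) \<le> \<mu>"
      and dir0: "norm (sgn (vel (U a)) - w) \<le> \<beta> / 2"
      and pos0: "norm (pos (U a) + \<rho> *\<^sub>R w) \<le> \<beta>" and eps0: "\<bar>snd (fst (U a))\<bar> \<le> \<beta>"
      and tr0: "\<bar>travel (pos (U a) \<bullet> w) - travel (- \<rho>)\<bar> \<le> \<delta>' / 4"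
      and rad0: "radius (U a) < s0"
      using nr \<rho> by (auto simp: dist_norm abs_le_iff)
    have trans0: "norm (transverse w (pos (U a))) \<le> 2 * \<beta>"
    proof -
      have "transverse w (pos (U a)) = transverse w (pos (U a) + \<rho> *\<^sub>R w)"
        using transverse_add[of w "pos (U a)" "\<rho> *\<^sub>R w"] transverse_scaleR[of w \<rho> w] transverse_self[OF w]
        by simp
      then show ?thesis using norm_transverse_le[OF w, of "pos (U a) + \<rho> *\<^sub>R w"] pos0 by simp
    qed
    have ax0: "- (3 / 2) * \<rho> \<le> pos (U a) \<bullet> w"
    proof -
      have "\<bar>(pos (U a) + \<rho> *\<^sub>R w) \<bullet> w\<bar> \<le> \<beta>"
        using Cauchy_Schwarz_ineq2[of "pos (U a) + \<rho> *\<^sub>R w" w] pos0 w by simp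
      then show ?thesis using w \<beta>\<delta> \<delta>'(4) by (simp add: inner_add_left norm_eq_1)
    qed
    have main: "norm (sgn (vel (U t)) - w) \<le> \<beta> \<and> 0 < vel (U t) \<bullet> w \<and>
        norm (transverse w (pos (U t))) < \<delta>' \<and> - (3 / 2) * \<rho> \<le> pos (U t) \<bullet> w \<and>
        \<bar>travel (pos (U t) \<bullet> w) - travel (- \<rho>) - (t - a)\<bar> < \<delta>'"
      if t: "t \<in> {a..b}" and s: "\<And>q. q \<in> {a..t} \<Longrightarrow> radius (U q) \<le> s0" for t
    proof -
      have "a \<le> t" using t by simp
      have Ut: "orbit V {a..t} U" by (rule orbit_subset[OF U]) (use t in auto)
      have dir: "norm (sgn (vel (U q)) - w) \<le> \<beta>" if q: "q \<in> {a..t}" for q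
      proof -
        have Uq: "orbit V {a..q} U" by (rule orbit_subset[OF Ut]) (use q in auto)
        have "norm (sgn (vel (U q)) - sgn (vel (U a)))
            \<le> (if sq_momentum (U a) = 0 then 0 else 4 * (\<beta> / 16) + sqrt (sq_momentum (U a)) / r\<^sup>2 * (q - a))"
          by (rule direction_estimate[OF Uq _ _ s r]) (use q En \<beta> in auto)
        also have "\<dots> \<le> 4 * (\<beta> / 16) + sqrt (sq_momentum (U a)) / r\<^sup>2 * (q - a)"
          using \<beta>(1) q sq_momentum_nonneg[of "U a"] by auto
        also have "sqrt (sq_momentum (U a)) / r\<^sup>2 * (q - a) \<le> \<mu> / r\<^sup>2 * L"
          using mom q t b \<open>0 < \<mu>\<close> by (intro mult_mono divide_right_mono) (auto simp: L_def)
        finally have "norm (sgn (vel (U q)) - sgn (vel (U a))) \<le> \<beta> / 2" using \<mu>L by linarith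
        then show ?thesis
          using dir0 norm_triangle_ineq[of "sgn (vel (U q)) - sgn (vel (U a))" "sgn (vel (U a)) - w"] by simp
      qed
      note pb = passage_bounds[OF Ut \<open>a \<le> t\<close> \<beta>(1,2) w En s dir trans0 eps0 uc]
      have "norm (transverse w (pos (U t))) \<le> K * \<beta>"
        using pb(2) \<beta>(1) by (simp add: K_def algebra_simps)
      then have "norm (transverse w (pos (U t))) < \<delta>'" using K\<beta>(1) \<delta>'(1) by linarith
      moreover have "2 * \<beta> * (t - a) \<le> 2 * \<beta> * L"
        using \<beta>(1) t b by (intro mult_left_mono) (auto simp: L_def)
      then have "\<bar>travel (pos (U t) \<bullet> w) - travel (- \<rho>) - (t - a)\<bar> < \<delta>'"
        using pb(4) tr0 L\<beta> \<omega>(2) \<delta>'(1) by linarith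
      ultimately show ?thesis using pb(1,3) ax0 dir[of t] \<open>a \<le> t\<close> by auto
    qed
    have eps: "\<bar>snd (fst (U t))\<bar> \<le> \<beta>" if "t \<in> {a..b}" for t
      using orbit_eps_const[OF U _ that, of a] eps0 \<open>a \<le> b\<close> by simp
    \<comment> \<open>Closes the circle: \<open>main\<close> presupposes confinement up to
      \<open>t\<close>, and its \<open>travel\<close> estimate keeps the axial position below
      2\<rho>, hence the radius strictly below \<open>s0\<close>.\<close>
    have conf: "radius (U t) < s0" if t: "t \<in> {a..b}" for t
    proof (rule first_exit_induct[where h = "\<lambda>t. radius (U t)", OF \<open>a \<le> b\<close> _ rad0 _ t])
      show "continuous_on {a..b} (\<lambda>t. radius (U t))"
        by (intro continuous_intros orbit_continuous[OF U])
      fix q assume q: "q \<in> {a..b}" and s: "\<And>p. p \<in> {a..q} \<Longrightarrow> radius (U p) \<le> s0"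
      have m: "norm (transverse w (pos (U q))) < \<delta>'" "- (3 / 2) * \<rho> \<le> pos (U q) \<bullet> w"
        "\<bar>travel (pos (U q) \<bullet> w) - travel (- \<rho>) - (q - a)\<bar> < \<delta>'"
        using main[OF q s] by blast+
      moreover have "q - a \<le> travel \<rho> - travel (- \<rho>)" using q b by (simp add: transit_time_def)
      ultimately have tl: "travel (pos (U q) \<bullet> w) < travel (2 * \<rho>)"
        using \<delta>'(5) by linarith
      have "radius (U q) \<le> s0" using s[of q] q by simp
      then have "pos (U q) \<bullet> w \<le> s0" using abs_axial_le_radius[OF w, of "U q"] by linarith
      then have "pos (U q) \<bullet> w < 2 * \<rho>" using \<rho> s0_pos by (intro travel_less_imp[OF _ _ tl]) auto
      then have "\<bar>pos (U q) \<bullet> w\<bar> < 2 * \<rho>" using m(2) \<rho>(1) by linarith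
      then show "radius (U q) < s0"
        using radius_le[of "U q"] norm_le_axial_transverse[OF w, of "pos (U q)"] m(1) eps[OF q] \<beta>\<delta> \<delta>'(4) \<rho>
        by linarith
    qed
    have "\<bar>energy V (U b) - E0\<bar> \<le> \<beta>"
      using orbit_energy_const[OF U, of b a] En \<open>a \<le> b\<close> by simp
    moreover have "radius (U q) \<le> s0" if "q \<in> {a..b}" for q
      using conf[OF that] by simp
    ultimately show "radius (U b) < s0 \<and> \<bar>energy V (U b) - E0\<bar> < \<delta> \<and> norm (sgn (vel (U b)) - w) < \<delta> \<and>
      norm (transverse w (pos (U b))) < \<delta> \<and> \<bar>snd (fst (U b))\<bar> < \<delta> \<and> 0 < vel (U b) \<bullet> w \<and>
      \<bar>travel (pos (U b) \<bullet> w) - travel (- \<rho>) - (b - a)\<bar> < \<delta>"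
      using main[of b] conf[of b] eps[of b] \<beta>\<delta> \<delta>'(2) \<open>a \<le> b\<close> by auto
  qed
qed


text \<open>Energy and direction replace the velocity as coordinates: they are what the passage
  controls, and the speed is recovered from energy and radius.\<close>

lemma radial_decomposition:
  fixes w :: "'a::euclidean_space"
  shows "z = (((pos z \<bullet> w) *\<^sub>R w + transverse w (pos z), snd (fst z)),
    sqrt (2 * (V (norm ((pos z \<bullet> w) *\<^sub>R w + transverse w (pos z), snd (fst z))) + energy V z)) *\<^sub>R sgn (vel z))"
proof -
  have p: "(pos z \<bullet> w) *\<^sub>R w + transverse w (pos z) = pos z" by (simp add: transverse_def)
  have "vel z = norm (vel z) *\<^sub>R sgn (vel z)" by (cases "vel z = 0") (simp_all add: sgn_div_norm)
  moreover have "sqrt (2 * (V (norm (pos z, snd (fst z))) + energy V z)) = norm (vel z)"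
    by (simp add: energy_def norm_eq_sqrt_inner)
  ultimately show ?thesis unfolding p by (simp add: prod_eq_iff)
qed

text \<open>At the exit the radius is close to \<rho> > 0, where the reconstruction
  \<open>\<Psi>\<close> of the state from the controlled quantities is continuous. The axial
  position is recovered from \<open>travel\<close> by strict monotonicity.\<close>

lemma passage_exit:
  fixes w :: "'a::euclidean_space"
  assumes w: "norm w = 1" and \<rho>: "0 < \<rho>" "4 * \<rho> \<le> s0" and "0 < \<delta>"
  obtains \<alpha> where "0 < \<alpha>" "\<And>U a. orbit V {a..a + transit_time \<rho>} U \<Longrightarrow>
    dist (U a) (radial_state w (- \<rho>)) < \<alpha> \<Longrightarrow>
    dist (U (a + transit_time \<rho>)) (radial_state w \<rho>) < \<delta>"
proof -
  have "0 < transit_time \<rho>"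
    unfolding transit_time_def using travel_strict_mono[of "- \<rho>" \<rho>] \<rho> by simp
  define \<Psi> :: "(real \<times> 'a) \<times> (real \<times> real) \<times> 'a \<Rightarrow> 'a state" where
    "\<Psi> = (\<lambda>p. ((fst (fst p) *\<^sub>R w + snd (fst p), fst (fst (snd p))),
      sqrt (2 * (V (norm (fst (fst p) *\<^sub>R w + snd (fst p), fst (fst (snd p)))) + snd (fst (snd p)))) *\<^sub>R snd (snd p)))"
  define p0 :: "(real \<times> 'a) \<times> (real \<times> real) \<times> 'a" where "p0 = ((\<rho>, 0), (0, E0), w)"
  have id: "((\<lambda>p. p) \<longlongrightarrow> p0) (nhds p0)" by (rule filterlim_ident)
  have r0: "norm (fst (fst p0) *\<^sub>R w + snd (fst p0), fst (fst (snd p0))) = \<rho>"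
    using w \<rho> by (simp add: p0_def norm_Pair)
  have "((\<lambda>p. V (norm (fst (fst p) *\<^sub>R w + snd (fst p), fst (fst (snd p)))))
      \<longlongrightarrow> V (norm (fst (fst p0) *\<^sub>R w + snd (fst p0), fst (fst (snd p0))))) (nhds p0)"
    by (rule isCont_tendsto_compose[OF DERIV_isCont[OF V_deriv]]) (use r0 \<rho> in \<open>auto intro!: tendsto_intros id\<close>)
  then have "(\<Psi> \<longlongrightarrow> \<Psi> p0) (nhds p0)"
    unfolding \<Psi>_def by (intro tendsto_intros id)
  then have "\<forall>\<^sub>F p in nhds p0. dist (\<Psi> p) (\<Psi> p0) < \<delta>"
    using \<open>0 < \<delta>\<close> by (rule tendstoD)
  then obtain d where d: "0 < d" "\<And>p. dist p p0 < d \<Longrightarrow> dist (\<Psi> p) (\<Psi> p0) < \<delta>"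
    unfolding eventually_nhds_metric by auto
  have \<Psi>0: "\<Psi> p0 = radial_state w \<rho>"
    using r0 \<rho> by (simp add: \<Psi>_def p0_def radial_state_def)
  have pair: "dist (x, y) (x', y') \<le> dist x x' + dist y y'"
    for x x' :: "'b::metric_space" and y y' :: "'c::metric_space"
    by (simp add: dist_Pair_Pair sqrt_sum_squares_le_sum)
  \<comment> \<open>\<open>\<Psi>\<close> depends on five quantities; each is allowed an error below
    d/5.\<close>
  define h where "h = min (d / 5) \<rho>"
  have "0 < h" using d(1) \<rho> by (simp add: h_def)
  note h = this min.cobounded1[of "d / 5" \<rho>, folded h_def] min.cobounded2[of "d / 5" \<rho>, folded h_def]
  define \<delta>' where "\<delta>' = min (d / 5) (min (travel (\<rho> + h) - travel \<rho>) (travel \<rho> - travel (\<rho> - h)))"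
  have "0 < \<delta>'"
    unfolding \<delta>'_def using d(1) h \<rho> travel_strict_mono[of \<rho> "\<rho> + h"] travel_strict_mono[of "\<rho> - h" \<rho>] by simp
  have \<delta>': "\<delta>' \<le> d / 5" "\<delta>' \<le> travel (\<rho> + h) - travel \<rho>" "\<delta>' \<le> travel \<rho> - travel (\<rho> - h)"
    unfolding \<delta>'_def by (simp_all only: min.cobounded1 min.coboundedI2 min.cobounded2 order_refl)
  obtain \<alpha> where \<alpha>: "0 < \<alpha>" "\<And>U a b. a \<le> b \<Longrightarrow> b \<le> a + transit_time \<rho> \<Longrightarrow> orbit V {a..b} U \<Longrightarrow>
    dist (U a) (radial_state w (- \<rho>)) < \<alpha> \<Longrightarrow>
    radius (U b) < s0 \<and> \<bar>energy V (U b) - E0\<bar> < \<delta>' \<and> norm (sgn (vel (U b)) - w) < \<delta>' \<and>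
    norm (transverse w (pos (U b))) < \<delta>' \<and> \<bar>snd (fst (U b))\<bar> < \<delta>' \<and> 0 < vel (U b) \<bullet> w \<and>
    \<bar>travel (pos (U b) \<bullet> w) - travel (- \<rho>) - (b - a)\<bar> < \<delta>'"
    using passage[OF w \<rho> \<open>0 < \<delta>'\<close>] by metis
  show ?thesis
  proof (rule that[OF \<alpha>(1)])
    fix U :: "real \<Rightarrow> 'a state" and a
    assume U: "orbit V {a..a + transit_time \<rho>} U" and near: "dist (U a) (radial_state w (- \<rho>)) < \<alpha>"
    define z where "z = U (a + transit_time \<rho>)"
    have z: "radius z < s0" "\<bar>energy V z - E0\<bar> < \<delta>'" "norm (sgn (vel z) - w) < \<delta>'"
      "norm (transverse w (pos z)) < \<delta>'" "\<bar>snd (fst z)\<bar> < \<delta>'"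
      "\<bar>travel (pos z \<bullet> w) - travel (- \<rho>) - transit_time \<rho>\<bar> < \<delta>'"
      using \<alpha>(2)[OF _ _ U near] \<open>0 < transit_time \<rho>\<close> by (simp_all add: z_def)
    have "\<bar>travel (pos z \<bullet> w) - travel \<rho>\<bar> < \<delta>'" using z(6) by (simp add: transit_time_def)
    then have "travel (pos z \<bullet> w) < travel (\<rho> + h)" "travel (\<rho> - h) < travel (pos z \<bullet> w)"
      using \<delta>' by linarith+
    moreover have "\<bar>pos z \<bullet> w\<bar> \<le> s0" using abs_axial_le_radius[OF w, of z] z(1) by linarith
    ultimately have "pos z \<bullet> w < \<rho> + h" "\<rho> - h < pos z \<bullet> w"
      using h \<rho> by (auto intro!: travel_less_imp)
    then have "\<bar>pos z \<bullet> w - \<rho>\<bar> < d / 5" using h by linarith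
    moreover define p where "p = ((pos z \<bullet> w, transverse w (pos z)), (snd (fst z), energy V z), sgn (vel z))"
    have "dist p p0 \<le> (dist (pos z \<bullet> w) \<rho> + dist (transverse w (pos z)) 0)
        + ((dist (snd (fst z)) 0 + dist (energy V z) E0) + dist (sgn (vel z)) w)"
      unfolding p_def p0_def by (intro order_trans[OF pair] add_mono order_refl pair)
    ultimately have "dist p p0 < d"
      using z \<delta>'(1) by (simp add: dist_norm)
    moreover have "\<Psi> p = z"
      using radial_decomposition[of z w] by (simp add: \<Psi>_def p_def)
    ultimately show "dist (U (a + transit_time \<rho>)) (radial_state w \<rho>) < \<delta>"
      using d(2)[of p] by (simp add: \<Psi>0 z_def)
  qed
qed

section \<open>Crossing data and colliding data\<close>

lemma abs_radius_diff_le: "\<bar>radius y - radius z\<bar> \<le> dist y z"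
  by (metis dist_fst_le dist_norm norm_triangle_ineq3 order_trans)

lemma norm_pos_diff_le:
  fixes y z :: "'a::euclidean_space state"
  shows "norm (pos y - pos z) \<le> dist y z"
  using norm_pos_le[of "y - z"] norm_fst_le[of "fst (y - z)" "snd (y - z)", unfolded prod.collapse]
  by (simp add: dist_norm)

text \<open>The condition on \<open>z\<close> is what bounds the radius from below, by the
  centrifugal barrier or by |\<epsilon>|. With the upper bound \<open>s0\<close> from the passage
  estimate, the orbit cannot leave every annulus and so lasts for the transit time.\<close>

lemma pass_through:
  fixes w :: "'a::euclidean_space"
  assumes w: "norm w = 1" and \<rho>: "0 < \<rho>" "4 * \<rho> \<le> s0" and "0 < \<delta>"
  obtains \<alpha> where "0 < \<alpha>" "\<And>z a. dist z (radial_state w (- \<rho>)) < \<alpha> \<Longrightarrow>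
    sq_momentum z \<noteq> 0 \<or> snd (fst z) \<noteq> 0 \<Longrightarrow>
    \<exists>U. U a = z \<and> orbit V {a..a + transit_time \<rho>} U \<and> dist (U (a + transit_time \<rho>)) (radial_state w \<rho>) < \<delta>"
proof -
  have "0 < transit_time \<rho>"
    unfolding transit_time_def using travel_strict_mono[of "- \<rho>" \<rho>] \<rho> by simp
  obtain \<alpha>1 where \<alpha>1: "0 < \<alpha>1" "\<And>(U :: real \<Rightarrow> 'a state) a b. a \<le> b \<Longrightarrow> b \<le> a + transit_time \<rho> \<Longrightarrow> orbit V {a..b} U \<Longrightarrow>
    dist (U a) (radial_state w (- \<rho>)) < \<alpha>1 \<Longrightarrow> radius (U b) < s0"
    using passage[OF w \<rho> zero_less_one] by metis
  obtain \<alpha>2 where \<alpha>2: "0 < \<alpha>2" "\<And>(U :: real \<Rightarrow> 'a state) a. orbit V {a..a + transit_time \<rho>} U \<Longrightarrow>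
    dist (U a) (radial_state w (- \<rho>)) < \<alpha>2 \<Longrightarrow>
    dist (U (a + transit_time \<rho>)) (radial_state w \<rho>) < \<delta>"
    using passage_exit[OF w \<rho> \<open>0 < \<delta>\<close>] by metis
  show ?thesis
  proof (rule that[of "min \<rho> (min \<alpha>1 \<alpha>2)"])
    show "0 < min \<rho> (min \<alpha>1 \<alpha>2)" using \<rho> \<alpha>1 \<alpha>2 by simp
    fix z :: "'a state" and a :: real
    assume near: "dist z (radial_state w (- \<rho>)) < min \<rho> (min \<alpha>1 \<alpha>2)"
      and ne: "sq_momentum z \<noteq> 0 \<or> snd (fst z) \<noteq> 0"
    have rz: "0 < radius z"
      using abs_radius_diff_le[of z "radial_state w (- \<rho>)"] near radial_state_simps(1)[OF w, of "- \<rho>"] \<rho>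
      by auto
    have "\<exists>U. orbit V {a..a + transit_time \<rho>} U \<and> U a = z"
    proof (rule ccontr)
      assume none: "\<nexists>U. orbit V {a..a + transit_time \<rho>} U \<and> U a = z"
      obtain \<tau> U where \<tau>: "a < \<tau>" "\<tau> \<le> a + transit_time \<rho>" and U: "orbit V {a..<\<tau>} U" "U a = z"
        and escape: "\<And>m. 0 < m \<Longrightarrow> m \<le> 1 \<Longrightarrow> \<exists>t\<in>{a..<\<tau>}. radius (U t) \<notin> {m..1/m}"
        using orbit_continuation[OF rz _ none] \<open>0 < transit_time \<rho>\<close> by (metis less_add_same_cancel1)
      have conf: "radius (U t) < s0" if t: "t \<in> {a..<\<tau>}" for t
      proof -
        have "orbit V {a..t} U" by (rule orbit_subset[OF U(1)]) (use t in auto)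
        then show ?thesis using \<alpha>1(2)[of a t U] t \<tau> near U(2) by auto
      qed
      have "\<exists>m>0. \<forall>t\<in>{a..<\<tau>}. m \<le> radius (U t)"
      proof (cases "snd (fst z) = 0")
        case True
        then have "0 < sq_momentum z" using ne sq_momentum_nonneg[of z] by (simp add: order_less_le)
        then obtain m where m: "0 < m" "\<And>y :: 'a state. 0 < radius y \<Longrightarrow> energy V y = energy V z \<Longrightarrow>
            sq_momentum z \<le> sq_momentum y \<Longrightarrow> m < radius y"
          using radius_lower_bound[of "sq_momentum z" "energy V z"] by metis
        have "m < radius (U t)" if t: "t \<in> {a..<\<tau>}" for t
          using m(2)[of "U t"] orbit_radius_pos[OF U(1) t] orbit_energy_const[OF U(1) _ t, of a]
            orbit_sq_momentum_const[OF U(1) _ t, of a] U(2) \<tau>(1) by simp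
        then show ?thesis using m(1) by (meson less_imp_le)
      next
        case False
        have "\<bar>snd (fst z)\<bar> \<le> radius (U t)" if t: "t \<in> {a..<\<tau>}" for t
        proof -
          have "snd (fst (U t)) = snd (fst z)"
            using orbit_eps_const[OF U(1) _ t, of a] U(2) \<tau>(1) by simp
          then show ?thesis by (metis norm_snd_le prod.collapse real_norm_def)
        qed
        then show ?thesis using False by (intro exI[of _ "\<bar>snd (fst z)\<bar>"]) auto
      qed
      then obtain m where m: "0 < m" "\<And>t. t \<in> {a..<\<tau>} \<Longrightarrow> m \<le> radius (U t)" by auto
      define n where "n = min (min m 1) (1 / s0)"
      have "0 < n" "n \<le> 1" "n \<le> m" unfolding n_def using m(1) s0_pos by auto
      have "n \<le> 1 / s0" unfolding n_def by (rule min.cobounded2)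
      then have "s0 \<le> 1 / n" using \<open>0 < n\<close> s0_pos by (simp add: field_simps)
      then show False
        using escape[OF \<open>0 < n\<close> \<open>n \<le> 1\<close>] conf m(2) \<open>n \<le> m\<close> by force
    qed
    then obtain U where U: "orbit V {a..a + transit_time \<rho>} U" "U a = z" by auto
    then show "\<exists>U. U a = z \<and> orbit V {a..a + transit_time \<rho>} U \<and> dist (U (a + transit_time \<rho>)) (radial_state w \<rho>) < \<delta>"
      using \<alpha>2(2)[OF U(1)] near by auto
  qed
qed

text \<open>Without momentum the position is parallel to the velocity, whose direction has inner
  product at least 1/2 with \<open>w\<close>. So the axial position can vanish only at the
  origin.\<close>

lemma radius_le_axial:
  fixes w :: "'a::euclidean_space"
  assumes w: "norm w = 1" and "sq_momentum z = 0" "snd (fst z) = 0" "vel z \<noteq> 0"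
    and dir: "norm (sgn (vel z) - w) \<le> 1 / 2"
  shows "radius z \<le> 2 * \<bar>pos z \<bullet> w\<bar>"
proof -
  define k d where "k = pos z \<bullet> sgn (vel z)" and "d = sgn (vel z)"
  have p: "pos z = k *\<^sub>R d" and "norm d = 1"
    using sq_momentum_zero_parallel[OF assms(2,4)] \<open>vel z \<noteq> 0\<close> by (auto simp: k_def d_def norm_sgn)
  have "d \<bullet> w = 1 + (d - w) \<bullet> w" using w by (simp add: inner_diff_left norm_eq_1)
  moreover have "\<bar>(d - w) \<bullet> w\<bar> \<le> 1 / 2"
    using Cauchy_Schwarz_ineq2[of "d - w" w] dir w by (simp add: d_def)
  ultimately have "1 / 2 \<le> d \<bullet> w" by linarith
  then have "\<bar>k\<bar> * (1 / 2) \<le> \<bar>k\<bar> * \<bar>d \<bullet> w\<bar>" by (intro mult_left_mono) auto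
  moreover have "radius z \<le> norm (pos z)" using radius_le[of z] assms(3) by simp
  ultimately show ?thesis using \<open>norm d = 1\<close> by (simp add: p abs_mult)
qed

text \<open>The axial position starts negative and cannot vanish while the orbit exists, as the
  radius would vanish with it. But \<open>travel\<close> keeps pace with time and would pass
  \<open>travel 0\<close> within the transit time. So the orbit ends, and with bounded radius it can
  only end at the origin.\<close>

lemma collision_nearby:
  fixes w :: "'a::euclidean_space"
  assumes w: "norm w = 1" and \<rho>: "0 < \<rho>" "4 * \<rho> \<le> s0" and "0 < \<delta>"
  obtains \<alpha> where "0 < \<alpha>" "\<And>z a. dist z (radial_state w (- \<rho>)) < \<alpha> \<Longrightarrow>
    sq_momentum z = 0 \<Longrightarrow> snd (fst z) = 0 \<Longrightarrow>
    \<exists>\<tau> U. U a = z \<and> a < \<tau> \<and> orbit V {a..<\<tau>} U \<and> ((\<lambda>t. pos (U t)) \<longlongrightarrow> 0) (at_left \<tau>) \<and>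
      \<bar>\<tau> - (a + transit_time \<rho> / 2)\<bar> < \<delta>"
proof -
  define L where "L = transit_time \<rho>"
  have "0 < L"
    unfolding L_def transit_time_def using travel_strict_mono[of "- \<rho>" \<rho>] \<rho> by simp
  have half: "travel 0 - travel (- \<rho>) = L / 2" "travel \<rho> - travel (- \<rho>) = L"
    using transit_time_half[of \<rho>] \<rho> by (auto simp: L_def transit_time_def)
  \<comment> \<open>\<delta>/2 makes up for the strict inequality lost in the limit; 1/2 is what
    \<open>radius_le_axial\<close> asks of the direction; L/2 makes survival until a + L
    contradictory, since \<open>travel\<close> would exceed its value at 0.\<close>
  define \<delta>' where "\<delta>' = min (min (\<delta> / 2) (1 / 2)) (L / 2)"
  have "0 < \<delta>'" unfolding \<delta>'_def using \<open>0 < \<delta>\<close> \<open>0 < L\<close> by simp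
  have \<delta>': "\<delta>' \<le> \<delta> / 2" "\<delta>' \<le> 1 / 2" "\<delta>' \<le> L / 2"
    unfolding \<delta>'_def by (meson min.cobounded1 min.cobounded2 order_trans)+
  obtain \<alpha>1 where \<alpha>1: "0 < \<alpha>1" "\<And>U a b. a \<le> b \<Longrightarrow> b \<le> a + transit_time \<rho> \<Longrightarrow> orbit V {a..b} U \<Longrightarrow>
    dist (U a) (radial_state w (- \<rho>)) < \<alpha>1 \<Longrightarrow>
    radius (U b) < s0 \<and> \<bar>energy V (U b) - E0\<bar> < \<delta>' \<and> norm (sgn (vel (U b)) - w) < \<delta>' \<and>
    norm (transverse w (pos (U b))) < \<delta>' \<and> \<bar>snd (fst (U b))\<bar> < \<delta>' \<and> 0 < vel (U b) \<bullet> w \<and>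
    \<bar>travel (pos (U b) \<bullet> w) - travel (- \<rho>) - (b - a)\<bar> < \<delta>'"
    using passage[OF w \<rho> \<open>0 < \<delta>'\<close>] by metis
  show ?thesis
  proof (rule that[of "min \<rho> \<alpha>1"])
    show "0 < min \<rho> \<alpha>1" using \<rho> \<alpha>1 by simp
    fix z :: "'a state" and a :: real
    assume near: "dist z (radial_state w (- \<rho>)) < min \<rho> \<alpha>1"
      and mom: "sq_momentum z = 0" and eps: "snd (fst z) = 0"
    note rs = radial_state_simps[OF w, of "- \<rho>"]
    have rz: "0 < radius z"
      using abs_radius_diff_le[of z "radial_state w (- \<rho>)"] near rs(1) \<rho> by auto
    have ax: "pos z \<bullet> w < 0"
    proof -
      have "\<bar>(pos z - pos (radial_state w (- \<rho>))) \<bullet> w\<bar> \<le> norm (pos z - pos (radial_state w (- \<rho>)))"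
        using Cauchy_Schwarz_ineq2[of _ w] w by (metis mult.right_neutral)
      also have "\<dots> \<le> dist z (radial_state w (- \<rho>))"
        by (rule norm_pos_diff_le)
      finally have "\<bar>pos z \<bullet> w + \<rho>\<bar> < \<rho>" using near rs(6) \<rho> by (simp add: inner_diff_left)
      then show ?thesis by linarith
    qed
    have facts: "radius (U t) < s0 \<and> radius (U t) \<le> 2 * \<bar>pos (U t) \<bullet> w\<bar> \<and> pos (U t) \<bullet> w < 0 \<and>
        0 < vel (U t) \<bullet> w \<and> \<bar>travel (pos (U t) \<bullet> w) - travel (- \<rho>) - (t - a)\<bar> < \<delta>'"
      if U: "orbit V {a..b} U" "U a = z" and b: "b \<le> a + L" and t: "t \<in> {a..b}" for U b t
    proof -
      have 1: "radius (U r) < s0 \<and> radius (U r) \<le> 2 * \<bar>pos (U r) \<bullet> w\<bar> \<and> 0 < vel (U r) \<bullet> w \<and>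
        \<bar>travel (pos (U r) \<bullet> w) - travel (- \<rho>) - (r - a)\<bar> < \<delta>'" if r: "r \<in> {a..b}" for r
      proof -
        have Ur: "orbit V {a..r} U" by (rule orbit_subset[OF U(1)]) (use r in auto)
        note p = \<alpha>1(2)[OF _ _ Ur]
        have p': "radius (U r) < s0" "norm (sgn (vel (U r)) - w) < \<delta>'" "0 < vel (U r) \<bullet> w"
          "\<bar>travel (pos (U r) \<bullet> w) - travel (- \<rho>) - (r - a)\<bar> < \<delta>'"
          using p near r b U(2) by (auto simp: L_def)
        have "radius (U r) \<le> 2 * \<bar>pos (U r) \<bullet> w\<bar>"
        proof (rule radius_le_axial[OF w])
          show "sq_momentum (U r) = 0"
            using orbit_sq_momentum_const[OF U(1) _ r, of a] mom U(2) r by simp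
          show "snd (fst (U r)) = 0"
            using orbit_eps_const[OF U(1) _ r, of a] eps U(2) r by simp
        qed (use p' \<delta>' in auto)
        then show ?thesis using p' by simp
      qed
      have "pos (U t) \<bullet> w < 0"
      proof (rule ccontr)
        assume "\<not> pos (U t) \<bullet> w < 0"
        moreover have "continuous_on {a..t} (\<lambda>t. pos (U t) \<bullet> w)"
          using t by (intro continuous_intros continuous_on_subset[OF orbit_continuous[OF U(1)]]) auto
        ultimately obtain r where "a \<le> r" "r \<le> t" "pos (U r) \<bullet> w = 0"
          using IVT'[of "\<lambda>t. pos (U t) \<bullet> w" a 0 t] ax U(2) t by auto
        then show False using 1[of r] orbit_radius_pos[OF U(1), of r] t by auto
      qed
      then show ?thesis using 1[OF t] by simp
    qed
    have none: "\<nexists>U. orbit V {a..a + L} U \<and> U a = z"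
    proof
      assume "\<exists>U. orbit V {a..a + L} U \<and> U a = z"
      then obtain U where U: "orbit V {a..a + L} U" "U a = z" by auto
      have f: "pos (U (a + L)) \<bullet> w < 0" "radius (U (a + L)) < s0"
        "\<bar>travel (pos (U (a + L)) \<bullet> w) - travel (- \<rho>) - L\<bar> < \<delta>'"
        using facts[OF U order_refl, of "a + L"] \<open>0 < L\<close> by auto
      have "travel (pos (U (a + L)) \<bullet> w) \<le> travel 0"
        using f(1,2) abs_axial_le_radius[OF w, of "U (a + L)"] s0_pos by (intro travel_mono) auto
      then show False using f(3) half \<delta>'(3) by linarith
    qed
    obtain \<tau> U where \<tau>: "a < \<tau>" "\<tau> \<le> a + L" and U: "orbit V {a..<\<tau>} U" "U a = z"
      and escape: "\<And>m. 0 < m \<Longrightarrow> m \<le> 1 \<Longrightarrow> \<exists>t\<in>{a..<\<tau>}. radius (U t) \<notin> {m..1/m}"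
      using orbit_continuation[OF rz _ none] \<open>0 < L\<close> by (metis less_add_same_cancel1)
    have sub: "orbit V {a..t} U" if "t < \<tau>" for t
      by (rule orbit_subset[OF U(1)]) (use that in auto)
    have F: "radius (U t) < s0" "radius (U t) \<le> 2 * \<bar>pos (U t) \<bullet> w\<bar>" "pos (U t) \<bullet> w < 0"
      "0 < vel (U t) \<bullet> w" "\<bar>travel (pos (U t) \<bullet> w) - travel (- \<rho>) - (t - a)\<bar> < \<delta>'" if "t \<in> {a..<\<tau>}" for t
      using facts[OF sub U(2), of t t] that \<tau> by auto
    have mono: "pos (U r) \<bullet> w \<le> pos (U t) \<bullet> w" if r: "a \<le> r" "r \<le> t" "t < \<tau>" for r t
    proof -
      have Urt: "orbit V {r..t} U" by (rule orbit_subset[OF U(1)]) (use r in auto)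
      have "0 * (t - r) \<le> pos (U t) \<bullet> w - pos (U r) \<bullet> w"
        by (rule mvt_lower[OF r(2) travel_orbit_deriv(1)[OF Urt _ w]])
          (use F r in \<open>auto intro: less_imp_le\<close>)
      then show ?thesis by simp
    qed
    have lim: "((\<lambda>t. pos (U t)) \<longlongrightarrow> 0) (at_left \<tau>)"
    proof (rule tendstoI)
      fix e :: real assume "0 < e"
      define n where "n = min (min (e / 2) 1) (1 / s0)"
      have "0 < n" unfolding n_def using \<open>0 < e\<close> s0_pos by auto
      have n: "n \<le> e / 2" "n \<le> 1" "n \<le> 1 / s0"
        unfolding n_def by (meson min.cobounded1 min.cobounded2 order_trans)+
      have "s0 \<le> 1 / n" using \<open>0 < n\<close> n(3) s0_pos by (simp add: field_simps)
      \<comment> \<open>One time of small radius suffices: from then on the axial distance does not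
        grow, and it bounds the radius up to the factor 2.\<close>
      then obtain r where r: "r \<in> {a..<\<tau>}" "radius (U r) < n"
        using escape[OF \<open>0 < n\<close> n(2)] F(1) by force
      have "dist (pos (U t)) 0 < e" if t: "r < t" "t < \<tau>" for t
      proof -
        have "\<bar>pos (U t) \<bullet> w\<bar> \<le> \<bar>pos (U r) \<bullet> w\<bar>"
          using mono[of r t] F(3)[of t] r t by auto
        also have "\<dots> < n" using abs_axial_le_radius[OF w, of "U r"] r by simp
        finally show ?thesis
          using F(2)[of t] norm_pos_le[of "U t"] r t n(1) by auto
      qed
      then show "\<forall>\<^sub>F t in at_left \<tau>. dist (pos (U t)) 0 < e"
        using r unfolding eventually_at_left_field by (auto intro!: exI[of _ r])
    qed
    have "((\<lambda>t. travel (pos (U t) \<bullet> w)) \<longlongrightarrow> travel (0 \<bullet> w)) (at_left \<tau>)"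
      by (rule isCont_tendsto_compose[OF travel_isCont tendsto_inner[OF lim tendsto_const]])
        (use s0_pos in simp)
    then have "((\<lambda>t. \<bar>travel (pos (U t) \<bullet> w) - travel (- \<rho>) - (t - a)\<bar>)
        \<longlongrightarrow> \<bar>travel (0 \<bullet> w) - travel (- \<rho>) - (\<tau> - a)\<bar>) (at_left \<tau>)"
      by (intro tendsto_intros)
    moreover have "\<forall>\<^sub>F t in at_left \<tau>. \<bar>travel (pos (U t) \<bullet> w) - travel (- \<rho>) - (t - a)\<bar> \<le> \<delta>'"
      using \<tau>(1) F(5) unfolding eventually_at_left_field by (auto intro!: exI[of _ a] less_imp_le)
    ultimately have "\<bar>travel (0 \<bullet> w) - travel (- \<rho>) - (\<tau> - a)\<bar> \<le> \<delta>'"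
      by (rule tendsto_upperbound) simp
    then have "\<bar>\<tau> - (a + transit_time \<rho> / 2)\<bar> < \<delta>"
      using half \<delta>'(1) \<open>0 < \<delta>\<close> by (simp add: L_def[symmetric] abs_le_iff abs_less_iff)
    then show "\<exists>\<tau> U. U a = z \<and> a < \<tau> \<and> orbit V {a..<\<tau>} U \<and> ((\<lambda>t. pos (U t)) \<longlongrightarrow> 0) (at_left \<tau>) \<and>
      \<bar>\<tau> - (a + transit_time \<rho> / 2)\<bar> < \<delta>"
      using U \<tau>(1) lim by blast
  qed
qed

text \<open>The centrifugal barrier forbids angular momentum, so near its end the orbit moves in a
  fixed direction and \<open>travel\<close> advances exactly with time. The parameter
  \<open>T'\<close> allows a late entry time \<open>T1\<close>, so that the symmetric exit time
  precedes the time of observation.\<close>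

lemma collision_orbit_radial:
  fixes U :: "real \<Rightarrow> 'a::euclidean_space state"
  assumes U: "orbit V {0..<T0} U" and "0 < T0" and lim: "((\<lambda>t. pos (U t)) \<longlongrightarrow> 0) (at_left T0)"
    and eps0: "snd (fst (U 0)) = 0" and En0: "energy V (U 0) = E0" and "T' < T0"
  obtains w \<rho> T1 where "norm w = 1" "0 < \<rho>" "4 * \<rho> \<le> s0" "0 < T1" "T' < T1" "T1 < T0"
    "U T1 = radial_state w (- \<rho>)" "transit_time \<rho> = 2 * (T0 - T1)"
proof -
  have eps: "snd (fst (U t)) = 0" if "t \<in> {0..<T0}" for t
    using orbit_eps_const[OF U _ that, of 0] eps0 \<open>0 < T0\<close> by simp
  have En: "energy V (U t) = E0" if "t \<in> {0..<T0}" for t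
    using orbit_energy_const[OF U _ that, of 0] En0 \<open>0 < T0\<close> by simp
  have rad: "radius (U t) = norm (pos (U t))" if "t \<in> {0..<T0}" for t
    using radius_le[of "U t"] norm_pos_le[of "U t"] eps[OF that] by simp
  have small: "\<exists>d<T0. \<forall>t. d < t \<longrightarrow> t < T0 \<longrightarrow> norm (pos (U t)) < e" if "0 < e" for e
    using tendstoD[OF lim that] unfolding eventually_at_left_field by auto
  have mom0: "sq_momentum (U 0) = 0"
  proof (rule ccontr)
    assume "sq_momentum (U 0) \<noteq> 0"
    then have "0 < sq_momentum (U 0)" using sq_momentum_nonneg[of "U 0"] by simp
    then obtain m where m: "0 < m" "\<And>y :: 'a state. 0 < radius y \<Longrightarrow> energy V y = E0 \<Longrightarrow>
        sq_momentum (U 0) \<le> sq_momentum y \<Longrightarrow> m < radius y"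
      using radius_lower_bound[of "sq_momentum (U 0)" E0] by metis
    obtain d where d: "d < T0" "\<And>t. d < t \<Longrightarrow> t < T0 \<Longrightarrow> norm (pos (U t)) < m"
      using small[OF m(1)] by auto
    define t where "t = (max 0 d + T0) / 2"
    have t: "t \<in> {0..<T0}" "d < t" using d(1) \<open>0 < T0\<close> by (auto simp: t_def)
    have "m < radius (U t)"
      using m(2)[of "U t"] orbit_radius_pos[OF U t(1)] En[OF t(1)] orbit_sq_momentum_const[OF U _ t(1), of 0] \<open>0 < T0\<close>
      by simp
    then show False using d(2)[of t] t rad[OF t(1)] by simp
  qed
  have mom: "sq_momentum (U t) = 0" if "t \<in> {0..<T0}" for t
    using orbit_sq_momentum_const[OF U _ that, of 0] mom0 \<open>0 < T0\<close> by simp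
  obtain d where d: "d < T0" "\<And>t. d < t \<Longrightarrow> t < T0 \<Longrightarrow> norm (pos (U t)) < s0 / 4"
    using small[of "s0 / 4"] s0_pos by auto
  define T1 where "T1 = (max (max 0 d) T' + T0) / 2"
  have T1: "0 < T1" "d < T1" "T' < T1" "T1 < T0"
    using d(1) \<open>0 < T0\<close> \<open>T' < T0\<close> by (auto simp: T1_def max_def)
  have dom: "t \<in> {0..<T0}" if "t \<in> {T1..<T0}" for t using that T1 by auto
  have s: "radius (U t) < s0 / 4" if "t \<in> {T1..<T0}" for t
    using d(2)[of t] rad[OF dom[OF that]] that T1 by simp
  have sub: "orbit V {T1..t} U" if "t \<in> {T1..<T0}" for t
    by (rule orbit_subset[OF U]) (use that T1 in auto)
  define w where "w = sgn (vel (U T1))"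
  have nz: "vel (U t) \<noteq> 0" if t: "t \<in> {T1..<T0}" for t
    using vel_sq(3)[of "U t"] En[OF dom[OF t]] orbit_radius_pos[OF U dom[OF t]] s[OF t] s0_pos by simp
  then have w: "norm w = 1" using T1 by (simp add: w_def norm_sgn)
  have dir: "sgn (vel (U t)) = w" if t: "t \<in> {T1..<T0}" for t
  proof -
    have "norm (sgn (vel (U t)) - sgn (vel (U T1)))
      \<le> (if sq_momentum (U T1) = 0 then 0 else 4 * (1 / 2) + sqrt (sq_momentum (U T1)) / s0\<^sup>2 * (t - T1))"
    proof (rule direction_estimate[OF sub[OF t] _ _ _ scale])
      show "\<bar>energy V (U T1) - E0\<bar> \<le> 1" using En[of T1] T1 by simp
      show "radius (U r) \<le> s0" if "r \<in> {T1..t}" for r using s[of r] that t s0_pos by auto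
    qed (use t in auto)
    then show ?thesis using mom[of T1] T1 by (simp add: w_def)
  qed
  define \<xi> where "\<xi> = (\<lambda>t. pos (U t) \<bullet> w)"
  have p: "pos (U t) = \<xi> t *\<^sub>R w" if t: "t \<in> {T1..<T0}" for t
    using sq_momentum_zero_parallel[OF mom[OF dom[OF t]] nz[OF t]] unfolding dir[OF t] \<xi>_def .
  have r\<xi>: "radius (U t) = \<bar>\<xi> t\<bar>" if t: "t \<in> {T1..<T0}" for t
    using rad[OF dom[OF t]] w by (simp add: p[OF t])
  have v: "vel (U t) = norm (vel (U t)) *\<^sub>R w" if t: "t \<in> {T1..<T0}" for t
    using dir[OF t] nz[OF t] by (auto simp: sgn_div_norm)
  have vw: "vel (U t) \<bullet> w = norm (vel (U t))" if t: "t \<in> {T1..<T0}" for t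
    by (subst v[OF t]) (use w in \<open>simp add: norm_eq_1\<close>)
  have s': "radius (U r) \<le> s0" if "r \<in> {T1..t}" "t \<in> {T1..<T0}" for r t
    using s[of r] that s0_pos by auto
  have limT: "((\<lambda>t. \<xi> t) \<longlongrightarrow> 0) (at_left T0)"
    using tendsto_inner[OF lim tendsto_const[of w]] by (simp add: \<xi>_def)
  have evT: "\<forall>\<^sub>F t in at_left T0. t \<in> {T1..<T0}"
    using T1(4) unfolding eventually_at_left_field by auto
  have "\<xi> T1 \<le> \<xi> t" if t: "t \<in> {T1..<T0}" for t
  proof -
    have "0 * (t - T1) \<le> \<xi> t - \<xi> T1"
      unfolding \<xi>_def
    proof (rule mvt_lower[OF _ travel_orbit_deriv(1)[OF sub[OF t] _ w]])
      show "0 \<le> vel (U r) \<bullet> w" if "r \<in> {T1..t}" for r using vw[of r] that t by simp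
    qed (use t s' in auto)
    then show ?thesis by simp
  qed
  then have "\<xi> T1 \<le> 0"
    using evT by (intro tendsto_lowerbound[OF limT]) (auto elim!: eventually_mono)
  moreover have "0 < radius (U T1)" using orbit_radius_pos[OF U, of T1] T1 by simp
  ultimately have neg: "\<xi> T1 < 0" using r\<xi>[of T1] T1 by simp
  define \<rho> where "\<rho> = - \<xi> T1"
  have \<rho>: "0 < \<rho>" "4 * \<rho> \<le> s0" using neg s[of T1] r\<xi>[of T1] T1 by (auto simp: \<rho>_def)
  have "U T1 = radial_state w (- \<rho>)"
  proof -
    have "norm (vel (U T1)) = sqrt (2 * (V \<bar>\<xi> T1\<bar> + E0))"
      using En[of T1] r\<xi>[of T1] T1 by (simp add: norm_eq_sqrt_inner energy_def)
    then show ?thesis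
      using p[of T1] v[of T1] eps[of T1] T1 by (simp add: radial_state_def \<rho>_def prod_eq_iff)
  qed
  moreover have "transit_time \<rho> = 2 * (T0 - T1)"
  proof -
    have tr: "travel (\<xi> t) - travel (\<xi> T1) = t - T1" if t: "t \<in> {T1..<T0}" for t
    proof -
      have one: "speed_inv \<bar>pos (U r) \<bullet> w\<bar> * (vel (U r) \<bullet> w) = 1" if r: "r \<in> {T1..t}" for r
      proof -
        have r': "r \<in> {T1..<T0}" using r t by auto
        show ?thesis
          using speed_ratio[of "U r" 0] orbit_radius_pos[OF U dom[OF r']] s'[OF r t] En[OF dom[OF r']]
          unfolding vw[OF r'] r\<xi>[OF r'] \<xi>_def by (simp add: mult.commute)
      qed
      have "travel (\<xi> t) - travel (\<xi> T1) \<le> 1 * (t - T1)" "1 * (t - T1) \<le> travel (\<xi> t) - travel (\<xi> T1)"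
        unfolding \<xi>_def
        by (rule mvt_upper[OF _ travel_orbit_deriv(2)[OF sub[OF t] _ w]]
            mvt_lower[OF _ travel_orbit_deriv(2)[OF sub[OF t] _ w]]; use t s' one in auto)+
      then show ?thesis by simp
    qed
    have lim1: "((\<lambda>t. travel (\<xi> t) - travel (\<xi> T1)) \<longlongrightarrow> travel 0 - travel (\<xi> T1)) (at_left T0)"
      using isCont_tendsto_compose[OF travel_isCont limT] s0_pos by (intro tendsto_intros) auto
    have lim2: "((\<lambda>t. t - T1) \<longlongrightarrow> T0 - T1) (at_left T0)"
      by (intro tendsto_intros)
    have "\<forall>\<^sub>F t in at_left T0. travel (\<xi> t) - travel (\<xi> T1) = t - T1"
      using evT by eventually_elim (rule tr)
    then have "travel 0 - travel (\<xi> T1) = T0 - T1"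
      by (intro tendsto_unique[OF trivial_limit_at_left_real Lim_transform_eventually[OF lim1] lim2])
    then show ?thesis using transit_time_half[of \<rho>] \<rho> by (simp add: \<rho>_def)
  qed
  ultimately show ?thesis using that w \<rho> T1 by blast
qed

end

section \<open>Solutions, collisions and the flow\<close>

text \<open>As V' is increasing, the mean value theorem on [s/2, s] gives (s/2) |V'(s)| \<le> V(s/2)
  - V(s). Slow variation with the single factor x = 2 makes the right side small relative to
  V.\<close>

lemma weak_singularity_class_V_star:
  assumes "V \<in> class_V_star"
  shows "weak_singularity V"
proof -
  have smooth: "smooth_pos V" and blowup: "filterlim V at_top (at_right 0)"
    and lim: "uniform_limit {1..2} (\<lambda>l x. V (l * x) / V l) (\<lambda>x. 1) (at_right 0)"
    using assms by (auto simp: class_V_star_def class_V_def)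
  obtain S where S: "admissible_S V S"
    using assms by (auto simp: class_V_star_def class_V_def)
  interpret smooth_potential V by unfold_locales (fact smooth)
  have "0 < S" using S by (simp add: admissible_S_def)
  then obtain r where r: "0 < ereal r" "ereal r < S" using ereal_dense2 by blast
  then have "0 < r" by simp
  have der: "deriv V s < 0" "0 < deriv (deriv V) s" if "0 < s" "s \<le> r" for s
  proof -
    have "ereal s < S" using that r(2) by (meson ereal_less_eq(3) order_le_less_trans)
    then show "deriv V s < 0" "0 < deriv (deriv V) s"
      using S that(1) unfolding admissible_S_def by blast+
  qed
  show ?thesis
  proof unfold_locales
    show "filterlim V at_top (at_right 0)" by (fact blowup)
    show "\<forall>\<^sub>F s in at_right 0. deriv V s < 0"
      using der(1) \<open>0 < r\<close> unfolding eventually_at_right_field by (auto intro!: exI[of _ r])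
    show "((\<lambda>s. s * deriv V s / V s) \<longlongrightarrow> 0) (at_right 0)"
    proof (rule tendstoI)
      fix e :: real assume "0 < e"
      \<comment> \<open>1/2 gives V(l) \<le> 2 V(s). The chain -s V'(s) \<le> 2 (V(l) - V(s)) \<le>
        2 e' V(l) \<le> 4 e' V(s) reaches e/2 times V(s) when e' \<le> e/8.\<close>
      define e' where "e' = min (1 / 2) (e / 8)"
      have "0 < e'" using \<open>0 < e\<close> by (simp add: e'_def)
      have e': "e' \<le> 1 / 2" "e' \<le> e / 8" unfolding e'_def by (rule min.cobounded1 min.cobounded2)+
      have "\<forall>\<^sub>F l in at_right 0. \<forall>x\<in>{1..2}. dist (V (l * x) / V l) 1 < e'"
        using uniform_limitD[OF lim \<open>0 < e'\<close>] .
      moreover have "\<forall>\<^sub>F l in at_right 0. 1 \<le> V l"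
        using blowup by (simp add: filterlim_at_top)
      ultimately have "\<forall>\<^sub>F l in at_right 0. dist (V (l * 2) / V l) 1 < e' \<and> 1 \<le> V l"
        by eventually_elim auto
      then obtain b where b: "0 < b" "\<And>l. 0 < l \<Longrightarrow> l < b \<Longrightarrow> dist (V (l * 2) / V l) 1 < e' \<and> 1 \<le> V l"
        unfolding eventually_at_right_field by auto
      have "dist (s * deriv V s / V s) 0 < e" if s: "0 < s" "s < min b r" for s
      proof -
        define l where "l = s / 2"
        have l: "0 < l" "l < s" "s = l * 2" "l < b" using s by (auto simp: l_def)
        have Vl: "\<bar>V s / V l - 1\<bar> < e'" "1 \<le> V l"
          using b(2)[OF l(1,4)] by (auto simp: dist_real_def l(3))
        have lower: "(1 - e') * V l \<le> V s"
          using Vl by (simp add: abs_less_iff field_simps)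
        moreover have "1 / 2 * V l \<le> (1 - e') * V l"
          using e'(1) Vl(2) by (intro mult_right_mono) auto
        ultimately have "1 / 2 * V l \<le> V s" by (rule order_trans[rotated])
        then have half: "V l \<le> 2 * V s" "0 < V s" using Vl(2) by auto
        obtain c where c: "l < c" "c < s" "V s - V l = (s - l) * deriv V c"
          using MVT2[of l s V "deriv V"] l V_deriv by (metis order_less_le_trans)
        have "deriv V c \<le> deriv V s"
        proof (rule DERIV_nonneg_imp_nondecreasing[of c s "deriv V"])
          fix x assume "c \<le> x" "x \<le> s"
          then show "\<exists>y. (deriv V has_real_derivative y) (at x) \<and> 0 \<le> y"
            using V_deriv2[of x] der(2)[of x] s l(1) c(1) by (intro exI[of _ "deriv (deriv V) x"]) auto
        qed (use c in simp)
        then have "l * deriv V c \<le> l * deriv V s" using l(1) by simp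
        moreover have "s - l = l" by (simp add: l_def)
        then have "V s - V l = l * deriv V c" using c(3) by (simp only:)
        moreover define p where "p = l * deriv V s"
        ultimately have "- (2 * p) \<le> 2 * (V l - V s)" by simp
        moreover have "s * deriv V s = 2 * p" by (simp add: p_def l_def)
        ultimately have "- (s * deriv V s) \<le> 2 * (V l - V s)" by (simp only:)
        also have "\<dots> \<le> 2 * (e' * V l)" using lower by (simp add: algebra_simps)
        also have "\<dots> \<le> 2 * (e' * (2 * V s))" using half(1) \<open>0 < e'\<close> by simp
        also have "\<dots> \<le> 2 * (e / 8 * (2 * V s))" using e'(2) half(2) by simp
        also have "\<dots> = e / 2 * V s" by simp
        finally have "- (s * deriv V s) / V s \<le> e / 2" using half(2) by (simp only: pos_divide_le_eq)
        moreover define q where "q = s * deriv V s / V s"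
        ultimately have "- q \<le> e / 2" by (simp only: minus_divide_left)
        moreover have "q < 0"
          using der(1)[of s] s half(2) by (simp add: q_def divide_neg_pos mult_pos_neg)
        ultimately show ?thesis using \<open>0 < e\<close> by (simp add: dist_real_def flip: q_def)
      qed
      then show "\<forall>\<^sub>F s in at_right 0. dist (s * deriv V s / V s) 0 < e"
        using b(1) \<open>0 < r\<close> unfolding eventually_at_right_field by (auto intro!: exI[of _ "min b r"])
    qed
  qed
qed

section \<open>Phase space and regularized states\<close>

definition extend :: "real \<Rightarrow> 'a \<times> 'a \<Rightarrow> 'a state" where
  "extend e y = ((fst y, e), snd y)"

definition project :: "'a state \<Rightarrow> 'a \<times> 'a" where
  "project z = (pos z, vel z)"

lemma extend_project: "snd (fst z) = e \<Longrightarrow> extend e (project z) = z"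
  by (auto simp: extend_def project_def prod_eq_iff)

lemma project_extend: "project (extend e y) = y"
  by (simp add: extend_def project_def)

lemma dist_extend:
  fixes y y' :: "'a::metric_space \<times> 'a"
  shows "dist (extend e y) (extend e' y') = dist (y, e) (y', e')"
  by (simp add: extend_def dist_prod_def algebra_simps)

lemma dist_project_le:
  fixes z z' :: "'a::metric_space state"
  shows "dist (project z) (project z') \<le> dist z z'"
  by (simp add: project_def dist_prod_def)

lemma orbit_cong:
  assumes "orbit V I W" "\<And>t. t \<in> I \<Longrightarrow> U t = W t"
  shows "orbit V I U"
  unfolding orbit_def
proof (intro ballI conjI)
  fix t assume t: "t \<in> I"
  then show "0 < radius (U t)" using assms orbit_radius_pos by metis
  have "(W has_vector_derivative newton V (W t)) (at t within I)"
    using assms(1) t by (simp add: orbit_def)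
  then show "(U has_vector_derivative newton V (U t)) (at t within I)"
    using assms(2) t by (intro has_vector_derivative_transform[of t I U W]) auto
qed

lemma has_vector_derivative_union:
  assumes "(f has_vector_derivative D) (at x within S)" "(f has_vector_derivative D) (at x within T)"
  shows "(f has_vector_derivative D) (at x within S \<union> T)"
  using assms unfolding has_vector_derivative_def has_derivative_within
  by (auto intro: Lim_Un)

lemma orbitD: "orbit V I U \<Longrightarrow> t \<in> I \<Longrightarrow> (U has_vector_derivative newton V (U t)) (at t within I)"
  by (simp add: orbit_def)

text \<open>At the junction both one-sided derivatives equal \<open>newton V\<close> of the common
  state. \<open>J\<close> is a general set to the right of \<open>b\<close>, so that the second
  piece may be closed or, for a collision, half-open.\<close>

lemma orbit_concat:
  assumes U: "orbit V {a..b} U" and W: "orbit V J W" and J: "\<And>t. t \<in> J \<Longrightarrow> b \<le> t" "b \<in> J"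
    and "U b = W b" "a \<le> b"
  shows "orbit V ({a..b} \<union> J) (\<lambda>t. if t \<le> b then U t else W t)" (is "orbit V _ ?f")
proof -
  have fU: "orbit V {a..b} ?f" by (rule orbit_cong[OF U]) auto
  have fW: "orbit V J ?f" by (rule orbit_cong[OF W]) (use J \<open>U b = W b\<close> in force)
  show ?thesis
    unfolding orbit_def
  proof (intro ballI conjI)
    fix t assume t: "t \<in> {a..b} \<union> J"
    then show "0 < radius (?f t)" using orbit_radius_pos[OF fU] orbit_radius_pos[OF fW] by blast
    consider "t < b" | "t = b" | "b < t" by linarith
    then show "(?f has_vector_derivative newton V (?f t)) (at t within {a..b} \<union> J)"
    proof cases
      case 1
      then have "at t within {a..b} \<union> J = at t within {a..b}"
        using J(1) by (intro at_within_nhd[of t "{..<b}"]) force+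
      moreover have "t \<in> {a..b}" using t 1 J(1) by force
      ultimately show ?thesis using orbitD[OF fU] by simp
    next
      case 2
      show ?thesis
        unfolding 2 by (rule has_vector_derivative_union[OF orbitD[OF fU] orbitD[OF fW]])
          (use J(2) \<open>a \<le> b\<close> in auto)
    next
      case 3
      then have "at t within {a..b} \<union> J = at t within J"
        by (intro at_within_nhd[of t "{b<..}"]) auto
      moreover have "t \<in> J" using t 3 by auto
      ultimately show ?thesis using orbitD[OF fW] by simp
    qed
  qed
qed

text \<open>Newton's equation is invariant under \<open>(x, v, t) \<mapsto> (-x, v, -t)\<close>; this makes the
  transmitted branch of a collision orbit an orbit.\<close>

lemma orbit_reflect:
  fixes U :: "real \<Rightarrow> 'a::euclidean_space state"
  assumes U: "orbit V I U" and J: "(\<lambda>t. c - t) ` J \<subseteq> I"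
  shows "orbit V J (\<lambda>t. ((- pos (U (c - t)), snd (fst (U (c - t)))), vel (U (c - t))))"
  unfolding orbit_def
proof (intro ballI conjI)
  fix t assume t: "t \<in> J"
  then have ct: "c - t \<in> I" using J by auto
  define z where "z = U (c - t)"
  have n: "norm (- pos z, snd (fst z)) = radius z"
    by (metis norm_Pair norm_minus_cancel prod.collapse)
  then show "0 < radius ((- pos (U (c - t)), snd (fst (U (c - t)))), vel (U (c - t)))"
    using orbit_radius_pos[OF U ct] by (simp add: z_def)
  have "(U has_vector_derivative newton V z) (at (c - t) within (\<lambda>t. c - t) ` J)"
    using U ct J unfolding orbit_def z_def by (meson has_vector_derivative_within_subset)
  moreover have "((\<lambda>t. c - t) has_vector_derivative - 1) (at t within J)"
    by (auto intro!: derivative_eq_intros)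
  ultimately have "((\<lambda>t. U (c - t)) has_vector_derivative - newton V z) (at t within J)"
    using vector_diff_chain_within[of "\<lambda>t. c - t" "-1" t J U "newton V z"] by (simp add: o_def)
  then have d1: "((\<lambda>t. fst (U (c - t))) has_vector_derivative - fst (newton V z)) (at t within J)"
    and d2: "((\<lambda>t. vel (U (c - t))) has_vector_derivative - snd (newton V z)) (at t within J)"
    using bounded_linear.has_vector_derivative[OF bounded_linear_fst]
      bounded_linear.has_vector_derivative[OF bounded_linear_snd] by fastforce+
  have d3: "((\<lambda>t. pos (U (c - t))) has_vector_derivative - fst (fst (newton V z))) (at t within J)"
    and d4: "((\<lambda>t. snd (fst (U (c - t)))) has_vector_derivative - snd (fst (newton V z))) (at t within J)"
    using bounded_linear.has_vector_derivative[OF bounded_linear_fst d1]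
      bounded_linear.has_vector_derivative[OF bounded_linear_snd d1] by simp_all
  have "newton V ((- pos z, snd (fst z)), vel z)
      = ((- (- fst (fst (newton V z))), - snd (fst (newton V z))), - snd (newton V z))"
    by (simp add: newton_def n)
  then show "((\<lambda>t. ((- pos (U (c - t)), snd (fst (U (c - t)))), vel (U (c - t)))) has_vector_derivative
      newton V ((- pos (U (c - t)), snd (fst (U (c - t)))), vel (U (c - t)))) (at t within J)"
    using has_vector_derivative_Pair[OF has_vector_derivative_Pair[OF has_vector_derivative_minus[OF d3] d4] d2]
    by (simp add: z_def)
qed

section \<open>The flow of the original system\<close>

context smooth_potential
begin

lemma gradient_V_eps:
  fixes x :: "real ^ 2"
  assumes s: "0 < norm (x, e)"
  shows "gradient (\<lambda>q. V_eps V e (norm q)) x = (deriv V (norm (x, e)) / norm (x, e)) *\<^sub>R x"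
proof -
  define D where "D = (deriv V (norm (x, e)) / norm (x, e)) *\<^sub>R x"
  have "((\<lambda>q. norm (q, e)) has_derivative (\<lambda>h. (h, 0) \<bullet> sgn (x, e))) (at x)"
  proof (rule has_derivative_compose[where g = norm])
    show "((\<lambda>q. (q, e)) has_derivative (\<lambda>h. (h, 0))) (at x)"
      by (auto intro!: derivative_eq_intros)
    show "(norm has_derivative (\<lambda>h. h \<bullet> sgn (x, e))) (at (x, e))"
      by (rule has_derivative_norm) (use s in auto)
  qed
  then have der: "((\<lambda>q. V (norm (q, e))) has_derivative (\<lambda>h. deriv V (norm (x, e)) * ((h, 0) \<bullet> sgn (x, e)))) (at x)"
    using has_derivative_compose[where f = "\<lambda>q. norm (q, e)" and g = V and s = UNIV and x = x,
        OF _ V_deriv[OF s, unfolded has_field_derivative_def]] by blast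
  have rhs: "(\<lambda>h. deriv V (norm (x, e)) * ((h, 0) \<bullet> sgn (x, e))) = (\<lambda>h. h \<bullet> D)"
    by (auto simp: D_def sgn_div_norm inner_prod_def fun_eq_iff field_simps)
  have "V_eps V e (norm q) = V (norm (q, e))" for q :: "real ^ 2"
    by (simp add: V_eps_def norm_Pair)
  then have g: "gderiv (\<lambda>q. V_eps V e (norm q)) x D"
    unfolding gderiv_def using has_derivative_eq_rhs[OF der rhs] by simp
  show ?thesis
    unfolding gradient_def D_def[symmetric]
  proof (rule the_equality[where P = "gderiv (\<lambda>q. V_eps V e (norm q)) x", OF g])
    fix D' assume "gderiv (\<lambda>q. V_eps V e (norm q)) x D'"
    then have "(\<lambda>h. h \<bullet> D') = (\<lambda>h. h \<bullet> D)"
      using g unfolding gderiv_def by (rule has_derivative_unique)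
    then show "D' = D" by (metis vector_eq_ldot)
  qed
qed

text \<open>The vector is lifted with third component 0, since \<epsilon> is constant in time, while
  the base point carries \<epsilon> itself.\<close>

lemma force_field_newton:
  assumes "0 < radius (extend e y)"
  shows "extend 0 (force_field V e y) = newton V (extend e y)"
  using gradient_V_eps[of "fst y" e] assms
  by (simp add: extend_def force_field_def newton_def)

lemma extend_pos_iff: "0 < radius (extend e y) \<longleftrightarrow> (e = 0 \<longrightarrow> fst y \<noteq> 0)"
  by (auto simp: extend_def prod_eq_iff zero_prod_def)

lemma bounded_linear_extend0: "bounded_linear (extend 0 :: (real ^ 2) \<times> (real ^ 2) \<Rightarrow> _)"
  unfolding extend_def
  by (intro bounded_linear_Pair bounded_linear_fst bounded_linear_snd bounded_linear_zero)

lemma bounded_linear_project: "bounded_linear (project :: (real ^ 2) state \<Rightarrow> _)"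
  unfolding project_def
  by (intro bounded_linear_Pair bounded_linear_fst_comp bounded_linear_fst bounded_linear_snd)

lemma solves_iff_orbit: "solves V e y I u \<longleftrightarrow> u 0 = y \<and> orbit V I (\<lambda>t. extend e (u t))"
proof -
  have shift: "extend e z = extend 0 z + ((0, e), 0)" for z :: phase
    by (simp add: extend_def)
  have "(u has_vector_derivative force_field V e (u t)) (at t within I) \<longleftrightarrow>
      ((\<lambda>t. extend e (u t)) has_vector_derivative newton V (extend e (u t))) (at t within I)"
    if pos: "0 < radius (extend e (u t))" for t
  proof
    assume "(u has_vector_derivative force_field V e (u t)) (at t within I)"
    then have "((\<lambda>t. extend 0 (u t)) has_vector_derivative newton V (extend e (u t))) (at t within I)"
      using bounded_linear.has_vector_derivative[OF bounded_linear_extend0] force_field_newton[OF pos]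
      by metis
    then show "((\<lambda>t. extend e (u t)) has_vector_derivative newton V (extend e (u t))) (at t within I)"
      unfolding shift by (auto intro!: derivative_eq_intros)
  next
    assume "((\<lambda>t. extend e (u t)) has_vector_derivative newton V (extend e (u t))) (at t within I)"
    then have "((\<lambda>t. project (extend e (u t))) has_vector_derivative project (newton V (extend e (u t)))) (at t within I)"
      by (rule bounded_linear.has_vector_derivative[OF bounded_linear_project])
    then show "(u has_vector_derivative force_field V e (u t)) (at t within I)"
      unfolding force_field_newton[OF pos, symmetric] project_extend .
  qed
  then show ?thesis
    unfolding solves_def orbit_def extend_pos_iff[symmetric] by blast
qed

lemma orbit_solves:
  fixes U :: "real \<Rightarrow> (real ^ 2) state"
  assumes U: "orbit V I U" and "convex I" "0 \<in> I"
  shows "solves V (snd (fst (U 0))) (project (U 0)) I (\<lambda>t. project (U t))"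
proof -
  have "extend (snd (fst (U 0))) (project (U t)) = U t" if "t \<in> I" for t
    by (rule extend_project) (rule orbit_eps_const[OF U \<open>convex I\<close> that \<open>0 \<in> I\<close>])
  then show ?thesis unfolding solves_iff_orbit using orbit_cong[OF U] by auto
qed

text \<open>By uniqueness \<open>W\<close> would follow \<open>U\<close> up to \<open>a\<close> and
  by continuity arrive at radius 0. This keeps the two clauses of \<open>flow_at\<close> from
  applying together.\<close>

lemma no_orbit_past_collision:
  fixes U W :: "real \<Rightarrow> 'a::euclidean_space state"
  assumes U: "orbit V {0..<a} U" and lim: "((\<lambda>t. pos (U t)) \<longlongrightarrow> 0) (at_left a)" and "0 < a"
    and eps: "snd (fst (U 0)) = 0" and W: "orbit V {0..a} W" "W 0 = U 0"
  shows False
proof -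
  have eq: "U t = W t" if t: "t \<in> {0..<a}" for t
  proof -
    have "orbit V {0..t} U" by (rule orbit_subset[OF U]) (use t in auto)
    moreover have "orbit V {0..t} W" by (rule orbit_subset[OF W(1)]) (use t in auto)
    ultimately show ?thesis using orbit_unique[of 0 t U W t] W(2) t by auto
  qed
  have "continuous (at a within {0..a}) (\<lambda>t. pos (W t))"
    using orbit_continuous[OF W(1)] \<open>0 < a\<close>
    by (intro continuous_intros) (simp add: continuous_on_eq_continuous_within)
  then have "((\<lambda>t. pos (W t)) \<longlongrightarrow> pos (W a)) (at_left a)"
    using \<open>0 < a\<close> by (simp add: continuous_within at_within_Icc_at_left)
  moreover have "\<forall>\<^sub>F t in at_left a. pos (U t) = pos (W t)"
    using \<open>0 < a\<close> eq unfolding eventually_at_left_field by (auto intro!: exI[of _ 0])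
  then have "((\<lambda>t. pos (W t)) \<longlongrightarrow> 0) (at_left a)"
    by (rule Lim_transform_eventually[OF lim])
  ultimately have "pos (W a) = 0"
    using tendsto_unique trivial_limit_at_left_real by blast
  moreover have "snd (fst (W a)) = 0"
    using orbit_eps_const[OF W(1), of a 0] W(2) eps \<open>0 < a\<close> by simp
  ultimately show False
    using orbit_radius_pos[OF W(1), of a] \<open>0 < a\<close> by (simp add: prod_eq_iff zero_prod_def)
qed

lemma solves_unique:
  assumes "solves V e y {0..T} u" "solves V e y {0..T} v" "t \<in> {0..T}"
  shows "u t = v t"
  using assms orbit_unique[of 0 T "\<lambda>t. extend e (u t)" "\<lambda>t. extend e (v t)" t]
  unfolding solves_iff_orbit by (metis project_extend)

lemma solves_subset: "solves V e y I u \<Longrightarrow> J \<subseteq> I \<Longrightarrow> solves V e y J u"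
  unfolding solves_iff_orbit using orbit_subset by blast

lemma collides_not_solves:
  assumes "collides V y a u" "solves V 0 y {0..b} v" "a \<le> b"
  shows False
proof -
  have u: "u 0 = y" "orbit V {0..<a} (\<lambda>t. extend 0 (u t))" "((\<lambda>t. fst (u t)) \<longlongrightarrow> 0) (at_left a)" "0 < a"
    using assms(1) unfolding collides_def solves_iff_orbit by auto
  have v: "v 0 = y" "orbit V {0..a} (\<lambda>t. extend 0 (v t))"
    using assms(2,3) orbit_subset[of V "{0..b}" _ "{0..a}"] unfolding solves_iff_orbit by auto
  show False
    by (rule no_orbit_past_collision[OF u(2) _ u(4) _ v(2)]) (use u v in \<open>auto simp: extend_def\<close>)
qed

lemma collides_unique:
  assumes "collides V y a u" "collides V y b v"
  shows "a = b" "\<And>t. t \<in> {0..<a} \<Longrightarrow> u t = v t"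
proof -
  have le: "b' \<le> a'" if "collides V y a' u'" "collides V y b' v'" for a' b' u' v'
  proof (rule ccontr)
    assume "\<not> b' \<le> a'"
    then have "solves V 0 y {0..a'} v'"
      using that(2) unfolding collides_def by (auto intro: solves_subset)
    then show False using collides_not_solves[OF that(1)] by blast
  qed
  from le[OF assms] le[OF assms(2,1)] show "a = b" by simp
  fix t assume t: "t \<in> {0..<a}"
  then have "solves V 0 y {0..t} u" "solves V 0 y {0..t} v"
    using assms \<open>a = b\<close> unfolding collides_def by (auto intro: solves_subset)
  then show "u t = v t" using solves_unique t by auto
qed

text \<open>Justifies the definite description in \<open>Phi\<close>: regular solutions agree,
  colliding ones share collision time and orbit, and a mixture is impossible.\<close>

lemma flow_at_unique:
  assumes "0 < T" "flow_at V T y e z" "flow_at V T y e z'"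
  shows "z = z'"
proof -
  have mixed: False if "solves V e y {0..T} u" "e = 0" "collides V y \<tau> v" "\<tau> < T" for u v \<tau>
    using collides_not_solves[OF that(3), of T u] that by auto
  have coll: "transmission \<tau> u T = transmission \<sigma> v T"
    if "collides V y \<tau> u" "\<tau> < T" "T < 2 * \<tau>" "collides V y \<sigma> v" for \<tau> \<sigma> u v
    using collides_unique[OF that(1,4)] that(2,3) by (simp add: transmission_def)
  have solv: "u T = v T" if "solves V e y {0..T} u" "solves V e y {0..T} v" for u v
    using solves_unique[OF that, of T] \<open>0 < T\<close> by simp
  from assms(2,3) show ?thesis
    unfolding flow_at_def using mixed coll solv by blast
qed

end

text \<open>Tolerances are fixed backwards in time: the regular arc after the exit determines the
  one for the passage, and this the one at time 0. Crossing data follow the reflected orbit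
  \<open>W\<close> after the exit; colliding data are evaluated by reflecting the arc before their
  own collision.\<close>

lemma (in collision_scale) flow_near_collision:
  assumes col: "collides V ybar T0 ubar" and En: "energy V (extend 0 ybar) = E0"
    and T: "T0 < T" "T < 2 * T0" and "0 < \<delta>"
  obtains \<alpha> where "0 < \<alpha>" "\<And>y e. dist (y, e) (ybar, 0) < \<alpha> \<Longrightarrow>
    \<exists>z. flow_at V T y e z \<and> dist z (transmission T0 ubar T) < \<delta>"
proof -
  define U where "U = (\<lambda>t. extend 0 (ubar t))"
  have "0 < T0" and u0: "ubar 0 = ybar" and U: "orbit V {0..<T0} U"
    and lim: "((\<lambda>t. pos (U t)) \<longlongrightarrow> 0) (at_left T0)"
    using col unfolding collides_def solves_iff_orbit by (auto simp: U_def extend_def)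
  have U0: "snd (fst (U 0)) = 0" "energy V (U 0) = E0" using u0 En by (auto simp: U_def extend_def)
  \<comment> \<open>The time before the collision whose reflection is \<open>T\<close>. An entry
    time \<open>T1\<close> after it makes the exit time \<open>T2\<close>, the reflection of
    \<open>T1\<close>, precede \<open>T\<close>.\<close>
  define t0 where "t0 = 2 * T0 - T"
  have t0: "0 < t0" "t0 < T0" using T by (auto simp: t0_def)
  obtain w \<rho> T1 where w: "norm w = 1" and \<rho>: "0 < \<rho>" "4 * \<rho> \<le> s0" and T1: "0 < T1" "t0 < T1" "T1 < T0"
    and UT1: "U T1 = radial_state w (- \<rho>)" and transit: "transit_time \<rho> = 2 * (T0 - T1)"
    using collision_orbit_radial[OF U \<open>0 < T0\<close> lim U0 t0(2)] by metis
  define T2 where "T2 = 2 * T0 - T1"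
  have T2: "T1 + transit_time \<rho> = T2" "T2 < T" "T1 < T2" "T1 + transit_time \<rho> / 2 = T0"
    using transit T1 by (auto simp: T2_def t0_def field_simps)
  have sub: "orbit V {0..T1} U" by (rule orbit_subset[OF U]) (use T1 in auto)
  define W where "W = (\<lambda>t. ((- pos (U (2 * T0 - t)), snd (fst (U (2 * T0 - t)))), vel (U (2 * T0 - t))))"
  have W: "orbit V {T2..T} W"
    unfolding W_def by (rule orbit_reflect[OF sub]) (use T2 t0 in \<open>auto simp: T2_def t0_def\<close>)
  have WT2: "W T2 = radial_state w \<rho>"
    using UT1 by (simp add: W_def T2_def radial_state_def)
  have WT: "project (W T) = transmission T0 ubar T"
    using T by (simp add: W_def U_def transmission_def project_def extend_def)
  obtain \<alpha>3 where \<alpha>3: "0 < \<alpha>3" "\<And>z. dist z (W T2) < \<alpha>3 \<Longrightarrow>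
      \<exists>Y. Y T2 = z \<and> orbit V {T2..T} Y \<and> (\<forall>t\<in>{T2..T}. dist (Y t) (W t) < \<delta>)"
    using orbit_dependence[OF W less_imp_le[OF T2(2)] \<open>0 < \<delta>\<close>] by metis
  obtain \<alpha>2 where \<alpha>2: "0 < \<alpha>2" "\<And>z a. dist z (radial_state w (- \<rho>)) < \<alpha>2 \<Longrightarrow>
    sq_momentum z \<noteq> 0 \<or> snd (fst z) \<noteq> 0 \<Longrightarrow>
    \<exists>Y. Y a = z \<and> orbit V {a..a + transit_time \<rho>} Y \<and> dist (Y (a + transit_time \<rho>)) (radial_state w \<rho>) < \<alpha>3"
    using pass_through[OF w \<rho> \<alpha>3(1)] by metis
  have "((\<lambda>s. U s) \<longlongrightarrow> U t0) (at t0 within {0..T1})"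
    using orbit_continuous[OF sub] t0 T1 by (simp add: continuous_on_def)
  then obtain d where d: "0 < d" "\<And>s. s \<in> {0..T1} \<Longrightarrow> dist s t0 < d \<Longrightarrow> dist (U s) (U t0) < \<delta> / 2"
    using \<open>0 < \<delta>\<close> unfolding tendsto_iff eventually_at by (metis dist_self half_gt_zero)
  \<comment> \<open>A collision time within \<kappa> of \<open>T0\<close> moves the reflected time
    2\<tau> - T by less than 2\<kappa>. The four terms give, in order: \<open>U\<close> is close to
    its value at \<open>t0\<close> there, T < 2\<tau>, \<tau> < T, and the reflected time is at most
    \<open>T1\<close>, on the regular arc.\<close>
  define \<kappa> where "\<kappa> = min (min (d / 2) (t0 / 2)) (min (T - T0) ((T1 - t0) / 2))"
  have "0 < \<kappa>" using d(1) t0 T T1 by (simp add: \<kappa>_def)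
  have \<kappa>: "\<kappa> \<le> d / 2" "\<kappa> \<le> t0 / 2" "\<kappa> \<le> T - T0" "\<kappa> \<le> (T1 - t0) / 2"
    unfolding \<kappa>_def by (meson min.cobounded1 min.cobounded2 order_trans)+
  obtain \<alpha>4 where \<alpha>4: "0 < \<alpha>4" "\<And>z a. dist z (radial_state w (- \<rho>)) < \<alpha>4 \<Longrightarrow>
    sq_momentum z = 0 \<Longrightarrow> snd (fst z) = 0 \<Longrightarrow>
    \<exists>\<tau> Y. Y a = z \<and> a < \<tau> \<and> orbit V {a..<\<tau>} Y \<and> ((\<lambda>t. pos (Y t)) \<longlongrightarrow> 0) (at_left \<tau>) \<and>
      \<bar>\<tau> - (a + transit_time \<rho> / 2)\<bar> < \<kappa>"
    using collision_nearby[OF w \<rho> \<open>0 < \<kappa>\<close>] by metis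
  have "0 < min (min \<alpha>2 \<alpha>4) (\<delta> / 2)" using \<alpha>2(1) \<alpha>4(1) \<open>0 < \<delta>\<close> by simp
  then obtain \<alpha> where \<alpha>: "0 < \<alpha>" "\<And>z. dist z (U 0) < \<alpha> \<Longrightarrow>
      \<exists>Y. Y 0 = z \<and> orbit V {0..T1} Y \<and> (\<forall>t\<in>{0..T1}. dist (Y t) (U t) < min (min \<alpha>2 \<alpha>4) (\<delta> / 2))"
    using orbit_dependence[OF sub less_imp_le[OF T1(1)]] by metis
  show ?thesis
  proof (rule that[OF \<alpha>(1)])
    fix y :: phase and e :: real assume near: "dist (y, e) (ybar, 0) < \<alpha>"
    have "dist (extend e y) (U 0) < \<alpha>" using near u0 by (simp add: U_def dist_extend)
    from \<alpha>(2)[OF this] obtain Y1 where Y1: "Y1 0 = extend e y" "orbit V {0..T1} Y1"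
      and near1: "\<And>t. t \<in> {0..T1} \<Longrightarrow> dist (Y1 t) (U t) < min (min \<alpha>2 \<alpha>4) (\<delta> / 2)"
      by auto
    have eps0: "snd (fst (Y1 0)) = e" and py: "project (Y1 0) = y"
      using Y1(1) by (simp_all add: extend_def project_def)
    have eps1: "snd (fst (Y1 T1)) = e"
      using orbit_eps_const[OF Y1(2), of T1 0] T1 eps0 by simp
    have nearT1: "dist (Y1 T1) (radial_state w (- \<rho>)) < \<alpha>2" "dist (Y1 T1) (radial_state w (- \<rho>)) < \<alpha>4"
      using near1[of T1] T1 UT1 by auto
    show "\<exists>z. flow_at V T y e z \<and> dist z (transmission T0 ubar T) < \<delta>"
    proof (cases "sq_momentum (Y1 T1) = 0 \<and> e = 0")
      case False
      then obtain Y2 where Y2: "Y2 T1 = Y1 T1" "orbit V {T1..T2} Y2" "dist (Y2 T2) (W T2) < \<alpha>3"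
        using \<alpha>2(2)[OF nearT1(1), of T1] eps1 unfolding T2(1) WT2 by auto
      obtain Y3 where Y3: "Y3 T2 = Y2 T2" "orbit V {T2..T} Y3" "dist (Y3 T) (W T) < \<delta>"
        using \<alpha>3(2)[OF Y2(3)] T2(2) by auto
      define Z where "Z = (\<lambda>t. if t \<le> T1 then Y1 t else if t \<le> T2 then Y2 t else Y3 t)"
      have "orbit V ({T1..T2} \<union> {T2..T}) (\<lambda>t. if t \<le> T2 then Y2 t else Y3 t)"
        by (rule orbit_concat[OF Y2(2) Y3(2)]) (use T2 Y3(1) in auto)
      moreover have "{T1..T2} \<union> {T2..T} = {T1..T}" using T2 by auto
      ultimately have "orbit V ({0..T1} \<union> {T1..T}) Z"
        unfolding Z_def by (intro orbit_concat[OF Y1(2)]) (use T1 T2 Y2(1) in auto)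
      moreover have "{0..T1} \<union> {T1..T} = {0..T}" using T1 T2 by auto
      ultimately have Z: "orbit V {0..T} Z" by simp
      have "Z 0 = Y1 0" using T1 by (simp add: Z_def)
      then have "solves V e y {0..T} (\<lambda>t. project (Z t))"
        using orbit_solves[OF Z] T1 T2 eps0 py by simp
      then have "flow_at V T y e (project (Z T))" unfolding flow_at_def by blast
      moreover have "Z T = Y3 T" using T2 by (simp add: Z_def)
      then have "dist (project (Z T)) (transmission T0 ubar T) < \<delta>"
        using dist_project_le[of "Y3 T" "W T"] Y3(3) WT by simp
      ultimately show ?thesis by blast
    next
      case True
      then obtain \<tau> Y2 where Y2: "Y2 T1 = Y1 T1" "T1 < \<tau>" "orbit V {T1..<\<tau>} Y2"
        "((\<lambda>t. pos (Y2 t)) \<longlongrightarrow> 0) (at_left \<tau>)" "\<bar>\<tau> - T0\<bar> < \<kappa>"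
        using \<alpha>4(2)[OF nearT1(2), of T1] eps1 unfolding T2(4) by auto
      define Z where "Z = (\<lambda>t. if t \<le> T1 then Y1 t else Y2 t)"
      have "orbit V ({0..T1} \<union> {T1..<\<tau>}) Z"
        unfolding Z_def by (intro orbit_concat[OF Y1(2) Y2(3)]) (use T1 Y2(1,2) in auto)
      moreover have "{0..T1} \<union> {T1..<\<tau>} = {0..<\<tau>}" using T1 Y2(2) by auto
      ultimately have Z: "orbit V {0..<\<tau>} Z" by simp
      have "Z 0 = Y1 0" using T1 by (simp add: Z_def)
      then have "solves V e y {0..<\<tau>} (\<lambda>t. project (Z t))"
        using orbit_solves[OF Z] T1 Y2(2) eps0 py by simp
      moreover have "\<forall>\<^sub>F t in at_left \<tau>. pos (Y2 t) = fst (project (Z t))"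
        using Y2(2) unfolding eventually_at_left_field by (auto intro!: exI[of _ T1] simp: Z_def project_def)
      then have "((\<lambda>t. fst (project (Z t))) \<longlongrightarrow> 0) (at_left \<tau>)"
        by (rule Lim_transform_eventually[OF Y2(4)])
      ultimately have "collides V y \<tau> (\<lambda>t. project (Z t))"
        using True T1 Y2(2) by (simp add: collides_def)
      moreover have \<tau>: "\<tau> < T" "T < 2 * \<tau>" using Y2(5) \<kappa>(2,3) by (auto simp: t0_def)
      ultimately have "flow_at V T y e (transmission \<tau> (\<lambda>t. project (Z t)) T)"
        unfolding flow_at_def using True by blast
      moreover have "dist (transmission \<tau> (\<lambda>t. project (Z t)) T) (transmission T0 ubar T) < \<delta>"
      proof -
        define s where "s = 2 * \<tau> - T"
        have st: "\<bar>s - t0\<bar> < 2 * \<kappa>" using Y2(5) by (simp add: s_def t0_def)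
        then have s: "s \<in> {0..T1}" using \<kappa>(2,4) by auto
        have "dist s t0 < d" using st \<kappa>(1) by (simp add: dist_real_def)
        then have "dist (U s) (U t0) < \<delta> / 2" using d(2)[OF s] by simp
        moreover have "dist (Y1 s) (U s) < \<delta> / 2" using near1[OF s] by simp
        ultimately have "dist (Y1 s) (U t0) < \<delta>" using dist_triangle_half_r[of "U s" "Y1 s" \<delta> "U t0"]
          by (simp add: dist_commute)
        moreover have "dist (- pos (Y1 s)) (- pos (U t0)) = dist (pos (Y1 s)) (pos (U t0))"
          by (simp add: dist_norm norm_minus_commute)
        then have "dist (- pos (Y1 s), vel (Y1 s)) (- pos (U t0), vel (U t0)) \<le> dist (Y1 s) (U t0)"
          using dist_project_le[of "Y1 s" "U t0"] by (simp only: project_def dist_Pair_Pair)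
        moreover have "transmission \<tau> (\<lambda>t. project (Z t)) T = (- pos (Y1 s), vel (Y1 s))"
          using \<tau> s by (simp add: transmission_def s_def Z_def project_def)
        moreover have "transmission T0 ubar T = (- pos (U t0), vel (U t0))"
          using T by (simp add: transmission_def t0_def U_def extend_def)
        ultimately show ?thesis by simp
      qed
      ultimately show ?thesis by blast
    qed
  qed
qed

theorem theorem3:
  fixes V :: "real \<Rightarrow> real" and S Ts :: ereal
    and ybar :: phase and ubar :: "real \<Rightarrow> phase" and T0 T :: real
  assumes "V \<in> class_V_star"
    and "admissible_S V S" and "admissible_T V Ts"
    and "ereal (norm (fst ybar)) \<le> min Ts S"
    and "collides V ybar T0 ubar"
    and "\<forall>t\<in>{0..<T0}. ereal (norm (fst (ubar t))) \<le> min Ts S"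
    and "T0 < T" and "T < 2 * T0"
    and "snd (transmission T0 ubar T) \<noteq> 0"
  shows "(\<forall>\<^sub>F (y, \<epsilon>) in inf (nhds (ybar, 0)) (principal (UNIV \<times> {0..})). \<exists>!z. flow_at V T y \<epsilon> z)
    \<and> ((\<lambda>(y, \<epsilon>). Phi V T y \<epsilon>) \<longlongrightarrow> Phi V T ybar 0) (at (ybar, 0) within UNIV \<times> {0..})"
proof -
  interpret weak_singularity V by (rule weak_singularity_class_V_star[OF assms(1)])
  have "0 < T" using assms(5,7) by (simp add: collides_def)
  obtain s0 where "small_scale (energy V (extend 0 ybar)) (1 / 2) s0"
    using small_scale_exists[of "1 / 2"] by auto
  then interpret collision_scale V "energy V (extend 0 ybar)" s0 by unfold_locales
  \<comment> \<open>Both the existence of the flow at time \<open>T\<close> for nearby data and the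
    limit come from this one statement.\<close>
  have near: "\<exists>\<alpha>>0. \<forall>y e. dist (y, e) (ybar, 0) < \<alpha> \<longrightarrow>
      (\<exists>z. flow_at V T y e z \<and> dist z (transmission T0 ubar T) < \<delta>)" if "0 < \<delta>" for \<delta>
    using flow_near_collision[OF assms(5) refl assms(7,8) that] by metis
  have Phi: "Phi V T y e = z" if "flow_at V T y e z" for y e z
    unfolding Phi_def using that flow_at_unique[OF \<open>0 < T\<close>] by (intro the_equality) auto
  have Phi0: "Phi V T ybar 0 = transmission T0 ubar T"
    by (rule Phi) (use assms(5,7,8) in \<open>auto simp: flow_at_def\<close>)
  show ?thesis
  proof
    obtain \<alpha> where "0 < \<alpha>" and \<alpha>: "\<And>y e. dist (y, e) (ybar, 0) < \<alpha> \<Longrightarrow> \<exists>z. flow_at V T y e z"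
      using near[OF zero_less_one] by metis
    have ex1: "\<exists>!z. flow_at V T y e z" if "dist (y, e) (ybar, 0) < \<alpha>" for y e
      using \<alpha>[OF that] flow_at_unique[OF \<open>0 < T\<close>] by metis
    show "\<forall>\<^sub>F (y, \<epsilon>) in inf (nhds (ybar, 0)) (principal (UNIV \<times> {0..})). \<exists>!z. flow_at V T y \<epsilon> z"
      unfolding eventually_inf_principal eventually_nhds_metric
    proof (intro exI[of _ \<alpha>] conjI allI impI)
      fix p :: "phase \<times> real" assume "dist p (ybar, 0) < \<alpha>"
      then show "case p of (y, \<epsilon>) \<Rightarrow> \<exists>!z. flow_at V T y \<epsilon> z"
        using ex1[of "fst p" "snd p"] by (simp only: case_prod_beta prod.collapse)
    qed (fact \<open>0 < \<alpha>\<close>)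
    show "((\<lambda>(y, \<epsilon>). Phi V T y \<epsilon>) \<longlongrightarrow> Phi V T ybar 0) (at (ybar, 0) within UNIV \<times> {0..})"
    proof (rule tendstoI)
      fix \<delta> :: real assume "0 < \<delta>"
      obtain \<beta> where "0 < \<beta>" and \<beta>: "\<And>y e. dist (y, e) (ybar, 0) < \<beta> \<Longrightarrow>
          \<exists>z. flow_at V T y e z \<and> dist z (transmission T0 ubar T) < \<delta>"
        using near[OF \<open>0 < \<delta>\<close>] by metis
      have "dist (Phi V T y e) (Phi V T ybar 0) < \<delta>" if near: "dist (y, e) (ybar, 0) < \<beta>" for y e
      proof -
        obtain z where "flow_at V T y e z" "dist z (transmission T0 ubar T) < \<delta>"
          using \<beta>[OF near] by blast
        then show ?thesis using Phi[of y e z] Phi0 by simp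
      qed
      then show "\<forall>\<^sub>F p in at (ybar, 0) within UNIV \<times> {0..}.
          dist (case p of (y, \<epsilon>) \<Rightarrow> Phi V T y \<epsilon>) (Phi V T ybar 0) < \<delta>"
        using \<open>0 < \<beta>\<close> unfolding eventually_at by (auto intro!: exI[of _ \<beta>])
    qed
  qed
qed

end
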